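(* For every $n\ge1$ let $\mathbf{x}^n=(\mathrm x^n_i)_{i\ge1}\in\{-1,+1\}^{\mathbb N}$ be a sequence such that $\tau(\mathbf{x}^n)>n$. Write $\mathcal T_n=\mathcal T_n(\mathbf{x}^n)$, $S^n_k=S_k(\mathbf{x}^n)$ for $0\le k\le n$, and $\mathsf h^+_n=\sum_{i=1}^n\frac{1}{S^n_i}\mathbf 1_{\{\mathrm x^n_i=1\}}$. Let $c\in(0,1]$. Let $(A_n)_{n\in\mathbb N}$ be a sequence of positive numbers such that $A_n\to\infty$ and $A_n=o(\log n)$ as $n\to\infty$. Assume that $$\lim_{\varepsilon\to0}\limsup_{n\to\infty}\max_{A_n\le i\le\varepsilon n}\left|\frac{S^n_i}{i}-c\right|=0\qquad\text{and}\qquad\forall\varepsilon\in(0,1),\quad \liminf_{n\to\infty}\min_{\varepsilon n\le i\le n}\frac{S^n_i}{n}>0 .$$ Then the following assertions hold. (I) We have $\displaystyle\frac{\mathsf h^+_n}{\ln n}\longrightarrow\frac{c+1}{2c}$ as $n\to\infty$. (II) For all $n\ge1$, conditionally given $\mathcal T_n$, let $V^n_1$ and $V^n_2$ be independent uniform vertices of $\mathcal T_n$. Then for every $p\ge1$, as $n\to\infty$, $$\frac{\mathsf H(V^n_1)}{\ln n}\longrightarrow\frac{c+1}{2c}\ \text{ in }\mathbb L^p\qquad\text{and}\qquad \frac{d^n(V^n_1,V^n_2)}{\ln n}\longrightarrow\frac{c+1}{c}\ \text{ in }\mathbb L^p,$$ where $\mathsf H(V^n_1)$ is the height of $V^n_1$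 in $\mathcal T_n$ and $d^n$ denotes the graph distance in $\mathcal T_n$. (III) We have $$\frac{\mathsf{Height}(\mathcal T_n)}{\ln(n)}\longrightarrow\frac{c+1}{2c}f(c)\quad\text{in probability as }n\to\infty,$$ where $f(c)$ is the unique solution with $f(c)>1$ to $f(c)(\ln f(c)-1)=(c-1)/(c+1)$.
   Context: $\mathbb N=\{1,2,3,\dots\}$. For $\mathbf{x}=(\mathrm x_i)_{i\ge1}\in\{-1,+1\}^{\mathbb N}$ set $S_0(\mathbf{x})=1$, $S_n(\mathbf{x})=1+\sum_{i=1}^n \mathrm x_i$, and $\tau(\mathbf{x})=\inf\{n\ge1: S_n(\mathbf{x})=0\}$ (with $\inf\varnothing=\infty$). Maxima and minima over $i$ are over integers. Uniform attachment with freezing (Algorithm 1). Given $\mathbf{x}$, random rooted, labelled trees $(\mathcal T_n(\mathbf{x}))_{n\ge0}$ are built recursively. $\mathcal T_0(\mathbf{x})$ is a single root vertex labelled $a$. For $n\ge1$, if $\mathcal T_{n-1}(\mathbf{x})$ has no vertex labelled $a$, set $\mathcal T_n(\mathbf{x})=\mathcal T_{n-1}(\mathbf{x})$. Otherwise let $V_n$ be a uniformly random vertex labelled $a$ ("active" vertex) of $\mathcal T_{n-1}(\mathbf{x})$, chosen independently of the previous choices; if $\mathrm x_n=-1$, $\mathcal T_n(\mathbf{x})$ is obtained by replacing the label $a$ of $V_n$ by $n$ (the vertex is "frozen"); if $\mathrm x_n=+1$, $\mathcal T_n(\mathbf{x})$ is obtained by adding an edge labelled $n$ between $V_n$ and a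 new vertex labelled $a$. The height of a vertex is its graph distance to the root, and $\mathsf{Height}(T)$ is the maximal height of a vertex of $T$. *)

theory Defs
  imports "HOL-Probability.Probability" "HOL-Library.Landau_Symbols"
begin

text \<open>Sequences are functions on \<^typ>\<open>nat\<close>; the value at index 0 is never used.\<close>

definition walk :: "(nat \<Rightarrow> int) \<Rightarrow> nat \<Rightarrow> int" where
  "walk x n = 1 + (\<Sum>i=1..n. x i)"

definition tau :: "(nat \<Rightarrow> int) \<Rightarrow> enat" where
  "tau x = Inf {enat n | n. 1 \<le> n \<and> walk x n = 0}"

definition h_plus :: "(nat \<Rightarrow> int) \<Rightarrow> nat \<Rightarrow> real" where
  "h_plus x n = (\<Sum>i=1..n. 1 / real_of_int (walk x i) * indicator {j. x j = 1} i)"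

datatype vlabel = Active | Frozen nat

text \<open>
  The vertices are the natural numbers in the domain of the vertex labelling; the root is the
  vertex 0 and a vertex added at step \<open>n\<close> is named \<open>n\<close>. These names are independent of the labels.
  The edges are the two-element vertex sets in the domain of the edge labelling.
\<close>

record lab_tree =
  vlab :: "nat \<rightharpoonup> vlabel"
  elab :: "nat set \<rightharpoonup> nat"

definition verts :: "lab_tree \<Rightarrow> nat set" where
  "verts T = dom (vlab T)"

definition edges :: "lab_tree \<Rightarrow> nat set set" where
  "edges T = dom (elab T)"

definition active :: "lab_tree \<Rightarrow> nat set" where
  "active T = {v. vlab T v = Some Active}"

definition root_tree :: lab_tree where
  "root_tree = \<lparr>vlab = [0 \<mapsto> Active], elab = Map.empty\<rparr>"

definition freeze :: "nat \<Rightarrow> nat \<Rightarrow> lab_tree \<Rightarrow> lab_tree" where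
  "freeze n v T = T\<lparr>vlab := (vlab T)(v \<mapsto> Frozen n)\<rparr>"

definition attach :: "nat \<Rightarrow> nat \<Rightarrow> lab_tree \<Rightarrow> lab_tree" where
  "attach n v T = T\<lparr>vlab := (vlab T)(n \<mapsto> Active), elab := (elab T)({v, n} \<mapsto> n)\<rparr>"

definition step :: "(nat \<Rightarrow> int) \<Rightarrow> nat \<Rightarrow> lab_tree \<Rightarrow> lab_tree pmf" where
  "step x n T =
     (if active T = {} then return_pmf T
      else map_pmf (\<lambda>v. if x n = -1 then freeze n v T else attach n v T)
             (pmf_of_set (active T)))"

text \<open>The law of the \<open>n\<close>-th tree of the chain with transition kernels \<^term>\<open>step x\<close>.\<close>

primrec tree_law :: "(nat \<Rightarrow> int) \<Rightarrow> nat \<Rightarrow> lab_tree pmf" where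
  "tree_law x 0 = return_pmf root_tree"
| "tree_law x (Suc n) = bind_pmf (tree_law x n) (step x (Suc n))"

text \<open>The joint law of the tree and two conditionally independent uniform vertices of it.\<close>

definition tree_vertices_law :: "(nat \<Rightarrow> int) \<Rightarrow> nat \<Rightarrow> (lab_tree \<times> nat \<times> nat) pmf" where
  "tree_vertices_law x n =
     bind_pmf (tree_law x n) (\<lambda>T.
       map_pmf (Pair T) (pair_pmf (pmf_of_set (verts T)) (pmf_of_set (verts T))))"

definition adj :: "lab_tree \<Rightarrow> (nat \<times> nat) set" where
  "adj T = {(u, v). {u, v} \<in> edges T}"

text \<open>The relation \<open>adj T ^^ k\<close> relates the endpoints of walks of length \<open>k\<close>.\<close>

definition gdist :: "lab_tree \<Rightarrow> nat \<Rightarrow> nat \<Rightarrow> nat" where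
  "gdist T u v = (LEAST k. (u, v) \<in> adj T ^^ k)"

definition vheight :: "lab_tree \<Rightarrow> nat \<Rightarrow> nat" where
  "vheight T v = gdist T v 0"

definition Height :: "lab_tree \<Rightarrow> nat" where
  "Height T = Max (vheight T ` verts T)"

text \<open>
  Convergence to a constant, where the \<open>n\<close>-th random variable \<open>X n\<close> lives on its own discrete
  probability space \<open>M n\<close>.
\<close>

definition tendsto_Lp :: "real \<Rightarrow> (nat \<Rightarrow> 'a pmf) \<Rightarrow> (nat \<Rightarrow> 'a \<Rightarrow> real) \<Rightarrow> real \<Rightarrow> bool" where
  "tendsto_Lp p M X l \<longleftrightarrow>
     (\<forall>n. integrable (measure_pmf (M n)) (\<lambda>\<omega>. \<bar>X n \<omega>\<bar> powr p)) \<and>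
     (\<lambda>n. measure_pmf.expectation (M n) (\<lambda>\<omega>. \<bar>X n \<omega> - l\<bar> powr p)) \<longlonglongrightarrow> 0"

definition tendsto_prob :: "(nat \<Rightarrow> 'a pmf) \<Rightarrow> (nat \<Rightarrow> 'a \<Rightarrow> real) \<Rightarrow> real \<Rightarrow> bool" where
  "tendsto_prob M X l \<longleftrightarrow>
     (\<forall>\<epsilon>>0. (\<lambda>n. measure_pmf.prob (M n) {\<omega>. \<bar>X n \<omega> - l\<bar> > \<epsilon>}) \<longlonglongrightarrow> 0)"

definition is_f :: "real \<Rightarrow> real \<Rightarrow> bool" where
  "is_f c y \<longleftrightarrow> y > 1 \<and> y * (ln y - 1) = (c - 1) / (c + 1)"

definition f_sol :: "real \<Rightarrow> real" where
  "f_sol c = (THE y. is_f c y)"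

end

theory Submission
  imports Defs
begin

text \<open>
  Weighting a vertex of height \<open>h\<close> by \<open>z ^ h\<close>, the expected total weight of the active vertices at
  time \<open>k\<close> is \<open>S k * (\<Prod>i\<le>k, x i = 1. 1 + (z - 1) / S i)\<close>, so the height of a uniform vertex has the
  exponential moments of a sum of independent Bernoulli variables of parameters \<open>1 / S i\<close>; it
  concentrates around \<open>h_plus\<close>, which is asymptotic to \<open>l ln n\<close> with \<open>l = (c + 1) / (2 c)\<close>.
  Two uniform vertices descend from different vertices of the tree at time \<open>m = \<lceil>A n\<rceil>\<close> with high
  probability, because the coalescence probabilities are of order \<open>1 / (S i)\<^sup>2\<close>, and that tree has
  height at most \<open>m = o(ln n)\<close>; hence their distance is asymptotically twice the height.
  For the maximal height, the upper bound is the first moment bound with \<open>z = f(c)\<close>. For the lower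
  bound, heights are counted from time \<open>m\<close> on, where the number of active vertices is already large:
  for \<open>z < f(c)\<close> the normalised total weight is a martingale which is bounded in \<open>L\<^sup>q\<close> for some
  \<open>q > 1\<close> and tends to 1, and comparing it with the total weight for a smaller \<open>z'\<close> shows that
  vertices of height at least \<open>a l ln n\<close> exist for every \<open>a < z'\<close>.
\<close>

section \<open>Parents, heights and distances in a tree\<close>

text \<open>The equation of \<open>f = f(c)\<close> is equivalent to
  \<open>1 + l (f - 1) - l f ln f = 0\<close>, and the left-hand side is the exponent of
  \<open>n\<close> in the first moment bound at height \<open>l f ln n\<close>. On the other side,
  the martingale increment at time \<open>i\<close> has a \<open>q\<close>-th moment of order at
  most about \<open>i powr (l k - q)\<close> with \<open>k = z powr q - 1 - q (z - 1)\<close>; for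
  \<open>z > 1\<close> this is summable for some \<open>q > 1\<close> close to 1 exactly when
  \<open>z < f\<close>. Second moments do not suffice: \<open>q = 2\<close> asks for
  \<open>l (z - 1)\<^sup>2 < 1\<close>, which fails before \<open>z\<close> reaches
  \<open>f\<close>. Starting at time \<open>m\<close> serves two purposes. Before \<open>A n\<close>
  only \<open>S i \<ge> 1\<close> is known; and the sum of the moments of the increments becomes the
  tail of a convergent series, so no separate argument for a nonzero limit of the martingale is
  needed. The lower bound stops at time \<open>\<epsilon> n\<close>, because only up to there is
  \<open>S i / i\<close> known to be close to \<open>c\<close>; later steps change
  \<open>h_plus\<close> by a bounded amount and never lower the height.\<close>

definition par :: "lab_tree \<Rightarrow> nat \<Rightarrow> nat" where
  "par T v = (THE u. u < v \<and> {u, v} \<in> edges T)"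

text \<open>Names increase away from the root, so the parent is the neighbour with the smaller name
  and the genealogy is read off the edges alone. The recursion stops at the first ancestor already
  present at time \<open>m\<close>, which \<open>anc m\<close> returns: \<open>rdep 0\<close> is the
  height, \<open>rdep m\<close> counts only edges added after time \<open>m\<close>. The guard
  \<open>v \<le> par T v\<close> is there for termination on records that are not trees.\<close>

function rdep :: "nat \<Rightarrow> lab_tree \<Rightarrow> nat \<Rightarrow> nat" where
  "rdep m T v = (if v \<le> m \<or> v \<le> par T v then 0 else Suc (rdep m T (par T v)))"
  by pat_completeness auto
termination by (relation "Wellfounded.measure (\<lambda>(m, T, v). v)") auto

function anc :: "nat \<Rightarrow> lab_tree \<Rightarrow> nat \<Rightarrow> nat" where
  "anc m T v = (if v \<le> m \<or> v \<le> par T v then v else anc m T (par T v))"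
  by pat_completeness auto
termination by (relation "Wellfounded.measure (\<lambda>(m, T, v). v)") auto

declare rdep.simps [simp del] anc.simps [simp del]

text \<open>The clause on a unique smaller neighbour stands for connectedness and absence of cycles
  at once, and it makes \<open>par\<close> well defined.\<close>

definition wf_tree :: "nat \<Rightarrow> lab_tree \<Rightarrow> bool" where
  "wf_tree k T \<longleftrightarrow> verts T \<subseteq> {..k} \<and> 0 \<in> verts T
     \<and> (\<forall>v\<in>verts T. 0 < v \<longrightarrow> (\<exists>!u. u < v \<and> {u, v} \<in> edges T))
     \<and> (\<forall>u v. {u, v} \<in> edges T \<longrightarrow> u \<noteq> v \<and> u \<in> verts T \<and> v \<in> verts T)"

lemma active_subset_verts: "active T \<subseteq> verts T"
  by (auto simp: active_def verts_def)

lemma wf_treeD: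
  assumes "wf_tree k T"
  shows "verts T \<subseteq> {..k}" "0 \<in> verts T" "finite (verts T)" "finite (active T)"
    "{u, v} \<in> edges T \<Longrightarrow> u \<noteq> v \<and> u \<in> verts T \<and> v \<in> verts T"
proof -
  show v: "verts T \<subseteq> {..k}" and "0 \<in> verts T" using assms by (auto simp: wf_tree_def)
  show f: "finite (verts T)" by (rule finite_subset[OF v finite_atMost])
  show "finite (active T)" by (rule finite_subset[OF active_subset_verts f])
  show "{u, v} \<in> edges T \<Longrightarrow> u \<noteq> v \<and> u \<in> verts T \<and> v \<in> verts T"
    using assms unfolding wf_tree_def by blast
qed

lemma par_props:
  assumes "wf_tree k T" "v \<in> verts T" "0 < v"
  shows "par T v < v" "{par T v, v} \<in> edges T" "par T v \<in> verts T"
proof -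
  have "\<exists>!u. u < v \<and> {u, v} \<in> edges T" using assms by (auto simp: wf_tree_def)
  from theI'[OF this] show *: "par T v < v" "{par T v, v} \<in> edges T" by (auto simp: par_def)
  show "par T v \<in> verts T" using wf_treeD(5)[OF assms(1) *(2)] by simp
qed

lemma par_eqI:
  assumes "wf_tree k T" "{u, v} \<in> edges T" "u < v"
  shows "par T v = u"
proof -
  have "v \<in> verts T" using assms wf_treeD(5) by blast
  hence "\<exists>!u. u < v \<and> {u, v} \<in> edges T" using assms by (auto simp: wf_tree_def)
  thus ?thesis using assms unfolding par_def by (intro the1_equality) auto
qed

lemma verts_root [simp]: "verts root_tree = {0}"
  and active_root [simp]: "active root_tree = {0}"
  and edges_root [simp]: "edges root_tree = {}"
  by (auto simp: verts_def active_def edges_def root_tree_def)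

lemma verts_freeze: "v \<in> verts T \<Longrightarrow> verts (freeze n v T) = verts T"
  and active_freeze [simp]: "active (freeze n v T) = active T - {v}"
  and edges_freeze [simp]: "edges (freeze n v T) = edges T"
  by (auto simp: verts_def active_def edges_def freeze_def)

lemma verts_attach [simp]: "verts (attach n v T) = insert n (verts T)"
  and active_attach [simp]: "active (attach n v T) = insert n (active T)"
  and edges_attach [simp]: "edges (attach n v T) = insert {v, n} (edges T)"
  by (auto simp: verts_def active_def edges_def attach_def)

lemma wf_root: "wf_tree 0 root_tree"
  by (auto simp: wf_tree_def)

lemma wf_mono: "wf_tree k T \<Longrightarrow> k \<le> k' \<Longrightarrow> wf_tree k' T"
  by (auto simp: wf_tree_def)

lemma wf_freeze: "wf_tree k T \<Longrightarrow> v \<in> verts T \<Longrightarrow> wf_tree k (freeze n v T)"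
  unfolding wf_tree_def by (simp add: verts_freeze)

lemma par_freeze [simp]: "par (freeze n v T) = par T"
  by (rule ext) (simp add: par_def)

lemma par_attach:
  assumes "w \<le> k" shows "par (attach (Suc k) v T) w = par T w"
proof -
  have "u < w \<Longrightarrow> {u, w} \<noteq> {v, Suc k}" for u using assms by (auto simp: doubleton_eq_iff)
  thus ?thesis unfolding par_def by (intro arg_cong[where f=The] ext) auto
qed

lemma wf_attach:
  assumes wf: "wf_tree k T" and v: "v \<in> verts T"
  shows "wf_tree (Suc k) (attach (Suc k) v T)"
proof -
  have vk: "v \<le> k" and vs: "verts T \<subseteq> {..k}" using wf v by (auto simp: wf_tree_def)
  have e: "{u, Suc k} \<notin> edges T" for u using wf_treeD(5)[OF wf, of u "Suc k"] vs by auto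
  have 1: "\<exists>!u. u < w \<and> {u, w} \<in> insert {v, Suc k} (edges T)"
    if w: "w \<in> insert (Suc k) (verts T)" "0 < w" for w
  proof (cases "w = Suc k")
    case True
    thus ?thesis using e vk by (intro ex1I[of _ v]) (auto simp: doubleton_eq_iff)
  next
    case False
    hence wv: "w \<in> verts T" "w \<le> k" using w vs by auto
    have ne: "u < w \<Longrightarrow> {u, w} \<noteq> {v, Suc k}" for u using wv by (auto simp: doubleton_eq_iff)
    have "\<exists>!u. u < w \<and> {u, w} \<in> edges T" using wf wv(1) w(2) unfolding wf_tree_def by blast
    moreover have "(u < w \<and> {u, w} \<in> insert {v, Suc k} (edges T)) \<longleftrightarrow> (u < w \<and> {u, w} \<in> edges T)" for u
      using ne[of u] by blast
    ultimately show ?thesis by simp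
  qed
  have 2: "u \<noteq> w \<and> u \<in> insert (Suc k) (verts T) \<and> w \<in> insert (Suc k) (verts T)"
    if uw: "{u, w} \<in> insert {v, Suc k} (edges T)" for u w
    proof -
    consider "{u, w} \<in> edges T" | "{u, w} = {v, Suc k}" using uw by blast
    thus ?thesis
    proof cases
      case 1
      thus ?thesis using wf_treeD(5)[OF wf, of u w] by blast
    next
      case 2
      thus ?thesis using v vk by (auto simp: doubleton_eq_iff)
    qed
  qed
  show ?thesis unfolding wf_tree_def verts_attach edges_attach
  proof (intro conjI ballI impI allI)
    show "insert (Suc k) (verts T) \<subseteq> {..Suc k}" using vs by auto
    show "0 \<in> insert (Suc k) (verts T)" using wf_treeD(2)[OF wf] by simp
  next
    fix w assume "w \<in> insert (Suc k) (verts T)" "0 < w"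
    thus "\<exists>!u. u < w \<and> {u, w} \<in> insert {v, Suc k} (edges T)" by (rule 1)
  next
    fix u w assume "{u, w} \<in> insert {v, Suc k} (edges T)"
    from 2[OF this] show "u \<noteq> w" "u \<in> insert (Suc k) (verts T)" "w \<in> insert (Suc k) (verts T)" by blast+
  qed
qed

lemma par_attach_new:
  assumes "wf_tree k T" "v \<in> verts T"
  shows "par (attach (Suc k) v T) (Suc k) = v"
  using assms wf_treeD(1)[OF assms(1)]
  by (intro par_eqI[OF wf_attach[OF assms]]) (auto simp: doubleton_eq_iff)

lemma rdep_freeze [simp]: "rdep m (freeze n v T) w = rdep m T w"
proof (induction w rule: less_induct)
  case (less w)
  show ?case using less by (simp add: rdep.simps[of _ _ w])
qed

lemma anc_freeze [simp]: "anc m (freeze n v T) w = anc m T w"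
proof (induction w rule: less_induct)
  case (less w)
  show ?case using less by (simp add: anc.simps[of _ _ w])
qed

lemma rdep_attach: "w \<le> k \<Longrightarrow> rdep m (attach (Suc k) v T) w = rdep m T w"
proof (induction w rule: less_induct)
  case (less w)
  show ?case using less by (simp add: rdep.simps[of _ _ w] par_attach)
qed

lemma anc_attach: "w \<le> k \<Longrightarrow> anc m (attach (Suc k) v T) w = anc m T w"
proof (induction w rule: less_induct)
  case (less w)
  show ?case using less by (simp add: anc.simps[of _ _ w] par_attach)
qed

lemma rdep_attach_new:
  assumes "wf_tree k T" "v \<in> verts T" "m \<le> k"
  shows "rdep m (attach (Suc k) v T) (Suc k) = Suc (rdep m T v)"
proof -
  have "v \<le> k" using assms wf_treeD(1) by auto
  thus ?thesis using assms
    by (simp add: rdep.simps[of _ _ "Suc k"] par_attach_new rdep_attach)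
qed

lemma anc_attach_new:
  assumes "wf_tree k T" "v \<in> verts T" "m \<le> k"
  shows "anc m (attach (Suc k) v T) (Suc k) = anc m T v"
proof -
  have "v \<le> k" using assms wf_treeD(1) by auto
  thus ?thesis using assms
    by (simp add: anc.simps[of _ _ "Suc k"] par_attach_new anc_attach)
qed

lemma rdep_le_self: "v \<le> m \<Longrightarrow> rdep m T v = 0"
  by (simp add: rdep.simps)

lemma anc_le_self: "v \<le> m \<Longrightarrow> anc m T v = v"
  by (simp add: anc.simps)

lemma rdep_0_le: "rdep 0 T v \<le> v"
proof (induction v rule: less_induct)
  case (less v)
  show ?case using less[of "par T v"] by (auto simp: rdep.simps[of _ T v])
qed

lemma rdep_le_rdep_0: "rdep m T v \<le> rdep 0 T v"
proof (induction v rule: less_induct)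
  case (less v)
  show ?case using less[of "par T v"] by (simp add: rdep.simps[of _ T v])
qed

text \<open>Names strictly decrease along an ancestral line, so its part inside the tree at time
  \<open>m\<close> has at most \<open>m\<close> edges. This is the whole price of counting heights
  from time \<open>m\<close>.\<close>

lemma rdep_0_le_rdep: "rdep 0 T v \<le> rdep m T v + m"
proof (induction v rule: less_induct)
  case (less v)
  show ?case
  proof (cases "v \<le> m")
    case True
    thus ?thesis using rdep_0_le[of T v] by linarith
  next
    case False
    thus ?thesis using less[of "par T v"] by (simp add: rdep.simps[of _ T v])
  qed
qed

lemma adj_sym: "(u, v) \<in> adj T \<longleftrightarrow> (v, u) \<in> adj T"
  by (simp add: adj_def insert_commute)

lemma adj_pow_sym: "(u, v) \<in> adj T ^^ k \<Longrightarrow> (v, u) \<in> adj T ^^ k"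
proof (induction k arbitrary: u v)
  case (Suc k)
  then obtain w where "(u, w) \<in> adj T ^^ k" "(w, v) \<in> adj T" by auto
  hence "(v, w) \<in> adj T" "(w, u) \<in> adj T ^^ k" using Suc adj_sym by blast+
  thus ?case by (rule relpow_Suc_I2)
qed auto

lemma path_to_root:
  assumes "wf_tree k T"
  shows "v \<in> verts T \<Longrightarrow> (v, 0) \<in> adj T ^^ rdep 0 T v"
proof (induction v rule: less_induct)
  case (less v)
  show ?case
  proof (cases "v = 0")
    case False
    hence p: "par T v < v" "{par T v, v} \<in> edges T" "par T v \<in> verts T"
      using par_props[OF assms less.prems] by auto
    have "(v, par T v) \<in> adj T" using p by (simp add: adj_def insert_commute)
    moreover have "(par T v, 0) \<in> adj T ^^ rdep 0 T (par T v)" using less.IH p by blast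
    ultimately have "(v, 0) \<in> adj T ^^ Suc (rdep 0 T (par T v))" by (rule relpow_Suc_I2)
    moreover have "rdep 0 T v = Suc (rdep 0 T (par T v))"
      using p(1) False by (simp add: rdep.simps[of 0 T v])
    ultimately show ?thesis by simp
  qed (simp add: rdep.simps)
qed

lemma path_between:
  assumes "wf_tree k T" "u \<in> verts T" "v \<in> verts T"
  shows "(u, v) \<in> adj T ^^ (rdep 0 T u + rdep 0 T v)"
  using path_to_root[OF assms(1,2)] adj_pow_sym[OF path_to_root[OF assms(1,3)]]
  by (auto simp: relpow_add)

lemma gdist_le:
  assumes "wf_tree k T" "u \<in> verts T" "v \<in> verts T"
  shows "gdist T u v \<le> rdep 0 T u + rdep 0 T v"
  using path_between[OF assms] unfolding gdist_def by (intro Least_le)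

text \<open>A potential that is 1-Lipschitz along edges bounds the length of every walk from below.
  Every edge joins a vertex to its parent, so the Lipschitz condition need only be checked
  there.\<close>

lemma gdist_ge:
  fixes \<phi> :: "nat \<Rightarrow> int"
  assumes "wf_tree k T" "u \<in> verts T" "v \<in> verts T"
    and lip: "\<And>w. w \<in> verts T \<Longrightarrow> 0 < w \<Longrightarrow> \<bar>\<phi> w - \<phi> (par T w)\<bar> \<le> 1"
  shows "\<phi> u - \<phi> v \<le> int (gdist T u v)"
proof -
  have e: "\<bar>\<phi> a - \<phi> b\<bar> \<le> 1" if ab: "(a, b) \<in> adj T" for a b
  proof -
    have E: "{a, b} \<in> edges T" "{b, a} \<in> edges T" using ab by (auto simp: adj_def insert_commute)
    have V: "a \<noteq> b" "a \<in> verts T" "b \<in> verts T" using wf_treeD(5)[OF assms(1) E(1)] by auto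
    show ?thesis
    proof (cases "a < b")
      case True
      thus ?thesis using lip[of b] par_eqI[OF assms(1) E(1)] V by (auto simp: abs_minus_commute)
    next
      case False
      thus ?thesis using lip[of a] par_eqI[OF assms(1) E(2)] V by (auto simp: abs_minus_commute)
    qed
  qed
  have "(a, b) \<in> adj T ^^ j \<Longrightarrow> \<phi> a - \<phi> b \<le> int j" for a b j
  proof (induction j arbitrary: b)
    case (Suc j)
    then obtain w where "(a, w) \<in> adj T ^^ j" "(w, b) \<in> adj T" by auto
    thus ?case using Suc.IH e by fastforce
  qed auto
  moreover have "(u, v) \<in> adj T ^^ gdist T u v"
    using path_between[OF assms(1-3)] unfolding gdist_def by (intro LeastI)
  ultimately show ?thesis by blast
qed

text \<open>The upper bound is the ancestral path; for the lower bound \<open>rdep 0 T\<close>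
  itself serves as the potential.\<close>

lemma vheight_eq:
  assumes "wf_tree k T" "v \<in> verts T"
  shows "vheight T v = rdep 0 T v"
proof -
  have 0: "0 \<in> verts T" and r: "rdep 0 T 0 = 0" using assms wf_treeD(2) by (auto simp: rdep.simps)
  have "\<bar>int (rdep 0 T w) - int (rdep 0 T (par T w))\<bar> \<le> 1" if "w \<in> verts T" "0 < w" for w
    using par_props(1)[OF assms(1) that] that by (simp add: rdep.simps[of _ T w])
  hence "int (rdep 0 T v) - int (rdep 0 T 0) \<le> int (gdist T v 0)"
    by (intro gdist_ge[OF assms 0]) auto
  thus ?thesis using gdist_le[OF assms 0] r by (simp add: vheight_def)
qed

text \<open>The function which is \<open>rdep m T\<close> on the class of \<open>u\<close> and \<open>- rdep m T\<close> elsewhere changes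
  by at most 1 along edges, because \<open>rdep m T\<close> vanishes where two classes meet.\<close>
lemma gdist_ge_rdep:
  assumes "wf_tree k T" "u \<in> verts T" "v \<in> verts T" "anc m T u \<noteq> anc m T v"
  shows "rdep m T u + rdep m T v \<le> gdist T u v"
proof -
  define \<phi> where "\<phi> w = (if anc m T w = anc m T u then int (rdep m T w) else - int (rdep m T w))" for w
  have "\<bar>\<phi> w - \<phi> (par T w)\<bar> \<le> 1" if w: "w \<in> verts T" "0 < w" for w
  proof -
    have p: "par T w < w" using par_props(1)[OF assms(1) w] .
    show ?thesis
    proof (cases "w \<le> m")
      case True
      thus ?thesis using p unfolding \<phi>_def by (simp add: rdep_le_self)
    next
      case False
      hence "rdep m T w = Suc (rdep m T (par T w))" "anc m T w = anc m T (par T w)"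
        using p by (simp_all add: rdep.simps[of m T w] anc.simps[of m T w])
      thus ?thesis by (simp add: \<phi>_def)
    qed
  qed
  hence "\<phi> u - \<phi> v \<le> int (gdist T u v)" by (intro gdist_ge[OF assms(1-3)])
  thus ?thesis using assms(4) by (simp add: \<phi>_def)
qed

lemma gdist_ge_heights:
  assumes "wf_tree k T" "u \<in> verts T" "v \<in> verts T" "anc m T u \<noteq> anc m T v"
  shows "rdep 0 T u + rdep 0 T v \<le> gdist T u v + 2 * m"
  using gdist_ge_rdep[OF assms] rdep_0_le_rdep[of T u m] rdep_0_le_rdep[of T v m] by linarith

lemma Height_le_iff:
  assumes "wf_tree k T"
  shows "real (Height T) \<le> h \<longleftrightarrow> (\<forall>v\<in>verts T. real (rdep 0 T v) \<le> h)"
proof -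
  have ne: "finite (vheight T ` verts T)" "vheight T ` verts T \<noteq> {}"
    using wf_treeD(2,3)[OF assms] by auto
  have "(\<forall>v\<in>verts T. real (rdep 0 T v) \<le> h) \<longleftrightarrow> (\<forall>v\<in>verts T. real (vheight T v) \<le> h)"
    using vheight_eq[OF assms] by simp
  also have "\<dots> \<longleftrightarrow> real (Height T) \<le> h"
  proof
    assume "\<forall>v\<in>verts T. real (vheight T v) \<le> h"
    thus "real (Height T) \<le> h" using Max_in[OF ne] unfolding Height_def by auto
  next
    assume h: "real (Height T) \<le> h"
    have "vheight T v \<le> Height T" if "v \<in> verts T" for v
      unfolding Height_def using ne that by (intro Max_ge) auto
    thus "\<forall>v\<in>verts T. real (vheight T v) \<le> h" using h by (meson of_nat_le_iff order_trans)
  qed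
  finally show ?thesis by simp
qed

section \<open>First moments along the chain\<close>

lemma set_step:
  "set_pmf (step x n T) \<subseteq>
     (if active T = {} then {T}
      else if finite (active T) then (\<lambda>v. if x n = -1 then freeze n v T else attach n v T) ` active T else UNIV)"
  by (auto simp: step_def)

lemma finite_set_step: "finite (active T) \<Longrightarrow> finite (set_pmf (step x n T))"
  by (rule finite_subset[OF set_step]) auto

lemma wf_tree_law: "T \<in> set_pmf (tree_law x k) \<Longrightarrow> wf_tree k T"
proof (induction k arbitrary: T)
  case 0
  thus ?case by (simp add: wf_root)
next
  case (Suc k)
  then obtain T' where T': "T' \<in> set_pmf (tree_law x k)" "T \<in> set_pmf (step x (Suc k) T')" by auto
  have wf: "wf_tree k T'" using Suc.IH T'(1) .
  have "T = T' \<or> (\<exists>v\<in>active T'. T = freeze (Suc k) v T' \<or> T = attach (Suc k) v T')"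
    using T'(2) set_step[of x "Suc k" T'] wf_treeD(4)[OF wf] by (auto split: if_splits)
  thus ?case
    using wf_mono[OF wf, of "Suc k"] wf_attach[OF wf] wf_mono[OF wf_freeze[OF wf], of _ "Suc k"]
      active_subset_verts[of T'] by auto
qed

lemma finite_set_tree_law: "finite (set_pmf (tree_law x k))"
proof (induction k)
  case (Suc k)
  thus ?case using wf_treeD(4)[OF wf_tree_law] finite_set_step by auto
qed auto

lemma expectation_cong:
  assumes "\<And>\<omega>. \<omega> \<in> set_pmf p \<Longrightarrow> f \<omega> = g \<omega>"
  shows "measure_pmf.expectation p f = measure_pmf.expectation p (g :: _ \<Rightarrow> real)"
  using assms by (intro integral_cong_AE) (auto simp: AE_measure_pmf_iff)

lemma expectation_mono:
  assumes "finite (set_pmf p)" "\<And>\<omega>. \<omega> \<in> set_pmf p \<Longrightarrow> f \<omega> \<le> g \<omega>"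
  shows "measure_pmf.expectation p f \<le> measure_pmf.expectation p (g :: _ \<Rightarrow> real)"
  using assms by (intro integral_mono_AE integrable_measure_pmf_finite) (auto simp: AE_measure_pmf_iff)

lemma expectation_const:
  assumes "\<And>\<omega>. \<omega> \<in> set_pmf p \<Longrightarrow> f \<omega> = (a :: real)"
  shows "measure_pmf.expectation p f = a"
  by (subst expectation_cong[OF assms]) auto

lemma prob_eq_expectation:
  "measure_pmf.prob p {\<omega>. P \<omega>} = measure_pmf.expectation p (\<lambda>\<omega>. of_bool (P \<omega>) :: real)"
proof -
  have "(\<lambda>\<omega>. of_bool (P \<omega>) :: real) = indicator {\<omega>. P \<omega>}" by (auto simp: indicator_def)
  thus ?thesis by simp
qed

lemma expectation_bind_finite:
  fixes h :: "'b \<Rightarrow> real"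
  assumes "finite (set_pmf p)" "\<And>a. a \<in> set_pmf p \<Longrightarrow> finite (set_pmf (f a))"
  shows "measure_pmf.expectation (bind_pmf p f) h
    = measure_pmf.expectation p (\<lambda>a. measure_pmf.expectation (f a) h)"
  by (subst pmf_expectation_bind[of "set_pmf p"])
     (use assms in \<open>auto simp: integral_measure_pmf[of "set_pmf p"]\<close>)

lemma verts_law_expectation:
  fixes \<phi> :: "lab_tree \<Rightarrow> nat \<Rightarrow> nat \<Rightarrow> real"
  shows "measure_pmf.expectation (tree_vertices_law x k) (\<lambda>(T, u, v). \<phi> T u v)
    = measure_pmf.expectation (tree_law x k)
        (\<lambda>T. (\<Sum>u\<in>verts T. \<Sum>v\<in>verts T. \<phi> T u v) / (real (card (verts T)))\<^sup>2)"
proof -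
  let ?U = "\<lambda>T. map_pmf (Pair T) (pair_pmf (pmf_of_set (verts T)) (pmf_of_set (verts T)))"
  have V: "verts T \<noteq> {}" "finite (verts T)" if "T \<in> set_pmf (tree_law x k)" for T
    using wf_treeD(2,3)[OF wf_tree_law[OF that]] by auto
  have fin: "finite (set_pmf (?U T))" if "T \<in> set_pmf (tree_law x k)" for T
    using V[OF that] by simp
  have "measure_pmf.expectation (?U T) (\<lambda>(T, u, v). \<phi> T u v)
      = (\<Sum>u\<in>verts T. \<Sum>v\<in>verts T. \<phi> T u v) / (real (card (verts T)))\<^sup>2"
    if T: "T \<in> set_pmf (tree_law x k)" for T
  proof -
    have "measure_pmf.expectation (?U T) (\<lambda>(T, u, v). \<phi> T u v)
      = measure_pmf.expectation (pair_pmf (pmf_of_set (verts T)) (pmf_of_set (verts T))) (\<lambda>(u, v). \<phi> T u v)"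
      by (simp add: case_prod_unfold)
    also have "\<dots> = (\<Sum>(u, v)\<in>verts T \<times> verts T. \<phi> T u v / (real (card (verts T)))\<^sup>2)"
      using V[OF T]
      by (subst integral_measure_pmf_real[of "verts T \<times> verts T"])
         (auto simp: pmf_pair power2_eq_square pmf_of_set[OF V[OF T]] intro!: sum.cong)
    also have "\<dots> = (\<Sum>u\<in>verts T. \<Sum>v\<in>verts T. \<phi> T u v) / (real (card (verts T)))\<^sup>2"
      by (simp add: sum_divide_distrib sum.cartesian_product case_prod_unfold)
    finally show ?thesis .
  qed
  thus ?thesis unfolding tree_vertices_law_def
    by (subst expectation_bind_finite[OF finite_set_tree_law fin])
       (auto intro!: expectation_cong)
qed

lemma finite_set_verts_law: "finite (set_pmf (tree_vertices_law x k))"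
proof -
  have "verts T \<noteq> {}" "finite (verts T)" if "T \<in> set_pmf (tree_law x k)" for T
    using wf_treeD(2,3)[OF wf_tree_law[OF that]] by auto
  thus ?thesis using finite_set_tree_law by (auto simp: tree_vertices_law_def)
qed

lemma set_verts_law:
  assumes "(T, u, v) \<in> set_pmf (tree_vertices_law x k)"
  shows "T \<in> set_pmf (tree_law x k)" "wf_tree k T" "u \<in> verts T" "v \<in> verts T"
proof -
  have V: "verts T' \<noteq> {}" "finite (verts T')" if "T' \<in> set_pmf (tree_law x k)" for T'
    using wf_treeD(2,3)[OF wf_tree_law[OF that]] by auto
  show T: "T \<in> set_pmf (tree_law x k)" using assms by (auto simp: tree_vertices_law_def)
  show "wf_tree k T" by (rule wf_tree_law[OF T])
  show "u \<in> verts T" "v \<in> verts T" using assms V by (auto simp: tree_vertices_law_def)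
qed

definition hp :: "(nat \<Rightarrow> int) \<Rightarrow> nat \<Rightarrow> nat \<Rightarrow> real" where
  "hp x m k = (\<Sum>i\<in>{m<..k}. of_bool (x i = 1) / real_of_int (walk x i))"

text \<open>The generating function at \<open>z\<close> of a sum of independent Bernoulli variables
  of parameters \<open>1 / walk x i\<close>, over the upward steps \<open>i\<close> in
  \<open>{m<..k}\<close>; \<open>hp\<close> is the mean of that sum.\<close>

definition growth :: "(nat \<Rightarrow> int) \<Rightarrow> nat \<Rightarrow> nat \<Rightarrow> real \<Rightarrow> real" where
  "growth x m k z = (\<Prod>i\<in>{m<..k}. 1 + of_bool (x i = 1) * (z - 1) / real_of_int (walk x i))"

text \<open>Counts ordered pairs, including the diagonal, whose ancestral lines have met by the time
  they are traced back to the tree at time \<open>m\<close>.\<close>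

definition cnt :: "nat \<Rightarrow> lab_tree \<Rightarrow> nat set \<Rightarrow> nat set \<Rightarrow> real" where
  "cnt m T A B = (\<Sum>u\<in>A. \<Sum>v\<in>B. of_bool (anc m T u = anc m T v))"

lemma greaterThanAtMost_Suc: "m \<le> k \<Longrightarrow> {m<..Suc k} = insert (Suc k) {m<..k}"
  by auto

lemma growth_refl [simp]: "growth x m m z = 1"
  and hp_refl [simp]: "hp x m m = 0"
  by (auto simp: growth_def hp_def)

lemma growth_Suc:
  "m \<le> k \<Longrightarrow> growth x m (Suc k) z
     = growth x m k z * (1 + of_bool (x (Suc k) = 1) * (z - 1) / real_of_int (walk x (Suc k)))"
  by (simp add: growth_def greaterThanAtMost_Suc mult.commute)

lemma hp_Suc:
  "m \<le> k \<Longrightarrow> hp x m (Suc k) = hp x m k + of_bool (x (Suc k) = 1) / real_of_int (walk x (Suc k))"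
  by (simp add: hp_def greaterThanAtMost_Suc)

text \<open>Only the first \<open>n\<close> steps are constrained, because \<open>tau x > n\<close>
  says nothing about the walk after time \<open>n\<close>.\<close>

locale freezing_walk =
  fixes x :: "nat \<Rightarrow> int" and n :: nat
  assumes steps: "1 \<le> i \<Longrightarrow> i \<le> n \<Longrightarrow> x i = 1 \<or> x i = -1"
    and walk_pos: "i \<le> n \<Longrightarrow> walk x i \<ge> 1"
begin

definition S :: "nat \<Rightarrow> real" where "S i = real_of_int (walk x i)"

definition upd :: "nat \<Rightarrow> nat \<Rightarrow> lab_tree \<Rightarrow> lab_tree" where
  "upd k v T = (if x k = -1 then freeze k v T else attach k v T)"

lemma S_ge_1: "i \<le> n \<Longrightarrow> S i \<ge> 1"
  using walk_pos[of i] by (simp add: S_def)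

lemma S_Suc: "S (Suc k) = S k + real_of_int (x (Suc k))"
  by (simp add: S_def walk_def)

lemma S_0 [simp]: "S 0 = 1"
  by (simp add: S_def walk_def)

lemma step_eq_map:
  assumes "k < n" "T \<in> set_pmf (tree_law x k)" "real (card (active T)) = S k"
  shows "step x (Suc k) T = map_pmf (\<lambda>v. upd (Suc k) v T) (pmf_of_set (active T))"
    "active T \<noteq> {}" "finite (active T)"
proof -
  show fin: "finite (active T)" using wf_treeD(4)[OF wf_tree_law[OF assms(2)]] .
  show "active T \<noteq> {}" using assms S_ge_1[of k] by auto
  thus "step x (Suc k) T = map_pmf (\<lambda>v. upd (Suc k) v T) (pmf_of_set (active T))"
    by (simp add: step_def upd_def)
qed

lemma new_not_in:
  assumes "T \<in> set_pmf (tree_law x k)"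
  shows "Suc k \<notin> verts T" "Suc k \<notin> active T"
  using wf_treeD(1)[OF wf_tree_law[OF assms]] active_subset_verts[of T] by auto

text \<open>Both numbers are deterministic: a step changes the number of active vertices by
  \<open>x k\<close>, and \<open>k\<close> steps with total \<open>S k - 1\<close> contain
  \<open>(k + S k - 1) / 2\<close> upward ones, each creating one vertex. Hence normalisations can
  be pulled out of expectations.\<close>

lemma cards:
  assumes "k \<le> n" "T \<in> set_pmf (tree_law x k)"
  shows "real (card (active T)) = S k \<and> real (card (verts T)) = (S k + real k + 1) / 2"
  using assms
proof (induction k arbitrary: T)
  case (Suc k)
  then obtain T' where T': "T' \<in> set_pmf (tree_law x k)" "T \<in> set_pmf (step x (Suc k) T')" by auto
  have IH: "real (card (active T')) = S k" "real (card (verts T')) = (S k + real k + 1) / 2"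
    using Suc.IH[OF _ T'(1)] Suc.prems by auto
  note st = step_eq_map[OF _ T'(1) IH(1)]
  obtain v where v: "v \<in> active T'" "T = upd (Suc k) v T'"
    using T'(2) st Suc.prems by auto
  have fin: "finite (verts T')" "finite (active T')" using wf_treeD(3,4)[OF wf_tree_law[OF T'(1)]] .
  have vv: "v \<in> verts T'" using v active_subset_verts by blast
  consider "x (Suc k) = 1" | "x (Suc k) = -1" using steps[of "Suc k"] Suc.prems by auto
  thus ?case
  proof cases
    case 1
    thus ?thesis using v IH new_not_in[OF T'(1)] fin
      by (simp add: upd_def S_Suc field_simps)
  next
    case 2
    have "card (active T') > 0" using v fin card_gt_0_iff by blast
    thus ?thesis using v IH fin 2 vv
      by (simp add: upd_def S_Suc verts_freeze of_nat_diff)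
  qed
qed auto

lemmas card_active = cards[THEN conjunct1] and card_verts = cards[THEN conjunct2]

lemma active_nonempty:
  assumes "k \<le> n" "T \<in> set_pmf (tree_law x k)"
  shows "active T \<noteq> {}" "finite (active T)" "finite (verts T)"
  using card_active[OF assms] S_ge_1[OF assms(1)] wf_treeD(3,4)[OF wf_tree_law[OF assms(2)]] by auto

text \<open>The denominator is the deterministic \<open>S k\<close> instead of a random cardinality;
  this is what turns expectations of additive functionals into closed recursions.\<close>

lemma expectation_Suc:
  assumes "k < n"
  shows "measure_pmf.expectation (tree_law x (Suc k)) g
    = measure_pmf.expectation (tree_law x k) (\<lambda>T. (\<Sum>v\<in>active T. g (upd (Suc k) v T)) / S k)"
proof -
  have "measure_pmf.expectation (step x (Suc k) T) g = (\<Sum>v\<in>active T. g (upd (Suc k) v T)) / S k"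
    if T: "T \<in> set_pmf (tree_law x k)" for T
  proof -
    have c: "real (card (active T)) = S k" using card_active[OF _ T] assms by auto
    note st = step_eq_map[OF assms T c]
    show ?thesis using st c by (simp add: integral_pmf_of_set)
  qed
  moreover have "finite (set_pmf (step x (Suc k) T))" if "T \<in> set_pmf (tree_law x k)" for T
    using wf_treeD(4)[OF wf_tree_law[OF that]] by (rule finite_set_step)
  ultimately show ?thesis
    unfolding tree_law.simps
    by (intro trans[OF expectation_bind_finite[OF finite_set_tree_law] expectation_cong])
qed

lemma expectation_Suc':
  assumes "k < n"
    and "\<And>T. T \<in> set_pmf (tree_law x k) \<Longrightarrow> wf_tree k T \<Longrightarrow> finite (active T) \<Longrightarrow> finite (verts T) \<Longrightarrow>
          Suc k \<notin> verts T \<Longrightarrow> Suc k \<notin> active T \<Longrightarrow> real (card (active T)) = S k \<Longrightarrow>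
          (\<Sum>v\<in>active T. g (upd (Suc k) v T)) / S k = g' T"
  shows "measure_pmf.expectation (tree_law x (Suc k)) g = measure_pmf.expectation (tree_law x k) g'"
  unfolding expectation_Suc[OF assms(1)]
proof (rule expectation_cong)
  fix T assume T: "T \<in> set_pmf (tree_law x k)"
  show "(\<Sum>v\<in>active T. g (upd (Suc k) v T)) / S k = g' T"
    using assms(1) T by (intro assms(2) wf_tree_law new_not_in active_nonempty card_active) auto
qed

definition Z :: "nat \<Rightarrow> real \<Rightarrow> lab_tree \<Rightarrow> real" where
  "Z m z T = (\<Sum>v\<in>active T. z ^ rdep m T v)"

lemma Z_attach:
  assumes "wf_tree k T" "v \<in> active T" "m \<le> k"
  shows "Z m z (attach (Suc k) v T) = Z m z T + z * z ^ rdep m T v"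
proof -
  have vs: "active T \<subseteq> {..k}" "v \<in> verts T" "finite (active T)"
    using wf_treeD[OF assms(1)] active_subset_verts assms(2) by blast+
  have "(\<Sum>w\<in>active T. z ^ rdep m (attach (Suc k) v T) w) = Z m z T"
    unfolding Z_def using vs by (intro sum.cong) (auto simp: rdep_attach)
  moreover have "Suc k \<notin> active T" using vs by auto
  ultimately show ?thesis using rdep_attach_new[OF assms(1) vs(2) assms(3)] vs(3) by (simp add: Z_def)
qed

lemma Z_freeze:
  assumes "finite (active T)" "v \<in> active T"
  shows "Z m z (freeze k v T) = Z m z T - z ^ rdep m T v"
  using assms by (simp add: Z_def sum_diff1)

lemma Z_base:
  assumes "k \<le> n" "T \<in> set_pmf (tree_law x k)"
  shows "Z k z T = S k"
proof -
  have "v \<le> k" if "v \<in> active T" for v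
    using wf_treeD(1)[OF wf_tree_law[OF assms(2)]] active_subset_verts that by blast
  thus ?thesis using card_active[OF assms] by (simp add: Z_def rdep_le_self)
qed

text \<open>At an upward step \<open>S (Suc k) + z - 1 = S k + z\<close> clears the denominator of
  the new factor.\<close>

lemma S_growth_Suc:
  assumes "m \<le> k" "k < n"
  shows "S (Suc k) * growth x m (Suc k) z
    = (if x (Suc k) = 1 then S k + z else S k - 1) * growth x m k z"
proof -
  have "S (Suc k) \<noteq> 0" using S_ge_1[of "Suc k"] assms by auto
  hence "S (Suc k) * (1 + (z - 1) / S (Suc k)) = S (Suc k) + z - 1" by (simp add: field_simps)
  thus ?thesis using steps[of "Suc k"] assms by (auto simp: growth_Suc S_Suc simp flip: S_def)
qed

text \<open>On average an attachment adds \<open>z\<close> times the mean weight of an active vertex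
  and a freezing removes that mean once, so \<open>Z\<close> is multiplied by
  \<open>(S k + z) / S k\<close> or \<open>(S k - 1) / S k\<close>.\<close>

lemma expectation_Z:
  assumes "m \<le> k" "k \<le> n"
  shows "measure_pmf.expectation (tree_law x k) (Z m z) = S k * growth x m k z"
  using assms
proof (induction k rule: dec_induct)
  case base
  thus ?case using Z_base by (simp add: expectation_const)
next
  case (step k)
  let ?c = "if x (Suc k) = 1 then S k + z else S k - 1"
  have "measure_pmf.expectation (tree_law x (Suc k)) (Z m z)
    = measure_pmf.expectation (tree_law x k) (\<lambda>T. ?c / S k * Z m z T)"
  proof (rule expectation_Suc')
    fix T assume T: "wf_tree k T" "finite (active T)" "real (card (active T)) = S k"
    have "(\<Sum>v\<in>active T. Z m z (upd (Suc k) v T)) = ?c * Z m z T"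
    proof (cases "x (Suc k) = 1")
      case True
      hence "(\<Sum>v\<in>active T. Z m z (upd (Suc k) v T)) = (\<Sum>v\<in>active T. Z m z T + z * z ^ rdep m T v)"
        using Z_attach[OF T(1)] step.hyps by (intro sum.cong) (auto simp: upd_def)
      thus ?thesis using T True by (simp add: sum.distrib Z_def sum_distrib_left algebra_simps)
    next
      case False
      hence "(\<Sum>v\<in>active T. Z m z (upd (Suc k) v T)) = (\<Sum>v\<in>active T. Z m z T - z ^ rdep m T v)"
        using Z_freeze[OF T(2)] steps[of "Suc k"] step by (intro sum.cong) (auto simp: upd_def)
      thus ?thesis using T False by (simp add: sum_subtractf Z_def algebra_simps)
    qed
    thus "(\<Sum>v\<in>active T. Z m z (upd (Suc k) v T)) / S k = ?c / S k * Z m z T" by simp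
  qed (use step in auto)
  also have "\<dots> = ?c * growth x m k z"
    using step S_ge_1[of k] by simp
  also have "\<dots> = S (Suc k) * growth x m (Suc k) z"
    using S_growth_Suc[of m k z] step by simp
  finally show ?case .
qed

text \<open>Freezing leaves the sum unchanged. The vertex born at an upward step \<open>i\<close> is
  a child of a uniform active vertex, hence has expected weight \<open>z\<close> times
  \<open>growth x 0 (i - 1) z\<close>. The predicate \<open>P\<close> selects vertices by their
  deterministic birth times.\<close>

lemma expectation_verts_sum:
  assumes "k \<le> n"
  shows "measure_pmf.expectation (tree_law x k) (\<lambda>T. \<Sum>v\<in>verts T. of_bool (P v) * z ^ rdep 0 T v)
    = of_bool (P 0) + (\<Sum>i\<in>{1..k}. of_bool (x i = 1 \<and> P i) * z * growth x 0 (i - 1) z)"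
  using assms
proof (induction k)
  case 0
  thus ?case by (simp add: rdep_le_self)
next
  case (Suc k)
  let ?U = "\<lambda>T. \<Sum>v\<in>verts T. of_bool (P v) * z ^ rdep 0 T v"
  let ?c = "of_bool (x (Suc k) = 1 \<and> P (Suc k)) * z / S k"
  have S: "S k \<ge> 1" using S_ge_1 Suc by simp
  have "measure_pmf.expectation (tree_law x (Suc k)) ?U
    = measure_pmf.expectation (tree_law x k) (\<lambda>T. ?U T + ?c * Z 0 z T)"
  proof (rule expectation_Suc')
    fix T assume T: "wf_tree k T" "finite (active T)" "finite (verts T)" "Suc k \<notin> verts T" "real (card (active T)) = S k"
    have "?U (upd (Suc k) v T) = ?U T + of_bool (x (Suc k) = 1 \<and> P (Suc k)) * z * z ^ rdep 0 T v"
      if v: "v \<in> active T" for v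
    proof -
      have vv: "v \<in> verts T" using v active_subset_verts by blast
      consider "x (Suc k) = 1" | "x (Suc k) = -1" using steps[of "Suc k"] Suc.prems by auto
      thus ?thesis
      proof cases
        case 1
        have "(\<Sum>w\<in>verts T. of_bool (P w) * z ^ rdep 0 (attach (Suc k) v T) w) = ?U T"
          using wf_treeD(1)[OF T(1)] by (intro sum.cong) (auto simp: rdep_attach)
        thus ?thesis using T 1 rdep_attach_new[OF T(1) vv, of 0] by (simp add: upd_def)
      next
        case 2
        thus ?thesis using vv by (simp add: upd_def verts_freeze)
      qed
    qed
    hence "(\<Sum>v\<in>active T. ?U (upd (Suc k) v T))
      = (\<Sum>v\<in>active T. ?U T + of_bool (x (Suc k) = 1 \<and> P (Suc k)) * z * z ^ rdep 0 T v)"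
      by (intro sum.cong) auto
    also have "\<dots> = S k * ?U T + of_bool (x (Suc k) = 1 \<and> P (Suc k)) * z * Z 0 z T"
      using T by (simp add: sum.distrib Z_def sum_distrib_left)
    finally show "(\<Sum>v\<in>active T. ?U (upd (Suc k) v T)) / S k = ?U T + ?c * Z 0 z T"
      using S by (simp add: field_simps)
  qed (use Suc in auto)
  also have "\<dots> = measure_pmf.expectation (tree_law x k) ?U + ?c * measure_pmf.expectation (tree_law x k) (Z 0 z)"
    by (subst Bochner_Integration.integral_add) (auto intro!: integrable_measure_pmf_finite finite_set_tree_law)
  also have "\<dots> = measure_pmf.expectation (tree_law x k) ?U + of_bool (x (Suc k) = 1 \<and> P (Suc k)) * z * growth x 0 k z"
    using expectation_Z[of 0 k z] Suc.prems S by simp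
  finally show ?case using Suc by simp
qed

lemma expectation_antimono:
  fixes g :: "lab_tree \<Rightarrow> real"
  assumes "K \<le> k" "k \<le> n"
    and "\<And>j T v. wf_tree j T \<Longrightarrow> v \<in> active T \<Longrightarrow> g (upd (Suc j) v T) \<le> g T"
  shows "measure_pmf.expectation (tree_law x k) g \<le> measure_pmf.expectation (tree_law x K) g"
  using assms(1,2)
proof (induction k rule: dec_induct)
  case (step k)
  have "measure_pmf.expectation (tree_law x (Suc k)) g
    = measure_pmf.expectation (tree_law x k) (\<lambda>T. (\<Sum>v\<in>active T. g (upd (Suc k) v T)) / S k)"
    using step by (intro expectation_Suc) auto
  also have "\<dots> \<le> measure_pmf.expectation (tree_law x k) g"
  proof (rule expectation_mono[OF finite_set_tree_law])
    fix T assume T: "T \<in> set_pmf (tree_law x k)"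
    have "(\<Sum>v\<in>active T. g (upd (Suc k) v T)) \<le> (\<Sum>v\<in>active T. g T)"
      using assms(3) wf_tree_law[OF T] by (intro sum_mono) auto
    also have "\<dots> = S k * g T" using card_active[OF _ T] step by simp
    finally show "(\<Sum>v\<in>active T. g (upd (Suc k) v T)) / S k \<le> g T"
      using S_ge_1[of k] step by (simp add: divide_le_eq mult.commute)
  qed
  finally show ?case using step by simp
qed auto

end

section \<open>Pairs of vertices with a common ancestor\<close>

lemma powr_tangent:
  fixes u v q :: real
  assumes "0 \<le> u" "0 \<le> v" "1 < q"
  shows "u powr q + q * u powr (q - 1) * (v - u) \<le> v powr q"
proof (cases "u = 0 \<or> v = 0")
  case True
  have "u powr q + q * u powr (q - 1) * (- u) \<le> 0" if "u > 0"
  proof -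
    have "u powr (q - 1) * u = u powr q" using that by (simp add: powr_mult_base mult.commute)
    hence "u powr q + q * u powr (q - 1) * (- u) = (1 - q) * u powr q" by (simp add: algebra_simps)
    thus ?thesis using assms by (simp add: mult_le_0_iff)
  qed
  thus ?thesis using True assms by (cases "u = 0") auto
next
  case False
  hence uv: "u > 0" "v > 0" using assms by auto
  have "((\<lambda>t. t powr q) has_real_derivative q * u powr (q - 1)) (at u)"
    using uv by (auto intro!: derivative_eq_intros)
  hence "v powr q - u powr q \<ge> q * u powr (q - 1) * (v - u)"
    using uv assms by (intro convex_on_imp_above_tangent[OF powr_convex])
      (auto intro: has_field_derivative_at_within simp: interior_open)
  thus ?thesis by simp
qed

lemma powr_subadditive:
  fixes u v s :: real
  assumes "0 \<le> u" "0 \<le> v" "0 \<le> s" "s \<le> 1"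
  shows "(u + v) powr s \<le> u powr s + v powr s"
proof (cases "u + v = 0")
  case False
  have *: "t \<le> t powr s" if "0 \<le> t" "t \<le> 1" for t :: real
    using powr_mono'[of s 1 t] that assms by (cases "t = 0") auto
  have "1 = u / (u + v) + v / (u + v)" using False by (simp add: add_divide_distrib[symmetric])
  also have "\<dots> \<le> (u / (u + v)) powr s + (v / (u + v)) powr s"
    using assms False by (intro add_mono *) (auto simp: divide_le_eq)
  also have "\<dots> = (u powr s + v powr s) / (u + v) powr s"
    using assms by (simp add: powr_divide add_divide_distrib)
  finally show ?thesis using assms False by (simp add: le_divide_eq)
qed (use assms in auto)

text \<open>Replaces the expansion of a square: after summation over centred \<open>b\<close> the
  linear term vanishes. For \<open>a > 0\<close> and \<open>a + b \<ge> 0\<close> convexity gives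
  the bound with \<open>(a + b) powr (q - 1)\<close> in the linear term, and subadditivity of
  \<open>t powr (q - 1)\<close> exchanges it for \<open>a powr (q - 1)\<close> at a cost of
  \<open>q \<le> 2\<close> times the last term. When the sign changes, the constant is
  \<open>1 + 2\<close>: one for the left-hand side and two for the negative linear term.\<close>

lemma abs_powr_add_le:
  fixes a b q :: real
  assumes q: "1 < q" "q \<le> 2"
  shows "\<bar>a + b\<bar> powr q \<le> \<bar>a\<bar> powr q + q * sgn a * \<bar>a\<bar> powr (q - 1) * b + 3 * \<bar>b\<bar> powr q"
proof -
  have pos: "\<bar>a + b\<bar> powr q \<le> a powr q + q * a powr (q - 1) * b + 3 * \<bar>b\<bar> powr q"
    if a: "a > 0" for a b :: real
  proof -
    have bb: "\<bar>b\<bar> powr (q - 1) * \<bar>b\<bar> = \<bar>b\<bar> powr q"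
      using powr_mult_base[of "\<bar>b\<bar>" "q - 1"] by (simp add: mult.commute)
    show ?thesis
    proof (cases "a + b \<ge> 0")
      case True
      have "(a + b) powr (q - 1) * b \<le> a powr (q - 1) * b + \<bar>b\<bar> powr q"
      proof (cases "b \<ge> 0")
        case True
        have "(a + b) powr (q - 1) \<le> a powr (q - 1) + b powr (q - 1)"
          using a True q by (intro powr_subadditive) auto
        hence "(a + b) powr (q - 1) * b \<le> (a powr (q - 1) + b powr (q - 1)) * b"
          using True by (intro mult_right_mono)
        thus ?thesis using bb True by (simp add: algebra_simps)
      next
        case False
        have "(a + b + - b) powr (q - 1) \<le> (a + b) powr (q - 1) + (- b) powr (q - 1)"
          using False q \<open>a + b \<ge> 0\<close> by (intro powr_subadditive) auto
        hence "(a powr (q - 1) - (- b) powr (q - 1)) * (- b) \<le> (a + b) powr (q - 1) * (- b)"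
          using False by (intro mult_right_mono) auto
        thus ?thesis using bb False by (simp add: algebra_simps)
      qed
      hence "q * ((a + b) powr (q - 1) * b) \<le> q * (a powr (q - 1) * b + \<bar>b\<bar> powr q)"
        using q by (intro mult_left_mono) auto
      moreover have "(a + b) powr q + q * (a + b) powr (q - 1) * (a - (a + b)) \<le> a powr q"
        using True a q by (intro powr_tangent) auto
      moreover have "q * \<bar>b\<bar> powr q \<le> 3 * \<bar>b\<bar> powr q" using q by (intro mult_right_mono) auto
      ultimately show ?thesis using True by (simp add: algebra_simps)
    next
      case False
      hence b: "a < \<bar>b\<bar>" "b < 0" using a by auto
      have "\<bar>a + b\<bar> powr q \<le> \<bar>b\<bar> powr q" using a b False q by (intro powr_mono2) auto
      moreover have "a powr (q - 1) * \<bar>b\<bar> \<le> \<bar>b\<bar> powr (q - 1) * \<bar>b\<bar>"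
        using a b q by (intro mult_right_mono powr_mono2) auto
      hence "q * (a powr (q - 1) * \<bar>b\<bar>) \<le> 2 * \<bar>b\<bar> powr q"
        using q unfolding bb by (intro mult_mono) auto
      moreover have "a powr q \<ge> 0" "\<bar>b\<bar> powr q \<ge> 0" by simp_all
      moreover have "q * (a powr (q - 1) * \<bar>b\<bar>) = - (q * a powr (q - 1) * b)" using b by simp
      ultimately show ?thesis by linarith
    qed
  qed
  consider "a > 0" | "a = 0" | "a < 0" by linarith
  thus ?thesis
  proof cases
    case 3
    have "\<bar>- a + - b\<bar> = \<bar>a + b\<bar>" by linarith
    thus ?thesis using pos[of "- a" "- b"] 3 by simp
  qed (use pos[of a b] in auto)
qed

text \<open>The tangent to \<open>t powr q\<close> at the mean lies below the function, and its
  linear part sums to zero.\<close>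

lemma power_mean_powr:
  fixes a :: "'b \<Rightarrow> real"
  assumes "finite A" "A \<noteq> {}" "\<And>i. i \<in> A \<Longrightarrow> 0 \<le> a i" "1 < q"
  shows "(sum a A / real (card A)) powr q \<le> (\<Sum>i\<in>A. a i powr q) / real (card A)"
proof -
  define u where "u = sum a A / real (card A)"
  have c: "real (card A) > 0" using assms by (simp add: card_gt_0_iff)
  have u: "u \<ge> 0" unfolding u_def using assms by (simp add: sum_nonneg)
  have "(\<Sum>i\<in>A. u powr q + q * u powr (q - 1) * (a i - u)) \<le> (\<Sum>i\<in>A. a i powr q)"
    using assms u by (intro sum_mono powr_tangent) auto
  moreover have "(\<Sum>i\<in>A. u powr q + q * u powr (q - 1) * (a i - u))
      = real (card A) * u powr q + q * u powr (q - 1) * (sum a A - real (card A) * u)"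
    by (simp add: sum.distrib sum_distrib_left[symmetric] sum_subtractf)
  moreover have "sum a A - real (card A) * u = 0" using c by (simp add: u_def)
  ultimately have "real (card A) * u powr q \<le> (\<Sum>i\<in>A. a i powr q)" by simp
  thus ?thesis using c unfolding u_def[symmetric] by (simp add: field_simps)
qed

section \<open>Pairs with a common ancestor at time \<open>m\<close>\<close>

definition cls :: "nat \<Rightarrow> lab_tree \<Rightarrow> nat set \<Rightarrow> nat \<Rightarrow> real" where
  "cls m T B u = (\<Sum>v\<in>B. of_bool (anc m T u = anc m T v))"

lemma cnt_cls: "cnt m T A B = (\<Sum>u\<in>A. cls m T B u)"
  by (simp add: cnt_def cls_def)

lemma cnt_commute: "cnt m T A B = cnt m T B A"
  unfolding cnt_def by (subst sum.swap) (simp add: eq_commute)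

lemma cnt_attach:
  assumes wf: "wf_tree k T" and v: "v \<in> verts T" and mk: "m \<le> k"
    and A: "A \<subseteq> verts T" and B: "B \<subseteq> verts T"
  shows "cnt m (attach (Suc k) v T) (insert (Suc k) A) (insert (Suc k) B)
    = cnt m T A B + cls m T B v + cls m T A v + 1"
proof -
  have k: "A \<subseteq> {..k}" "B \<subseteq> {..k}" and fin: "finite A" "finite B"
    using wf_treeD(1,3)[OF wf] A B finite_subset by blast+
  have new: "Suc k \<notin> A" "Suc k \<notin> B" using k by auto
  have eA: "anc m (attach (Suc k) v T) w = anc m T w" if "w \<in> A \<union> B" for w
    using k that by (auto intro: anc_attach)
  have en: "anc m (attach (Suc k) v T) (Suc k) = anc m T v" by (rule anc_attach_new[OF wf v mk])
  show ?thesis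
    using fin new by (simp add: cnt_def cls_def en eA sum.distrib eq_commute[of _ "anc m T v"] del: sum_of_bool_eq)
qed

lemma cnt_remove_left:
  assumes "finite A" "v \<in> A"
  shows "cnt m T (A - {v}) B = cnt m T A B - cls m T B v"
  using assms by (simp add: cnt_cls sum_diff1)

text \<open>The \<open>+ 1\<close> restores the pair \<open>(v, v)\<close>, which is subtracted once
  as a row entry and once as a column entry.\<close>

lemma cnt_remove_both:
  assumes "finite A" "v \<in> A"
  shows "cnt m T (A - {v}) (A - {v}) = cnt m T A A - 2 * cls m T A v + 1"
proof -
  have "cls m T (A - {v}) v = cls m T A v - 1" using assms by (simp add: cls_def sum_diff1 del: sum_of_bool_eq)
  thus ?thesis using assms
    by (simp add: cnt_remove_left cnt_commute[of m T A "A - {v}"])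
qed

lemma cnt_freeze [simp]: "cnt m (freeze k v T) A B = cnt m T A B"
  by (simp add: cnt_def)

lemma expectation_linear:
  fixes f g :: "lab_tree \<Rightarrow> real"
  shows "measure_pmf.expectation (tree_law x k) (\<lambda>T. a * f T + b * g T + c)
    = a * measure_pmf.expectation (tree_law x k) f + b * measure_pmf.expectation (tree_law x k) g + c"
proof -
  have "integrable (measure_pmf (tree_law x k)) h" for h :: "lab_tree \<Rightarrow> real"
    by (intro integrable_measure_pmf_finite finite_set_tree_law)
  thus ?thesis by simp
qed

context freezing_walk
begin

text \<open>Averaging \<open>cls\<close> over the uniform vertex \<open>v\<close> gives
  \<open>cnt / S k\<close>, so this count satisfies a closed recursion. It is the source term of the
  mixed count, which in turn is the source term of the count over all vertices: a triangular system,
  solved in the same order by the three bounds further on.\<close>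

lemma expectation_cnt_active:
  assumes "m \<le> k" "k < n"
  shows "measure_pmf.expectation (tree_law x (Suc k)) (\<lambda>T. cnt m T (active T) (active T))
    = (1 + (if x (Suc k) = 1 then 2 else - 2) / S k)
      * measure_pmf.expectation (tree_law x k) (\<lambda>T. cnt m T (active T) (active T)) + 1"
    (is "_ = (1 + ?s / S k) * _ + 1")
proof -
  have "measure_pmf.expectation (tree_law x (Suc k)) (\<lambda>T. cnt m T (active T) (active T))
    = measure_pmf.expectation (tree_law x k) (\<lambda>T. (1 + ?s / S k) * cnt m T (active T) (active T) + 0 * 0 + 1)"
  proof (rule expectation_Suc')
    fix T assume T: "wf_tree k T" "finite (active T)" "real (card (active T)) = S k"
    have "cnt m (upd (Suc k) v T) (active (upd (Suc k) v T)) (active (upd (Suc k) v T))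
      = cnt m T (active T) (active T) + ?s * cls m T (active T) v + 1" if v: "v \<in> active T" for v
      using steps[of "Suc k"] assms v T active_subset_verts[of T] subsetD[OF active_subset_verts v]
      by (auto simp: upd_def cnt_attach cnt_remove_both)
    hence "(\<Sum>v\<in>active T. cnt m (upd (Suc k) v T) (active (upd (Suc k) v T)) (active (upd (Suc k) v T)))
      = (\<Sum>v\<in>active T. cnt m T (active T) (active T) + ?s * cls m T (active T) v + 1)"
      by (intro sum.cong) auto
    also have "\<dots> = S k * cnt m T (active T) (active T) + ?s * cnt m T (active T) (active T) + S k"
      using T by (simp add: sum.distrib cnt_cls[of m T "active T" "active T"] sum_distrib_left sum_negf)
    finally show "(\<Sum>v\<in>active T. cnt m (upd (Suc k) v T) (active (upd (Suc k) v T)) (active (upd (Suc k) v T))) / S k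
      = (1 + ?s / S k) * cnt m T (active T) (active T) + 0 * 0 + 1"
      using S_ge_1[of k] assms by (simp add: field_simps)
  qed (use assms in auto)
  thus ?thesis by (simp only: expectation_linear)
qed

lemma expectation_cnt_mixed:
  assumes "m \<le> k" "k < n"
  shows "measure_pmf.expectation (tree_law x (Suc k)) (\<lambda>T. cnt m T (active T) (verts T))
    = (if x (Suc k) = 1 then
         (1 + 1 / S k) * measure_pmf.expectation (tree_law x k) (\<lambda>T. cnt m T (active T) (verts T))
          + 1 / S k * measure_pmf.expectation (tree_law x k) (\<lambda>T. cnt m T (active T) (active T)) + 1
       else (1 - 1 / S k) * measure_pmf.expectation (tree_law x k) (\<lambda>T. cnt m T (active T) (verts T)))"
proof -
  let ?p = "x (Suc k) = 1"
  let ?a = "if ?p then 1 + 1 / S k else 1 - 1 / S k" and ?b = "if ?p then 1 / S k else 0"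
  let ?c = "if ?p then 1 else 0 :: real"
  have "measure_pmf.expectation (tree_law x (Suc k)) (\<lambda>T. cnt m T (active T) (verts T))
    = measure_pmf.expectation (tree_law x k)
       (\<lambda>T. ?a * cnt m T (active T) (verts T) + ?b * cnt m T (active T) (active T) + ?c)"
  proof (rule expectation_Suc')
    fix T assume T: "wf_tree k T" "finite (active T)" "finite (verts T)" "real (card (active T)) = S k"
    have *: "cnt m (upd (Suc k) v T) (active (upd (Suc k) v T)) (verts (upd (Suc k) v T))
      = cnt m T (active T) (verts T) + (if ?p then cls m T (verts T) v + cls m T (active T) v + 1
          else - cls m T (verts T) v)" if v: "v \<in> active T" for v
    proof -
      have vv: "v \<in> verts T" using v active_subset_verts by blast
      show ?thesis
        using steps[of "Suc k"] assms v vv T active_subset_verts[of T]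
        by (auto simp: upd_def cnt_attach cnt_remove_left verts_freeze)
    qed
    have "(\<Sum>v\<in>active T. cnt m (upd (Suc k) v T) (active (upd (Suc k) v T)) (verts (upd (Suc k) v T)))
      = (\<Sum>v\<in>active T. cnt m T (active T) (verts T) + (if ?p then cls m T (verts T) v + cls m T (active T) v + 1
          else - cls m T (verts T) v))"
      using * by (intro sum.cong) auto
    also have "\<dots> = S k * cnt m T (active T) (verts T) + (if ?p then cnt m T (active T) (verts T)
         + cnt m T (active T) (active T) + S k else - cnt m T (active T) (verts T))"
      using T by (simp add: sum.distrib cnt_cls[of m T "active T" "verts T"]
           cnt_cls[of m T "active T" "active T"] sum_negf sum_subtractf)
    finally show "(\<Sum>v\<in>active T. cnt m (upd (Suc k) v T) (active (upd (Suc k) v T)) (verts (upd (Suc k) v T))) / S k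
      = ?a * cnt m T (active T) (verts T) + ?b * cnt m T (active T) (active T) + ?c"
      using S_ge_1[of k] assms by (auto simp add: field_simps)
  qed (use assms in auto)
  thus ?thesis by (simp only: expectation_linear) simp
qed

lemma expectation_cnt_verts:
  assumes "m \<le> k" "k < n"
  shows "measure_pmf.expectation (tree_law x (Suc k)) (\<lambda>T. cnt m T (verts T) (verts T))
    = measure_pmf.expectation (tree_law x k) (\<lambda>T. cnt m T (verts T) (verts T))
      + (if x (Suc k) = 1 then 2 / S k * measure_pmf.expectation (tree_law x k) (\<lambda>T. cnt m T (active T) (verts T)) + 1 else 0)"
proof -
  let ?p = "x (Suc k) = 1"
  let ?b = "if ?p then 2 / S k else 0" and ?c = "if ?p then 1 else 0 :: real"
  have "measure_pmf.expectation (tree_law x (Suc k)) (\<lambda>T. cnt m T (verts T) (verts T))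
    = measure_pmf.expectation (tree_law x k)
       (\<lambda>T. 1 * cnt m T (verts T) (verts T) + ?b * cnt m T (active T) (verts T) + ?c)"
  proof (rule expectation_Suc')
    fix T assume T: "wf_tree k T" "finite (active T)" "finite (verts T)" "real (card (active T)) = S k"
    have *: "cnt m (upd (Suc k) v T) (verts (upd (Suc k) v T)) (verts (upd (Suc k) v T))
      = cnt m T (verts T) (verts T) + (if ?p then 2 * cls m T (verts T) v + 1 else 0)"
      if v: "v \<in> active T" for v
    proof -
      have vv: "v \<in> verts T" using v active_subset_verts by blast
      show ?thesis
        using steps[of "Suc k"] assms v vv T by (auto simp: upd_def cnt_attach verts_freeze)
    qed
    have "(\<Sum>v\<in>active T. cnt m (upd (Suc k) v T) (verts (upd (Suc k) v T)) (verts (upd (Suc k) v T)))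
      = (\<Sum>v\<in>active T. cnt m T (verts T) (verts T) + (if ?p then 2 * cls m T (verts T) v + 1 else 0))"
      using * by (intro sum.cong) auto
    also have "\<dots> = S k * cnt m T (verts T) (verts T) + (if ?p then 2 * cnt m T (active T) (verts T) + S k else 0)"
      using T by (simp add: sum.distrib cnt_cls[of m T "active T" "verts T"] sum_distrib_left)
    finally show "(\<Sum>v\<in>active T. cnt m (upd (Suc k) v T) (verts (upd (Suc k) v T)) (verts (upd (Suc k) v T))) / S k
      = 1 * cnt m T (verts T) (verts T) + ?b * cnt m T (active T) (verts T) + ?c"
      using S_ge_1[of k] assms by (auto simp add: field_simps)
  qed (use assms in auto)
  thus ?thesis by (simp only: expectation_linear) simp
qed

lemma cnt_base:
  assumes "T \<in> set_pmf (tree_law x m)" "A \<subseteq> B" "B \<subseteq> verts T"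
  shows "cnt m T A B = real (card A)"
proof -
  have B: "B \<subseteq> {..m}" "finite B" using wf_treeD(1,3)[OF wf_tree_law[OF assms(1)]] assms(3) finite_subset by blast+
  have "(\<Sum>v\<in>B. of_bool (anc m T u = anc m T v) :: real) = (\<Sum>v\<in>B. of_bool (u = v))" if "u \<in> A" for u
    using B assms(2) that by (intro sum.cong) (auto simp: anc_le_self subset_iff)
  moreover have "(\<Sum>v\<in>B. of_bool (u = v) :: real) = 1" if "u \<in> A" for u
    using B assms(2) that by (subst sum.mono_neutral_cong_right[where S="{u}" and h="\<lambda>_. 1"]) auto
  ultimately show ?thesis by (simp add: cnt_def)
qed

text \<open>Completing the square, \<open>(S k)\<^sup>2 \<plusminus> 2 S k \<le> (S k \<plusminus>
  1)\<^sup>2\<close>, so the count divided by \<open>(S k)\<^sup>2\<close> grows at each step only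
  by the contribution of the added 1. At time \<open>m\<close> every vertex is its own ancestor,
  whence the initial value \<open>S m / (S m)\<^sup>2\<close>.\<close>

lemma cnt_active_bound:
  assumes "m \<le> k" "k \<le> n"
  shows "measure_pmf.expectation (tree_law x k) (\<lambda>T. cnt m T (active T) (active T)) / (S k)\<^sup>2
    \<le> 1 / S m + (\<Sum>i\<in>{m<..k}. 1 / (S i)\<^sup>2)"
  using assms
proof (induction k rule: dec_induct)
  case base
  have "measure_pmf.expectation (tree_law x m) (\<lambda>T. cnt m T (active T) (active T)) = S m"
    using base by (intro expectation_const) (simp add: cnt_base active_subset_verts card_active)
  thus ?case using S_ge_1[OF base] by (simp add: power2_eq_square)
next
  case (step k)
  define W where "W = measure_pmf.expectation (tree_law x k) (\<lambda>T. cnt m T (active T) (active T))"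
  have W: "W \<ge> 0" unfolding W_def by (intro integral_nonneg_AE) (auto simp: cnt_def intro!: sum_nonneg)
  have S: "S k \<ge> 1" "S (Suc k) \<ge> 1" using S_ge_1 step by auto
  define s where "s = (if x (Suc k) = 1 then 2 else - 2 :: real)"
  have xs: "S (Suc k) = S k + s / 2" using steps[of "Suc k"] step by (auto simp: S_Suc s_def)
  have "(1 + s / S k) * W \<le> W / (S k)\<^sup>2 * (S (Suc k))\<^sup>2"
  proof -
    have "(S k)\<^sup>2 + s * S k \<le> (S k + s / 2)\<^sup>2" by (simp add: power2_eq_square algebra_simps)
    hence "W / (S k)\<^sup>2 * ((S k)\<^sup>2 + s * S k) \<le> W / (S k)\<^sup>2 * (S (Suc k))\<^sup>2"
      unfolding xs using W by (intro mult_left_mono) auto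
    moreover have "W / (S k)\<^sup>2 * ((S k)\<^sup>2 + s * S k) = (1 + s / S k) * W"
      using S by (simp add: field_simps power2_eq_square)
    ultimately show ?thesis by simp
  qed
  hence "((1 + s / S k) * W + 1) / (S (Suc k))\<^sup>2 \<le> W / (S k)\<^sup>2 + 1 / (S (Suc k))\<^sup>2"
    using S by (simp add: add_divide_distrib pos_divide_le_eq)
  moreover have "measure_pmf.expectation (tree_law x (Suc k)) (\<lambda>T. cnt m T (active T) (active T)) = (1 + s / S k) * W + 1"
    using expectation_cnt_active[of m k] step by (simp add: W_def s_def)
  ultimately show ?case using step by (simp add: W_def greaterThanAtMost_Suc)
qed

text \<open>Division by \<open>S k\<close> removes the multiplicative factors
  \<open>1 \<plusminus> 1 / S k\<close> exactly; what remains at an upward step is at most the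
  normalised active count plus \<open>1 / S (Suc k)\<close>.\<close>

lemma cnt_mixed_bound:
  assumes "m \<le> k" "k \<le> n"
    and B: "\<And>k. m \<le> k \<Longrightarrow> k \<le> n \<Longrightarrow>
       measure_pmf.expectation (tree_law x k) (\<lambda>T. cnt m T (active T) (active T)) / (S k)\<^sup>2 \<le> B"
  shows "measure_pmf.expectation (tree_law x k) (\<lambda>T. cnt m T (active T) (verts T)) / S k
    \<le> 1 + real (k - m) * B + (\<Sum>i\<in>{m<..k}. 1 / S i)"
  using assms(1,2)
proof (induction k rule: dec_induct)
  case base
  have "measure_pmf.expectation (tree_law x m) (\<lambda>T. cnt m T (active T) (verts T)) = S m"
    using base by (intro expectation_const) (simp add: cnt_base active_subset_verts card_active)
  thus ?case using S_ge_1[OF base] by simp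
next
  case (step k)
  define W where "W = measure_pmf.expectation (tree_law x k) (\<lambda>T. cnt m T (active T) (active T))"
  define X where "X = measure_pmf.expectation (tree_law x k) (\<lambda>T. cnt m T (active T) (verts T))"
  define X' where "X' = measure_pmf.expectation (tree_law x (Suc k)) (\<lambda>T. cnt m T (active T) (verts T))"
  have W: "W \<ge> 0" unfolding W_def by (intro integral_nonneg_AE) (auto simp: cnt_def intro!: sum_nonneg)
  have S: "S k \<ge> 1" "S (Suc k) \<ge> 1" using S_ge_1 step by auto
  have WB: "W / (S k)\<^sup>2 \<le> B" using B[of k] step by (simp add: W_def)
  have B0: "B \<ge> 0" using WB W by (meson divide_nonneg_nonneg order_trans zero_le_power2)
  have "X' / S (Suc k) \<le> X / S k + B + 1 / S (Suc k)"
  proof (cases "x (Suc k) = 1")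
    case True
    have s: "S (Suc k) = S k + 1" using True by (simp add: S_Suc)
    have X': "X' = X * (S (Suc k) / S k) + W / S k + 1"
      using expectation_cnt_mixed[of m k] step True S by (simp add: X'_def X_def W_def s field_simps)
    have "X' / S (Suc k) = X / S k + W / (S k * S (Suc k)) + 1 / S (Suc k)"
      unfolding X' using S by (simp add: add_divide_distrib)
    moreover have "W / (S k * S (Suc k)) \<le> W / (S k)\<^sup>2"
      using W S s by (intro divide_left_mono) (auto simp: power2_eq_square)
    ultimately show ?thesis using WB by linarith
  next
    case False
    hence s: "S (Suc k) = S k - 1" using steps[of "Suc k"] step by (auto simp: S_Suc)
    have X': "X' = X * (S (Suc k) / S k)"
      using expectation_cnt_mixed[of m k] step False S by (simp add: X'_def X_def s field_simps)
    have "X' / S (Suc k) = X / S k"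
      unfolding X' using S by simp
    thus ?thesis using B0 S by simp
  qed
  thus ?case using step
    by (simp add: X_def X'_def greaterThanAtMost_Suc Suc_diff_le algebra_simps)
qed

lemma cnt_verts_bound:
  assumes "m \<le> k" "k \<le> n"
    and B: "\<And>k. m \<le> k \<Longrightarrow> k \<le> n \<Longrightarrow>
       measure_pmf.expectation (tree_law x k) (\<lambda>T. cnt m T (active T) (verts T)) / S k \<le> B"
  shows "measure_pmf.expectation (tree_law x k) (\<lambda>T. cnt m T (verts T) (verts T))
    \<le> real m + 1 + real (k - m) * (2 * B + 1)"
  using assms(1,2)
proof (induction k rule: dec_induct)
  case base
  have "cnt m T (verts T) (verts T) \<le> real m + 1" if "T \<in> set_pmf (tree_law x m)" for T
    using card_mono[OF _ wf_treeD(1)[OF wf_tree_law[OF that]]] that by (simp add: cnt_base)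
  hence "measure_pmf.expectation (tree_law x m) (\<lambda>T. cnt m T (verts T) (verts T))
     \<le> measure_pmf.expectation (tree_law x m) (\<lambda>T. real m + 1)"
    by (intro expectation_mono finite_set_tree_law)
  thus ?case by simp
next
  case (step k)
  define X where "X = measure_pmf.expectation (tree_law x k) (\<lambda>T. cnt m T (active T) (verts T))"
  have X: "X \<ge> 0" unfolding X_def by (intro integral_nonneg_AE) (auto simp: cnt_def intro!: sum_nonneg)
  have XB: "X / S k \<le> B" using B[of k] step by (simp add: X_def)
  have "X / S k \<ge> 0" using X S_ge_1[of k] step by simp
  hence "(if x (Suc k) = 1 then 2 / S k * X + 1 else 0) \<le> 2 * B + 1"
    using XB by auto
  moreover have "real (Suc k - m) * (2 * B + 1) = real (k - m) * (2 * B + 1) + (2 * B + 1)"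
    using step by (simp add: Suc_diff_le algebra_simps)
  ultimately show ?case
    using step expectation_cnt_verts[of m k, folded X_def] by linarith
qed

end

section \<open>The height martingale\<close>

context freezing_walk
begin

definition mart :: "nat \<Rightarrow> real \<Rightarrow> nat \<Rightarrow> lab_tree \<Rightarrow> real" where
  "mart m z k T = Z m z T / (S k * growth x m k z)"

lemma growth_pos:
  assumes "k \<le> n" "0 < z" shows "growth x m k z > 0"
  unfolding growth_def
proof (rule prod_pos)
  fix i assume i: "i \<in> {m<..k}"
  have "S i \<ge> 1" using S_ge_1[of i] i assms by auto
  hence "(1 - z) / S i < 1" using assms by (simp add: divide_less_eq)
  thus "0 < 1 + of_bool (x i = 1) * (z - 1) / real_of_int (walk x i)"
    unfolding S_def[symmetric] by (auto simp: diff_divide_distrib)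
qed

lemma mart_base:
  assumes "m \<le> n" "T \<in> set_pmf (tree_law x m)"
  shows "mart m z m T = 1"
  using Z_base[OF assms] S_ge_1[OF assms(1)] by (simp add: mart_def)

text \<open>Both kinds of step move the martingale by a multiple of the weight of the chosen vertex
  minus the mean weight, and the factor \<open>\<kappa>\<close> does not depend on the vertex; hence
  the increment is centred. It is \<open>z / ((S k + z) * growth)\<close> for an attachment and
  \<open>- 1 / (S (Suc k) * growth)\<close> for a freezing, and \<open>1 \<le> z\<close> puts both
  below one bound.\<close>

lemma mart_step:
  assumes T: "wf_tree k T" "finite (active T)" "real (card (active T)) = S k"
    and mk: "m \<le> k" "k < n" and z: "1 \<le> z"
  obtains \<kappa> where "\<And>v. v \<in> active T \<Longrightarrow>
      mart m z (Suc k) (upd (Suc k) v T) = mart m z k T + \<kappa> * (z ^ rdep m T v - Z m z T / S k)"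
    "\<bar>\<kappa>\<bar> \<le> z / (S (Suc k) * growth x m k z)"
proof -
  have S: "S k \<ge> 1" "S (Suc k) \<ge> 1" using S_ge_1 mk by auto
  have g: "growth x m k z > 0" using growth_pos mk z by simp
  show thesis
  proof (cases "x (Suc k) = 1")
    case True
    have eq: "mart m z (Suc k) (upd (Suc k) v T)
       = mart m z k T + z / ((S k + z) * growth x m k z) * (z ^ rdep m T v - Z m z T / S k)"
      if v: "v \<in> active T" for v
      using Z_attach[OF T(1) v mk(1)] S_growth_Suc[OF mk, of z] True S g z
      by (simp add: mart_def upd_def divide_simps) (simp add: algebra_simps)
    have s: "S (Suc k) = S k + 1" using True by (simp add: S_Suc)
    have "z / ((S k + z) * growth x m k z) \<le> z / (S (Suc k) * growth x m k z)"
      using S g z s by (intro divide_left_mono mult_right_mono mult_pos_pos) auto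
    thus ?thesis using eq S g z by (intro that[of "z / ((S k + z) * growth x m k z)"]) auto
  next
    case False
    hence x1: "x (Suc k) = -1" using steps[of "Suc k"] mk by auto
    hence s: "S (Suc k) = S k - 1" by (simp add: S_Suc)
    have eq: "mart m z (Suc k) (upd (Suc k) v T)
       = mart m z k T + - 1 / (S (Suc k) * growth x m k z) * (z ^ rdep m T v - Z m z T / S k)"
      if v: "v \<in> active T" for v
      using Z_freeze[OF T(2) v, of m z "Suc k"] S_growth_Suc[OF mk, of z] x1 S g z
      by (simp add: mart_def upd_def s divide_simps) (simp add: algebra_simps)
    have "1 / (S (Suc k) * growth x m k z) \<le> z / (S (Suc k) * growth x m k z)"
      using S g z by (intro divide_right_mono) auto
    thus ?thesis using eq S g z by (intro that[of "- 1 / (S (Suc k) * growth x m k z)"]) auto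
  qed
qed

text \<open>\<open>abs_powr_add_le\<close> is applied to the martingale minus 1 and its increment.
  The constant is \<open>6 = 3 * 2\<close>: the 3 comes from that inequality, the 2 from treating a
  weight and the mean weight separately, with the power mean inequality reducing the second to the
  first.\<close>

lemma mart_moment:
  assumes z: "1 \<le> z" and q: "1 < q" "q \<le> 2" and "m \<le> k" "k \<le> n"
  shows "measure_pmf.expectation (tree_law x k) (\<lambda>T. \<bar>mart m z k T - 1\<bar> powr q)
    \<le> (\<Sum>i\<in>{m<..k}. 6 * (z / (S i * growth x m (i - 1) z)) powr q * growth x m (i - 1) (z powr q))"
  using assms(4,5)
proof (induction k rule: dec_induct)
  case base
  have "measure_pmf.expectation (tree_law x m) (\<lambda>T. \<bar>mart m z m T - 1\<bar> powr q) = 0"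
    using base by (intro expectation_const) (simp add: mart_base)
  thus ?case by simp
next
  case (step k)
  have S: "S k \<ge> 1" "S (Suc k) \<ge> 1" using S_ge_1 step by auto
  define K where "K = (z / (S (Suc k) * growth x m k z)) powr q"
  have "measure_pmf.expectation (tree_law x (Suc k)) (\<lambda>T. \<bar>mart m z (Suc k) T - 1\<bar> powr q)
    = measure_pmf.expectation (tree_law x k)
        (\<lambda>T. (\<Sum>v\<in>active T. \<bar>mart m z (Suc k) (upd (Suc k) v T) - 1\<bar> powr q) / S k)"
    using step by (intro expectation_Suc) auto
  also have "\<dots> \<le> measure_pmf.expectation (tree_law x k)
      (\<lambda>T. 1 * \<bar>mart m z k T - 1\<bar> powr q + 6 * K / S k * Z m (z powr q) T + 0)"
  proof (rule expectation_mono[OF finite_set_tree_law])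
    fix T assume T': "T \<in> set_pmf (tree_law x k)"
    have T: "wf_tree k T" "finite (active T)" "real (card (active T)) = S k" "active T \<noteq> {}"
      using wf_tree_law[OF T'] card_active[OF _ T'] active_nonempty[OF _ T'] step by auto
    obtain \<kappa> where \<kappa>: "\<And>v. v \<in> active T \<Longrightarrow>
      mart m z (Suc k) (upd (Suc k) v T) = mart m z k T + \<kappa> * (z ^ rdep m T v - Z m z T / S k)"
      "\<bar>\<kappa>\<bar> \<le> z / (S (Suc k) * growth x m k z)"
      using mart_step[OF T(1-3), of m z] step z by auto
    define a where "a = mart m z k T - 1"
    define b where "b v = \<kappa> * (z ^ rdep m T v - Z m z T / S k)" for v
    define \<mu> where "\<mu> = Z m z T / S k"
    have \<mu>: "\<mu> \<ge> 0" unfolding \<mu>_def Z_def using z S by (intro divide_nonneg_nonneg sum_nonneg) auto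
    \<comment> \<open>The \<open>q\<close>-th power of a weight at \<open>z\<close> is a weight at
      \<open>z powr q\<close>, so the moment of the increment is again a first moment given by
      \<open>expectation_Z\<close>.\<close>
    have pw: "(z ^ r) powr q = (z powr q) ^ r" for r
      using z by (simp add: powr_realpow[symmetric] powr_powr mult.commute)
    have sb: "(\<Sum>v\<in>active T. b v) = 0"
    proof -
      have "(\<Sum>v\<in>active T. b v) = \<kappa> * (Z m z T - real (card (active T)) * (Z m z T / S k))"
        by (simp add: b_def Z_def sum_distrib_left[symmetric] sum_subtractf)
      thus ?thesis using T(3) S by simp
    qed
    have Kq: "\<bar>\<kappa>\<bar> powr q \<le> K" unfolding K_def using \<kappa>(2) q by (intro powr_mono2) auto
    have bq: "\<bar>b v\<bar> powr q \<le> K * ((z powr q) ^ rdep m T v + \<mu> powr q)" for v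
    proof -
      have zr: "0 \<le> z ^ rdep m T v" using z by simp
      \<comment> \<open>Both quantities are nonnegative, so their distance is at most their maximum;
        no factor \<open>2 powr q\<close> arises.\<close>
      have "\<bar>z ^ rdep m T v - \<mu>\<bar> powr q \<le> (max (z ^ rdep m T v) \<mu>) powr q"
        using zr \<mu> q by (intro powr_mono2) auto
      also have "\<dots> \<le> (z ^ rdep m T v) powr q + \<mu> powr q" by (auto simp: max_def)
      finally have "\<bar>\<kappa>\<bar> powr q * \<bar>z ^ rdep m T v - \<mu>\<bar> powr q \<le> K * ((z ^ rdep m T v) powr q + \<mu> powr q)"
        using Kq by (intro mult_mono) (auto simp: K_def)
      thus ?thesis by (simp add: b_def \<mu>_def abs_mult powr_mult pw)
    qed
    have \<mu>q: "S k * \<mu> powr q \<le> Z m (z powr q) T"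
      using power_mean_powr[OF T(2,4), of "\<lambda>v. z ^ rdep m T v" q] z q T(3) S
      by (simp add: \<mu>_def Z_def pw field_simps)
    have "(\<Sum>v\<in>active T. \<bar>a + b v\<bar> powr q)
      \<le> (\<Sum>v\<in>active T. \<bar>a\<bar> powr q + (q * sgn a * \<bar>a\<bar> powr (q - 1)) * b v
             + 3 * (K * ((z powr q) ^ rdep m T v + \<mu> powr q)))"
    proof (rule sum_mono)
      fix v
      show "\<bar>a + b v\<bar> powr q \<le> \<bar>a\<bar> powr q + (q * sgn a * \<bar>a\<bar> powr (q - 1)) * b v
             + 3 * (K * ((z powr q) ^ rdep m T v + \<mu> powr q))"
        using abs_powr_add_le[OF q, of a "b v"] bq[of v] by linarith
    qed
    also have "\<dots> = S k * \<bar>a\<bar> powr q + 3 * K * (Z m (z powr q) T + S k * \<mu> powr q)"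
      using T(3) sb unfolding sum.distrib sum_distrib_left[symmetric] Z_def by (simp add: algebra_simps)
    also have "\<dots> \<le> S k * \<bar>a\<bar> powr q + 3 * K * (2 * Z m (z powr q) T)"
      using \<mu>q by (intro add_left_mono mult_left_mono) (auto simp: K_def)
    finally have "(\<Sum>v\<in>active T. \<bar>a + b v\<bar> powr q) / S k \<le> \<bar>a\<bar> powr q + 6 * K / S k * Z m (z powr q) T"
      using S by (simp add: field_simps)
    moreover have "(\<Sum>v\<in>active T. \<bar>a + b v\<bar> powr q)
       = (\<Sum>v\<in>active T. \<bar>mart m z (Suc k) (upd (Suc k) v T) - 1\<bar> powr q)"
    proof (intro sum.cong refl)
      fix v assume v: "v \<in> active T"
      have "a + b v = mart m z (Suc k) (upd (Suc k) v T) - 1"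
        using \<kappa>(1)[OF v] unfolding a_def b_def by linarith
      thus "\<bar>a + b v\<bar> powr q = \<bar>mart m z (Suc k) (upd (Suc k) v T) - 1\<bar> powr q" by simp
    qed
    ultimately show "(\<Sum>v\<in>active T. \<bar>mart m z (Suc k) (upd (Suc k) v T) - 1\<bar> powr q) / S k
      \<le> 1 * \<bar>mart m z k T - 1\<bar> powr q + 6 * K / S k * Z m (z powr q) T + 0" by (simp add: a_def)
  qed
  also have "\<dots> = measure_pmf.expectation (tree_law x k) (\<lambda>T. \<bar>mart m z k T - 1\<bar> powr q)
      + 6 * K * growth x m k (z powr q)"
    unfolding expectation_linear using expectation_Z[of m k "z powr q"] step S by simp
  finally show ?case using step by (simp add: K_def greaterThanAtMost_Suc)
qed

end

section \<open>The deterministic sums\<close>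

text \<open>Holds without an upper bound on \<open>t\<close>: beyond 1 the exponent is not positive.
  This is needed because \<open>(z - 1) / S i\<close> can exceed 1 while \<open>S i\<close> is
  small.\<close>

lemma exp_diff_square_le: "0 \<le> t \<Longrightarrow> exp (t - t\<^sup>2) \<le> 1 + (t :: real)"
proof (cases "t \<le> 1")
  case True
  assume "0 \<le> t"
  hence "t - t\<^sup>2 \<le> ln (1 + t)" using True ln_one_plus_pos_lower_bound by blast
  thus ?thesis using \<open>0 \<le> t\<close> by (subst (asm) ln_ge_iff) auto
next
  case False
  assume t: "0 \<le> t"
  have "t * 1 \<le> t * t" using False by (intro mult_left_mono) auto
  hence "exp (t - t\<^sup>2) \<le> 1" by (simp add: power2_eq_square)
  thus ?thesis using t by linarith
qed

context freezing_walk
begin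

definition inv_sq :: "nat \<Rightarrow> nat \<Rightarrow> real" where
  "inv_sq m k = (\<Sum>i\<in>{m<..k}. 1 / (S i)\<^sup>2)"

lemma growth_le:
  assumes "k \<le> n" "0 < z"
  shows "growth x m k z \<le> exp ((z - 1) * hp x m k)"
proof -
  have "growth x m k z \<le> (\<Prod>i\<in>{m<..k}. exp (of_bool (x i = 1) * (z - 1) / S i))"
    unfolding growth_def S_def[symmetric]
  proof (rule prod_mono)
    fix i assume i: "i \<in> {m<..k}"
    have "S i \<ge> 1" using S_ge_1[of i] i assms by auto
    hence "(1 - z) / S i \<le> 1" using assms by (simp add: divide_le_eq)
    thus "0 \<le> 1 + of_bool (x i = 1) * (z - 1) / S i \<and>
        1 + of_bool (x i = 1) * (z - 1) / S i \<le> exp (of_bool (x i = 1) * (z - 1) / S i)"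
      using exp_ge_add_one_self[of "(z - 1) / S i"] by (auto simp: diff_divide_distrib)
  qed
  also have "\<dots> = exp ((z - 1) * hp x m k)"
    by (simp add: hp_def S_def exp_sum sum_distrib_left mult.commute)
  finally show ?thesis .
qed

lemma growth_ge:
  assumes "k \<le> n" "1 \<le> z"
  shows "exp ((z - 1) * hp x m k - (z - 1)\<^sup>2 * inv_sq m k) \<le> growth x m k z"
proof -
  have "(z - 1) * hp x m k - (z - 1)\<^sup>2 * inv_sq m k
      = (\<Sum>i\<in>{m<..k}. of_bool (x i = 1) * (z - 1) / S i - ((z - 1) / S i)\<^sup>2)"
    by (simp add: hp_def inv_sq_def S_def sum_distrib_left sum_subtractf power_divide mult.commute)
  also have "exp \<dots> = (\<Prod>i\<in>{m<..k}. exp (of_bool (x i = 1) * (z - 1) / S i - ((z - 1) / S i)\<^sup>2))"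
    by (simp add: exp_sum)
  also have "\<dots> \<le> growth x m k z"
    unfolding growth_def S_def[symmetric]
  proof (rule prod_mono)
    fix i assume i: "i \<in> {m<..k}"
    have "S i \<ge> 1" using S_ge_1[of i] i assms by auto
    hence "0 \<le> (z - 1) / S i" using assms by simp
    from exp_diff_square_le[OF this]
    show "0 \<le> exp (of_bool (x i = 1) * (z - 1) / S i - ((z - 1) / S i)\<^sup>2) \<and>
        exp (of_bool (x i = 1) * (z - 1) / S i - ((z - 1) / S i)\<^sup>2)
          \<le> 1 + of_bool (x i = 1) * (z - 1) / S i"
      by auto
  qed
  finally show ?thesis .
qed

lemma hp_nonneg: "k \<le> n \<Longrightarrow> 0 \<le> hp x m k"
  unfolding hp_def S_def[symmetric]
proof (rule sum_nonneg)
  fix i assume "k \<le> n" "i \<in> {m<..k}"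
  thus "0 \<le> of_bool (x i = 1) / S i" using S_ge_1[of i] by simp
qed

lemma hp_split: "m \<le> k \<Longrightarrow> k \<le> j \<Longrightarrow> hp x m j = hp x m k + hp x k j"
  unfolding hp_def by (subst sum.union_disjoint[symmetric]) (auto simp: ivl_disj_un)

lemma hp_le_const:
  assumes "k \<le> n" "0 < a" "\<And>i. m < i \<Longrightarrow> i \<le> k \<Longrightarrow> a \<le> S i"
  shows "hp x m k \<le> real (k - m) / a"
proof -
  have "hp x m k \<le> (\<Sum>i\<in>{m<..k}. 1 / a)"
    unfolding hp_def S_def[symmetric]
  proof (rule sum_mono)
    fix i assume i: "i \<in> {m<..k}"
    have "a \<le> S i" using assms(3) i by auto
    thus "of_bool (x i = 1) / S i \<le> 1 / a" using assms(2) by (simp add: frac_le)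
  qed
  thus ?thesis by simp
qed

lemma ln_S_step:
  assumes "Suc k \<le> n"
  shows "real_of_int (x (Suc k)) / S (Suc k) \<le> ln (S (Suc k)) - ln (S k)"
    "ln (S (Suc k)) - ln (S k) \<le> real_of_int (x (Suc k)) / S (Suc k) + 2 / (S (Suc k))\<^sup>2"
proof -
  have S: "S k \<ge> 1" "S (Suc k) \<ge> 1" using S_ge_1 assms by auto
  define t where "t = 1 / S (Suc k)"
  have t: "0 < t" "t \<le> 1" using S by (auto simp: t_def)
  consider "x (Suc k) = 1" | "x (Suc k) = -1" using steps[of "Suc k"] assms by auto
  hence "real_of_int (x (Suc k)) * t \<le> ln (S (Suc k)) - ln (S k) \<and>
    ln (S (Suc k)) - ln (S k) \<le> real_of_int (x (Suc k)) * t + 2 * t\<^sup>2"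
  proof cases
    case 1
    hence s: "S (Suc k) = S k + 1" by (simp add: S_Suc)
    \<comment> \<open>An upward step from a positive value ends at 2 or more;
      \<open>t \<le> 1 / 2\<close> is what the quadratic lower bound for \<open>ln (1 - t)\<close>
      requires.\<close>
    have t2: "t \<le> 1 / 2" using S s by (simp add: t_def)
    have "1 - t = S k / S (Suc k)" using S s by (simp add: t_def field_simps)
    hence "ln (S k) - ln (S (Suc k)) = ln (1 - t)" using S by (simp add: ln_div)
    thus ?thesis
      using ln_one_minus_pos_lower_bound[of t] ln_add_one_self_le_self2[of "-t"] t t2 1 by simp
  next
    case 2
    hence s: "S (Suc k) = S k - 1" by (simp add: S_Suc)
    have "1 + t = S k / S (Suc k)" using S s by (simp add: t_def field_simps)
    hence "ln (S k) - ln (S (Suc k)) = ln (1 + t)" using S by (simp add: ln_div)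
    moreover have "t\<^sup>2 \<le> 2 * t\<^sup>2" by simp
    ultimately show ?thesis
      using ln_one_plus_pos_lower_bound[of t] ln_add_one_self_le_self2[of "t"] t 2 by simp
  qed
  thus "real_of_int (x (Suc k)) / S (Suc k) \<le> ln (S (Suc k)) - ln (S k)"
    "ln (S (Suc k)) - ln (S k) \<le> real_of_int (x (Suc k)) / S (Suc k) + 2 / (S (Suc k))\<^sup>2"
    by (auto simp: t_def power_divide)
qed

text \<open>Since \<open>of_bool (x i = 1) = (1 + x i) / 2\<close>, and \<open>x i / S i\<close> is the increment of \<open>ln \<circ> S\<close> up to
  a summable error, the sum \<open>hp\<close> is half of \<open>\<Sum> 1 / S i\<close> plus half of the increment of \<open>ln \<circ> S\<close>.\<close>
lemma hp_bounds:
  assumes "m \<le> k" "k \<le> n"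
  shows "2 * hp x m k \<le> (\<Sum>i\<in>{m<..k}. 1 / S i) + ln (S k) - ln (S m)"
    "(\<Sum>i\<in>{m<..k}. 1 / S i) + ln (S k) - ln (S m) - 2 * inv_sq m k \<le> 2 * hp x m k"
proof -
  have "2 * hp x m k \<le> (\<Sum>i\<in>{m<..k}. 1 / S i) + ln (S k) - ln (S m) \<and>
    (\<Sum>i\<in>{m<..k}. 1 / S i) + ln (S k) - ln (S m) - 2 * inv_sq m k \<le> 2 * hp x m k"
    using assms
  proof (induction k rule: dec_induct)
    case (step k)
    have e: "2 * (of_bool (x (Suc k) = 1) / real_of_int (walk x (Suc k)))
      = 1 / S (Suc k) + real_of_int (x (Suc k)) / S (Suc k)"
      using steps[of "Suc k"] step by (auto simp: S_def)
    have "inv_sq m (Suc k) = inv_sq m k + 1 / (S (Suc k))\<^sup>2"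
      using step by (simp add: inv_sq_def greaterThanAtMost_Suc)
    thus ?case using step ln_S_step[of k] e
      by (simp add: hp_Suc greaterThanAtMost_Suc)
  qed (simp add: inv_sq_def)
  thus "2 * hp x m k \<le> (\<Sum>i\<in>{m<..k}. 1 / S i) + ln (S k) - ln (S m)"
    "(\<Sum>i\<in>{m<..k}. 1 / S i) + ln (S k) - ln (S m) - 2 * inv_sq m k \<le> 2 * hp x m k" by auto
qed

end

section \<open>Harmonic sums and the logarithmic size of \<open>hp\<close>\<close>

lemma sum_inverse_squares_le:
  assumes "1 \<le> m" "m \<le> k"
  shows "(\<Sum>i\<in>{m<..k}. 1 / (real i)\<^sup>2) \<le> 1 / real m - 1 / real k"
  using assms(2)
proof (induction k rule: dec_induct)
  case (step k)
  have k: "real k > 0" using step assms by simp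
  have "1 / (real (Suc k))\<^sup>2 \<le> 1 / (real k * real (Suc k))"
    using k by (intro divide_left_mono) (auto simp: power2_eq_square)
  also have "\<dots> = 1 / real k - 1 / real (Suc k)" using k by (simp add: field_simps)
  finally show ?case using step by (simp add: greaterThanAtMost_Suc)
qed auto

lemma sum_inverse_bounds:
  assumes "1 \<le> m" "m \<le> k"
  shows "(\<Sum>i\<in>{m<..k}. 1 / real i) \<le> ln (real k / real m)"
    "ln (real k / real m) - ln 2 \<le> (\<Sum>i\<in>{m<..k}. 1 / real i)"
proof -
  have "(\<Sum>i\<in>{m<..k}. 1 / real i) \<le> ln (real k) - ln (real m) \<and>
    ln (real (Suc k)) - ln (real (Suc m)) \<le> (\<Sum>i\<in>{m<..k}. 1 / real i)"
    using assms(2)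
  proof (induction k rule: dec_induct)
    case (step k)
    have k: "real k > 0" using step assms by simp
    have "1 + - (1 / real (Suc k)) = real k / real (Suc k)" using k by (simp add: field_simps)
    hence "1 / real (Suc k) \<le> ln (real (Suc k)) - ln (real k)"
      using ln_add_one_self_le_self2[of "- (1 / real (Suc k))"] k by (simp add: ln_div)
    moreover have "1 + 1 / real (Suc k) = real (Suc (Suc k)) / real (Suc k)" by (simp add: field_simps)
    hence "ln (real (Suc (Suc k))) - ln (real (Suc k)) \<le> 1 / real (Suc k)"
      using ln_add_one_self_le_self[of "1 / real (Suc k)"] k by (simp add: ln_div)
    ultimately show ?case using step by (simp add: greaterThanAtMost_Suc)
  qed auto
  \<comment> \<open>Undoing the shift by one in the lower bound costs \<open>ln 2\<close>, since
    \<open>m + 1 \<le> 2 m\<close>.\<close>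
  moreover have "ln (real (Suc m)) \<le> ln (2 * real m)" using assms by (subst ln_le_cancel_iff) auto
  moreover have "ln (real k) \<le> ln (real (Suc k))" using assms by (subst ln_le_cancel_iff) auto
  moreover have "ln (real k / real m) = ln (real k) - ln (real m)" "ln (2 * real m) = ln 2 + ln (real m)"
    using assms by (simp_all add: ln_div ln_mult)
  ultimately show "(\<Sum>i\<in>{m<..k}. 1 / real i) \<le> ln (real k / real m)"
    "ln (real k / real m) - ln 2 \<le> (\<Sum>i\<in>{m<..k}. 1 / real i)"
    by linarith+
qed

context freezing_walk
begin

text \<open>In the coefficient, \<open>1 / lo\<close> comes from the harmonic sum of the
  \<open>1 / S i\<close> and 1 from the growth of \<open>ln (S i)\<close>; for \<open>lo\<close>
  tending to \<open>c\<close> it becomes \<open>l\<close>.\<close>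

lemma hp_le_ln:
  assumes "1 \<le> m" "m \<le> k" "k \<le> n" and "0 < lo" "lo \<le> hi"
    and "\<And>i. m \<le> i \<Longrightarrow> i \<le> k \<Longrightarrow> lo * real i \<le> S i \<and> S i \<le> hi * real i"
  shows "hp x m k \<le> (1 + 1 / lo) / 2 * ln (real k / real m) + ln (hi / lo) / 2"
proof -
  have "(\<Sum>i\<in>{m<..k}. 1 / S i) \<le> (\<Sum>i\<in>{m<..k}. 1 / lo * (1 / real i))"
  proof (rule sum_mono)
    fix i assume i: "i \<in> {m<..k}"
    have "lo * real i \<le> S i" "0 < lo * real i" using assms(4) assms(6)[of i] i by auto
    hence "1 / S i \<le> 1 / (lo * real i)" by (intro divide_left_mono) auto
    thus "1 / S i \<le> 1 / lo * (1 / real i)" by simp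
  qed
  also have "\<dots> = 1 / lo * (\<Sum>i\<in>{m<..k}. 1 / real i)" by (simp only: sum_distrib_left)
  also have "\<dots> \<le> 1 / lo * ln (real k / real m)"
    using sum_inverse_bounds(1)[OF assms(1,2)] assms(4) by (intro mult_left_mono) auto
  finally have 1: "(\<Sum>i\<in>{m<..k}. 1 / S i) \<le> 1 / lo * ln (real k / real m)" .
  have S: "0 < S k" "0 < S m" using S_ge_1[of k] S_ge_1[of m] assms by auto
  have "ln (S k) \<le> ln (hi * real k)" using assms(6)[of k] S assms(1-5) by simp
  moreover have "ln (lo * real m) \<le> ln (S m)" using assms(6)[of m] S assms(1-5) by simp
  ultimately have "ln (S k) - ln (S m) \<le> ln (real k / real m) + ln (hi / lo)"
    using assms by (simp add: ln_mult ln_div)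
  thus ?thesis using hp_bounds(1)[OF assms(2,3)] 1 by (simp add: algebra_simps add_divide_distrib)
qed

lemma inv_sq_le:
  assumes "1 \<le> m" "m \<le> k" "0 < lo" "\<And>i. m < i \<Longrightarrow> i \<le> k \<Longrightarrow> lo * real i \<le> S i"
  shows "inv_sq m k \<le> 1 / (lo\<^sup>2 * real m)"
proof -
  have "inv_sq m k \<le> (\<Sum>i\<in>{m<..k}. 1 / lo\<^sup>2 * (1 / (real i)\<^sup>2))"
    unfolding inv_sq_def
  proof (rule sum_mono)
    fix i assume i: "i \<in> {m<..k}"
    have "lo * real i \<le> S i" "0 < lo * real i" using assms(3) assms(4)[of i] i by auto
    moreover from this have "0 < S i" by linarith
    ultimately have "0 < (S i)\<^sup>2 * (lo * real i)\<^sup>2" "lo * real i \<le> S i" "0 \<le> lo * real i"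
      by (simp_all only: mult_pos_pos zero_less_power less_imp_le)
    hence "1 / (S i)\<^sup>2 \<le> 1 / (lo * real i)\<^sup>2" by (intro divide_left_mono power_mono) auto
    thus "1 / (S i)\<^sup>2 \<le> 1 / lo\<^sup>2 * (1 / (real i)\<^sup>2)" by (simp add: power_mult_distrib)
  qed
  also have "\<dots> = 1 / lo\<^sup>2 * (\<Sum>i\<in>{m<..k}. 1 / (real i)\<^sup>2)" by (simp only: sum_distrib_left)
  also have "\<dots> \<le> 1 / lo\<^sup>2 * (1 / real m)"
    using sum_inverse_squares_le[OF assms(1,2)] assms(3)
    by (intro mult_left_mono order_trans[OF sum_inverse_squares_le[OF assms(1,2)]]) auto
  finally show ?thesis by simp
qed

lemma hp_ge_ln:
  assumes "1 \<le> m" "m \<le> k" "k \<le> n" and "0 < lo" "lo \<le> hi"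
    and "\<And>i. m \<le> i \<Longrightarrow> i \<le> k \<Longrightarrow> lo * real i \<le> S i \<and> S i \<le> hi * real i"
  shows "(1 + 1 / hi) / 2 * ln (real k / real m) - (ln (hi / lo) + ln 2 / hi + 2 / lo\<^sup>2) / 2 \<le> hp x m k"
proof -
  have "1 / hi * (ln (real k / real m) - ln 2) \<le> 1 / hi * (\<Sum>i\<in>{m<..k}. 1 / real i)"
    using sum_inverse_bounds(2)[OF assms(1,2)] assms(4,5) by (intro mult_left_mono) auto
  also have "\<dots> = (\<Sum>i\<in>{m<..k}. 1 / hi * (1 / real i))" by (simp only: sum_distrib_left)
  also have "\<dots> \<le> (\<Sum>i\<in>{m<..k}. 1 / S i)"
  proof (rule sum_mono)
    fix i assume i: "i \<in> {m<..k}"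
    have "0 < lo * real i" "lo * real i \<le> S i" "S i \<le> hi * real i" using assms(4) assms(6)[of i] i by auto
    moreover have "0 < hi" "0 < real i" using assms(4,5) i by auto
    ultimately have "1 / (hi * real i) \<le> 1 / S i" by (intro divide_left_mono mult_pos_pos) auto
    thus "1 / hi * (1 / real i) \<le> 1 / S i" by simp
  qed
  finally have 1: "1 / hi * (ln (real k / real m) - ln 2) \<le> (\<Sum>i\<in>{m<..k}. 1 / S i)" .
  have S: "0 < S k" "0 < S m" using S_ge_1[of k] S_ge_1[of m] assms by auto
  have "ln (lo * real k) \<le> ln (S k)" using assms(6)[of k] S assms(1-5) by simp
  moreover have "ln (S m) \<le> ln (hi * real m)" using assms(6)[of m] S assms(1-5) by simp
  ultimately have 2: "ln (real k / real m) - ln (hi / lo) \<le> ln (S k) - ln (S m)"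
    using assms by (simp add: ln_mult ln_div)
  have "inv_sq m k \<le> 1 / (lo\<^sup>2 * real m)" using assms by (intro inv_sq_le) auto
  also have "\<dots> \<le> 1 / lo\<^sup>2" using assms by (intro divide_left_mono) auto
  finally have "2 * inv_sq m k \<le> 2 / lo\<^sup>2" by simp
  thus ?thesis using hp_bounds(2)[OF assms(2,3)] 1 2 by (simp add: algebra_simps add_divide_distrib)
qed

end

section \<open>Asymptotics of the walk\<close>

text \<open>An integer walk with unit steps started at 1 cannot leave the positive integers without
  visiting 0.\<close>

lemma freezing_walkI:
  assumes "\<forall>i\<ge>1. x i \<in> {-1, 1}" "tau x > enat n"
  shows "freezing_walk x n"
proof
  fix i :: nat assume "1 \<le> i" "i \<le> n"
  thus "x i = 1 \<or> x i = -1" using assms(1) by auto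
next
  have nz: "walk x k \<noteq> 0" if "1 \<le> k" "k \<le> n" for k
  proof
    assume "walk x k = 0"
    hence "tau x \<le> enat k" unfolding tau_def using that by (intro Inf_lower) auto
    also have "\<dots> \<le> enat n" using that by simp
    finally show False using assms(2) by simp
  qed
  fix i assume "i \<le> n"
  thus "1 \<le> walk x i"
  proof (induction i)
    case (Suc i)
    have "walk x (Suc i) = walk x i + x (Suc i)" by (simp add: walk_def)
    moreover have "x (Suc i) = -1 \<or> x (Suc i) = 1" using assms(1) by auto
    ultimately show ?case using Suc nz[of "Suc i"] by auto
  qed (simp add: walk_def)
qed

lemma hp_0_eq: "hp x 0 n = h_plus x n"
  unfolding hp_def h_plus_def by (intro sum.cong) (auto simp: indicator_def)

locale freezing_asymptotics =
  fixes x :: "nat \<Rightarrow> nat \<Rightarrow> int" and c :: real and A :: "nat \<Rightarrow> real"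
  assumes x_values: "\<forall>n\<ge>1. \<forall>i\<ge>1. x n i \<in> {-1, 1}"
    and tau_gt: "\<forall>n\<ge>1. tau (x n) > enat n"
    and c_pos: "0 < c" and c_le: "c \<le> 1"
    and A_pos: "\<forall>n\<ge>1. A n > 0"
    and A_lim: "filterlim A at_top sequentially"
    and A_small: "A \<in> o(\<lambda>n. ln (real n))"
    and S_near: "((\<lambda>\<epsilon>::real. limsup (\<lambda>n. ereal (Max
        ((\<lambda>i. \<bar>real_of_int (walk (x n) i) / real i - c\<bar>)
          ` {i. A n \<le> real i \<and> real i \<le> \<epsilon> * real n})))) \<longlongrightarrow> 0) (at_right 0)"
    and S_bulk: "\<forall>\<epsilon>\<in>{0<..<1::real}. liminf (\<lambda>n. ereal (Min
        ((\<lambda>i. real_of_int (walk (x n) i) / real n)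
          ` {i. \<epsilon> * real n \<le> real i \<and> i \<le> n}))) > 0"
begin

definition W :: "nat \<Rightarrow> nat \<Rightarrow> real" where "W n i = real_of_int (walk (x n) i)"

definition l :: real where "l = (c + 1) / (2 * c)"

text \<open>The first time from which the hypotheses control the walk; it tends to infinity and is
  still \<open>o(ln n)\<close>.\<close>

definition m :: "nat \<Rightarrow> nat" where "m n = nat \<lceil>A n\<rceil>"

abbreviation L :: "nat \<Rightarrow> real" where "L n \<equiv> ln (real n)"

lemma walk_ok: "1 \<le> n \<Longrightarrow> freezing_walk (x n) n"
  using x_values tau_gt by (intro freezing_walkI) auto

lemma ev_ge: "eventually (\<lambda>n. N \<le> n) sequentially"
  by (rule eventually_ge_at_top)

lemma L_at_top: "filterlim L at_top sequentially"
  by (intro filterlim_compose[OF ln_at_top] filterlim_real_sequentially)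

lemma l_pos: "l > 0"
  using c_pos by (simp add: l_def)

lemma m_ge_A: "A n \<le> real (m n)"
  unfolding m_def by linarith

lemma m_le_A: "1 \<le> n \<Longrightarrow> real (m n) \<le> A n + 1"
  using A_pos unfolding m_def by (smt (verit) ceiling_correct of_nat_nat ceiling_less_zero)

lemma m_ge_1: "1 \<le> n \<Longrightarrow> 1 \<le> m n"
proof -
  assume "1 \<le> n"
  hence "real (m n) > 0" using A_pos m_ge_A[of n] by (meson less_le_trans)
  thus ?thesis by simp
qed

lemma m_at_top: "filterlim (\<lambda>n. real (m n)) at_top sequentially"
  by (rule filterlim_at_top_mono[OF A_lim]) (simp add: m_ge_A)

lemma m_small: "(\<lambda>n. real (m n) / L n) \<longlonglongrightarrow> 0"
proof (rule tendsto_sandwich[where f = "\<lambda>_. 0" and h = "\<lambda>n. A n / L n + 1 / L n"])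
  show "(\<lambda>n. A n / L n + 1 / L n) \<longlonglongrightarrow> 0"
    using tendsto_add[OF smalloD_tendsto[OF A_small] tendsto_divide_0[OF tendsto_const[of 1] filterlim_at_top_imp_at_infinity[OF L_at_top]]]
    by simp
  show "eventually (\<lambda>n. 0 \<le> real (m n) / L n) sequentially"
    using ev_ge[of 1] by eventually_elim auto
  show "eventually (\<lambda>n. real (m n) / L n \<le> A n / L n + 1 / L n) sequentially"
    using ev_ge[of 2]
  proof eventually_elim
    case (elim n)
    have "L n > 0" using elim by simp
    thus ?case using m_le_A[of n] elim by (simp add: add_divide_distrib[symmetric] divide_right_mono)
  qed
qed auto

lemma m_le_eps:
  assumes "0 < \<epsilon>"
  shows "eventually (\<lambda>n. real (m n) \<le> \<epsilon> * L n) sequentially"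
  using order_tendstoD(2)[OF m_small assms] ev_ge[of 2]
proof eventually_elim
  case (elim n)
  have "L n > 0" using elim by simp
  thus ?case using elim by (simp add: divide_less_eq)
qed

lemma m_le_eps_n:
  assumes "0 < \<epsilon>"
  shows "eventually (\<lambda>n. real (m n) \<le> \<epsilon> * real n) sequentially"
  using m_le_eps[OF assms] ev_ge[of 2]
proof eventually_elim
  case (elim n)
  have "L n \<le> real n" using elim ln_bound[of "real n"] by simp
  hence "\<epsilon> * L n \<le> \<epsilon> * real n" using assms by simp
  thus ?case using elim by linarith
qed

text \<open>Fixes one \<open>\<epsilon>\<close> for a given accuracy \<open>\<delta>\<close> and
  turns both asymptotic hypotheses into pointwise bounds: \<open>S i\<close> is close to
  \<open>c i\<close> on the initial window and of order at least \<open>n\<close> beyond it.\<close>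

lemma S_near_bulk:
  assumes "0 < \<delta>"
  obtains \<epsilon> \<eta> where "0 < \<epsilon>" "\<epsilon> < 1" "0 < \<eta>"
    "eventually (\<lambda>n. (\<forall>i. A n \<le> real i \<and> real i \<le> \<epsilon> * real n \<longrightarrow> \<bar>W n i / real i - c\<bar> < \<delta>)
       \<and> (\<forall>i. \<epsilon> * real n \<le> real i \<and> i \<le> n \<longrightarrow> \<eta> * real n \<le> W n i)) sequentially"
proof -
  have "eventually (\<lambda>\<epsilon>::real. limsup (\<lambda>n. ereal (Max
        ((\<lambda>i. \<bar>real_of_int (walk (x n) i) / real i - c\<bar>)
          ` {i. A n \<le> real i \<and> real i \<le> \<epsilon> * real n}))) < ereal \<delta>) (at_right 0)"
    using order_tendstoD(2)[OF S_near, of "ereal \<delta>"] assms by simp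
  moreover have "eventually (\<lambda>\<epsilon>::real. \<epsilon> \<in> {0<..<1}) (at_right 0)"
    by (intro eventually_at_right_real) auto
  ultimately have "eventually (\<lambda>\<epsilon>::real. \<epsilon> \<in> {0<..<1} \<and> limsup (\<lambda>n. ereal (Max
        ((\<lambda>i. \<bar>real_of_int (walk (x n) i) / real i - c\<bar>)
          ` {i. A n \<le> real i \<and> real i \<le> \<epsilon> * real n}))) < ereal \<delta>) (at_right 0)"
    by eventually_elim auto
  from eventually_happens'[OF trivial_limit_at_right_real this]
  obtain \<epsilon> where \<epsilon>: "0 < \<epsilon>" "\<epsilon> < 1" and ls: "limsup (\<lambda>n. ereal (Max
        ((\<lambda>i. \<bar>real_of_int (walk (x n) i) / real i - c\<bar>)
          ` {i. A n \<le> real i \<and> real i \<le> \<epsilon> * real n}))) < ereal \<delta>" by auto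
  have "liminf (\<lambda>n. ereal (Min ((\<lambda>i. real_of_int (walk (x n) i) / real n)
          ` {i. \<epsilon> * real n \<le> real i \<and> i \<le> n}))) > 0" using S_bulk \<epsilon> by auto
  from ereal_dense2[OF this] obtain \<eta> where \<eta>: "0 < ereal \<eta>"
    "ereal \<eta> < liminf (\<lambda>n. ereal (Min ((\<lambda>i. real_of_int (walk (x n) i) / real n)
          ` {i. \<epsilon> * real n \<le> real i \<and> i \<le> n})))" by auto
  have "eventually (\<lambda>n. (\<forall>i. A n \<le> real i \<and> real i \<le> \<epsilon> * real n \<longrightarrow> \<bar>W n i / real i - c\<bar> < \<delta>)
       \<and> (\<forall>i. \<epsilon> * real n \<le> real i \<and> i \<le> n \<longrightarrow> \<eta> * real n \<le> W n i)) sequentially"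
    using Limsup_lessD[OF ls] less_LiminfD[OF \<eta>(2)] ev_ge[of 1]
  proof eventually_elim
    case (elim n)
    have n: "real n > 0" using elim by simp
    let ?I = "{i. A n \<le> real i \<and> real i \<le> \<epsilon> * real n}" and ?J = "{i. \<epsilon> * real n \<le> real i \<and> i \<le> n}"
    have "?I \<subseteq> {..nat \<lfloor>\<epsilon> * real n\<rfloor>}" by (auto simp: le_nat_floor)
    hence finI: "finite ?I" by (rule finite_subset) simp
    have finJ: "finite ?J" by (rule finite_subset[of _ "{..n}"]) auto
    show ?case
    proof (intro conjI allI impI)
      fix i assume "A n \<le> real i \<and> real i \<le> \<epsilon> * real n"
      \<comment> \<open>The index lies in the set over which the maximum is taken, so the
        unspecified value of \<open>Max {}\<close> never enters.\<close>
      hence "\<bar>W n i / real i - c\<bar> \<le> Max ((\<lambda>i. \<bar>real_of_int (walk (x n) i) / real i - c\<bar>) ` ?I)"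
        unfolding W_def using finI by (intro Max_ge) auto
      thus "\<bar>W n i / real i - c\<bar> < \<delta>" using elim by simp
    next
      fix i assume "\<epsilon> * real n \<le> real i \<and> i \<le> n"
      hence "Min ((\<lambda>i. real_of_int (walk (x n) i) / real n) ` ?J) \<le> W n i / real n"
        unfolding W_def using finJ by (intro Min_le) auto
      hence "\<eta> \<le> W n i / real n" using elim by simp
      thus "\<eta> * real n \<le> W n i" using n by (simp add: le_divide_eq)
    qed
  qed
  thus ?thesis using \<epsilon> \<eta>(1) by (intro that[of \<epsilon> \<eta>]) auto
qed

text \<open>On the window \<open>S i\<close> is at least \<open>(c / 2) i\<close>; beyond it
  \<open>S i \<ge> \<eta> n \<ge> \<eta> i\<close>. The smaller of the two slopes works
  throughout.\<close>

lemma S_linear: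
  obtains \<gamma> where "0 < \<gamma>"
    "eventually (\<lambda>n. \<forall>i. A n \<le> real i \<and> i \<le> n \<longrightarrow> \<gamma> * real i \<le> W n i) sequentially"
proof -
  obtain \<epsilon> \<eta> where *: "0 < \<epsilon>" "\<epsilon> < 1" "0 < \<eta>"
    "eventually (\<lambda>n. (\<forall>i. A n \<le> real i \<and> real i \<le> \<epsilon> * real n \<longrightarrow> \<bar>W n i / real i - c\<bar> < c / 2)
       \<and> (\<forall>i. \<epsilon> * real n \<le> real i \<and> i \<le> n \<longrightarrow> \<eta> * real n \<le> W n i)) sequentially"
    using S_near_bulk[of "c / 2"] c_pos by auto
  have "eventually (\<lambda>n. \<forall>i. A n \<le> real i \<and> i \<le> n \<longrightarrow> min (c / 2) \<eta> * real i \<le> W n i) sequentially"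
    using *(4) ev_ge[of 1]
  proof eventually_elim
    case (elim n)
    show ?case
    proof (intro allI impI)
      fix i assume i: "A n \<le> real i \<and> i \<le> n"
      have i0: "real i > 0" using A_pos elim i by (meson less_le_trans)
      show "min (c / 2) \<eta> * real i \<le> W n i"
      proof (cases "real i \<le> \<epsilon> * real n")
        case True
        hence "\<bar>W n i / real i - c\<bar> < c / 2" using elim i by blast
        hence "c / 2 \<le> W n i / real i" by (auto simp: abs_if split: if_splits)
        hence "c / 2 * real i \<le> W n i" using i0 by (simp add: le_divide_eq)
        moreover have "min (c / 2) \<eta> * real i \<le> c / 2 * real i" by (intro mult_right_mono) auto
        ultimately show ?thesis by linarith
      next
        case False
        hence "\<eta> * real n \<le> W n i" using elim i by auto
        moreover have "min (c / 2) \<eta> * real i \<le> \<eta> * real n" using i * by (intro mult_mono) auto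
        ultimately show ?thesis by linarith
      qed
    qed
  qed
  thus ?thesis using * c_pos by (intro that[of "min (c / 2) \<eta>"]) auto
qed

text \<open>\<open>\<delta>\<close> is chosen so small that the coefficients
  \<open>(1 + 1 / (c - \<delta>)) / 2\<close> and \<open>(1 + 1 / (c + \<delta>)) / 2\<close> lie
  within \<open>e\<close> of their common limit \<open>l\<close>.\<close>

lemma hp_near:
  assumes "0 < e"
  obtains \<epsilon> \<eta> C where "0 < \<epsilon>" "\<epsilon> < 1" "0 < \<eta>"
    "eventually (\<lambda>n. (\<forall>k. m n \<le> k \<and> real k \<le> \<epsilon> * real n \<longrightarrow>
          hp (x n) (m n) k \<le> (l + e) * ln (real k / real (m n)) + C
          \<and> (l - e) * ln (real k / real (m n)) - C \<le> hp (x n) (m n) k)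
       \<and> (\<forall>i. \<epsilon> * real n \<le> real i \<and> i \<le> n \<longrightarrow> \<eta> * real n \<le> W n i)) sequentially"
proof -
  have "((\<lambda>\<delta>. (1 + 1 / (c - \<delta>)) / 2) \<longlongrightarrow> (1 + 1 / (c - 0)) / 2) (at_right 0)"
    "((\<lambda>\<delta>. (1 + 1 / (c + \<delta>)) / 2) \<longlongrightarrow> (1 + 1 / (c + 0)) / 2) (at_right 0)"
    by (intro tendsto_intros; use c_pos in simp)+
  moreover have "(1 + 1 / c) / 2 = l" using c_pos by (simp add: l_def field_simps)
  ultimately have lim: "((\<lambda>\<delta>. (1 + 1 / (c - \<delta>)) / 2) \<longlongrightarrow> l) (at_right 0)"
    "((\<lambda>\<delta>. (1 + 1 / (c + \<delta>)) / 2) \<longlongrightarrow> l) (at_right 0)" by simp_all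
  have "eventually (\<lambda>\<delta>. \<delta> \<in> {0<..<c}) (at_right 0)"
    using c_pos by (intro eventually_at_right_real) auto
  hence "eventually (\<lambda>\<delta>. (1 + 1 / (c - \<delta>)) / 2 < l + e \<and> l - e < (1 + 1 / (c + \<delta>)) / 2 \<and> \<delta> \<in> {0<..<c}) (at_right 0)"
    using order_tendstoD(2)[OF lim(1), of "l + e"] order_tendstoD(1)[OF lim(2), of "l - e"] assms
    by (simp add: eventually_conj)
  from eventually_happens'[OF trivial_limit_at_right_real this]
  obtain \<delta> where \<delta>: "(1 + 1 / (c - \<delta>)) / 2 < l + e" "l - e < (1 + 1 / (c + \<delta>)) / 2" "0 < \<delta>" "\<delta> < c" by auto
  obtain \<epsilon> \<eta> where *: "0 < \<epsilon>" "\<epsilon> < 1" "0 < \<eta>"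
    "eventually (\<lambda>n. (\<forall>i. A n \<le> real i \<and> real i \<le> \<epsilon> * real n \<longrightarrow> \<bar>W n i / real i - c\<bar> < \<delta>)
       \<and> (\<forall>i. \<epsilon> * real n \<le> real i \<and> i \<le> n \<longrightarrow> \<eta> * real n \<le> W n i)) sequentially"
    using S_near_bulk[of \<delta>] \<delta> by auto
  let ?lo = "c - \<delta>" and ?hi = "c + \<delta>"
  define C where "C = \<bar>ln (?hi / ?lo) / 2\<bar> + \<bar>(ln (?hi / ?lo) + ln 2 / ?hi + 2 / ?lo\<^sup>2) / 2\<bar>"
  have "eventually (\<lambda>n. (\<forall>k. m n \<le> k \<and> real k \<le> \<epsilon> * real n \<longrightarrow>
          hp (x n) (m n) k \<le> (l + e) * ln (real k / real (m n)) + C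
          \<and> (l - e) * ln (real k / real (m n)) - C \<le> hp (x n) (m n) k)
       \<and> (\<forall>i. \<epsilon> * real n \<le> real i \<and> i \<le> n \<longrightarrow> \<eta> * real n \<le> W n i)) sequentially"
    using *(4) ev_ge[of 1]
  proof eventually_elim
    case (elim n)
    interpret freezing_walk "x n" n by (rule walk_ok) (use elim in simp)
    have m1: "1 \<le> m n" using m_ge_1 elim by simp
    have "hp (x n) (m n) k \<le> (l + e) * ln (real k / real (m n)) + C
          \<and> (l - e) * ln (real k / real (m n)) - C \<le> hp (x n) (m n) k"
      if k: "m n \<le> k" "real k \<le> \<epsilon> * real n" for k
    proof -
      have "\<epsilon> * real n \<le> 1 * real n" using * by (intro mult_right_mono) auto
      hence kn: "k \<le> n" using k by linarith
      have bd: "?lo * real i \<le> S i \<and> S i \<le> ?hi * real i" if i: "m n \<le> i" "i \<le> k" for i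
      proof -
        have i0: "real i > 0" using i m1 by linarith
        have "real (m n) \<le> real i" using i by simp
        hence "A n \<le> real i \<and> real i \<le> \<epsilon> * real n" using m_ge_A[of n] i k by (auto intro: order_trans)
        hence "\<bar>W n i / real i - c\<bar> < \<delta>" using elim by blast
        hence "c - \<delta> \<le> W n i / real i" "W n i / real i \<le> c + \<delta>" by linarith+
        thus ?thesis using i0 unfolding S_def W_def by (simp add: le_divide_eq divide_le_eq)
      qed
      have ln0: "0 \<le> ln (real k / real (m n))" using k m1 by simp
      have u: "(1 + 1 / ?lo) / 2 * ln (real k / real (m n)) \<le> (l + e) * ln (real k / real (m n))"
        "(l - e) * ln (real k / real (m n)) \<le> (1 + 1 / ?hi) / 2 * ln (real k / real (m n))"
        using \<delta> ln0 by (intro mult_right_mono; simp)+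
      have lh: "0 < ?lo" "?lo \<le> ?hi" using \<delta> by auto
      have "hp (x n) (m n) k \<le> (1 + 1 / ?lo) / 2 * ln (real k / real (m n)) + ln (?hi / ?lo) / 2"
        by (rule hp_le_ln[OF m1 k(1) kn lh bd])
      moreover have "(1 + 1 / ?hi) / 2 * ln (real k / real (m n)) - (ln (?hi / ?lo) + ln 2 / ?hi + 2 / ?lo\<^sup>2) / 2
         \<le> hp (x n) (m n) k"
        by (rule hp_ge_ln[OF m1 k(1) kn lh bd])
      moreover have "ln (?hi / ?lo) / 2 \<le> C" "(ln (?hi / ?lo) + ln 2 / ?hi + 2 / ?lo\<^sup>2) / 2 \<le> C"
        unfolding C_def by linarith+
      ultimately show ?thesis using u by linarith
    qed
    thus ?case using elim by blast
  qed
  thus ?thesis using * by (intro that[of \<epsilon> \<eta> C]) auto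
qed

lemma floor_eps:
  assumes "0 < \<epsilon>" "\<epsilon> < 1"
  shows "eventually (\<lambda>n. m n \<le> nat \<lfloor>\<epsilon> * real n\<rfloor> \<and> nat \<lfloor>\<epsilon> * real n\<rfloor> \<le> n \<and>
    real (nat \<lfloor>\<epsilon> * real n\<rfloor>) \<le> \<epsilon> * real n \<and> \<epsilon> / 2 * real n \<le> real (nat \<lfloor>\<epsilon> * real n\<rfloor>)
    \<and> (\<forall>i>nat \<lfloor>\<epsilon> * real n\<rfloor>. \<epsilon> * real n \<le> real i)) sequentially"
proof -
  have "eventually (\<lambda>n. 2 / \<epsilon> \<le> real n) sequentially"
    using filterlim_real_sequentially unfolding filterlim_at_top by blast
  thus ?thesis using m_le_eps_n[OF assms(1)] ev_ge[of 1]
  proof eventually_elim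
    case (elim n)
    have 2: "2 \<le> \<epsilon> * real n" using elim assms by (simp add: divide_le_eq mult.commute)
    have "\<epsilon> * real n \<le> 1 * real n" using assms by (intro mult_right_mono) auto
    hence kn: "nat \<lfloor>\<epsilon> * real n\<rfloor> \<le> n" by linarith
    have mk: "m n \<le> nat \<lfloor>\<epsilon> * real n\<rfloor>" using elim by (simp add: le_nat_floor)
    have lt: "\<epsilon> * real n \<le> real i" if "i > nat \<lfloor>\<epsilon> * real n\<rfloor>" for i
      using that 2 by linarith
    have r: "real (nat \<lfloor>\<epsilon> * real n\<rfloor>) = of_int \<lfloor>\<epsilon> * real n\<rfloor>" using 2 by simp
    have 3: "real (nat \<lfloor>\<epsilon> * real n\<rfloor>) \<le> \<epsilon> * real n" "\<epsilon> * real n < real (nat \<lfloor>\<epsilon> * real n\<rfloor>) + 1" unfolding r by linarith+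
    have "\<epsilon> / 2 * real n \<le> real (nat \<lfloor>\<epsilon> * real n\<rfloor>)" using 2 3(2) by linarith
    thus ?case using kn mk 3(1) lt by blast
  qed
qed

text \<open>The sum is cut at \<open>m n\<close> and at \<open>K\<close>, the floor of
  \<open>\<epsilon> n\<close>. The first piece is at most \<open>m n = o(ln n)\<close> because
  \<open>S i \<ge> 1\<close>; the last has at most \<open>n\<close> terms of size at most
  \<open>1 / (\<eta> n)\<close>; the middle one is governed by \<open>hp_near\<close>, where
  \<open>ln (K / m n)\<close> differs from \<open>ln n\<close> by at most a constant plus
  \<open>m n\<close>.\<close>

lemma hp_asymp: "(\<lambda>n. hp (x n) 0 n / L n) \<longlonglongrightarrow> l"
proof (rule tendstoI)
  fix e :: real assume e: "0 < e"
  \<comment> \<open>Smaller than \<open>l\<close>, so that inequalities may be multiplied by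
    \<open>l - e'\<close>, and a quarter of \<open>e\<close>, which leaves room for the vanishing
    terms.\<close>
  define e' where "e' = min (e / 4) (l / 2)"
  have e': "0 < e'" "e' \<le> e / 4" "e' < l" using e l_pos by (auto simp: e'_def)
  obtain \<epsilon> \<eta> C where *: "0 < \<epsilon>" "\<epsilon> < 1" "0 < \<eta>"
    "eventually (\<lambda>n. (\<forall>k. m n \<le> k \<and> real k \<le> \<epsilon> * real n \<longrightarrow>
          hp (x n) (m n) k \<le> (l + e') * ln (real k / real (m n)) + C
          \<and> (l - e') * ln (real k / real (m n)) - C \<le> hp (x n) (m n) k)
       \<and> (\<forall>i. \<epsilon> * real n \<le> real i \<and> i \<le> n \<longrightarrow> \<eta> * real n \<le> W n i)) sequentially"
    using hp_near[OF e'(1)] by blast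
  define B where "B = \<bar>C\<bar> + 1 / \<eta> + l * \<bar>ln (\<epsilon> / 2)\<bar>"
  have "(\<lambda>n. (1 + l) * (real (m n) / L n) + B / L n) \<longlonglongrightarrow> (1 + l) * 0 + 0"
    by (intro tendsto_add tendsto_mult tendsto_const m_small
          tendsto_divide_0[OF tendsto_const filterlim_at_top_imp_at_infinity[OF L_at_top]])
  hence "eventually (\<lambda>n. (1 + l) * (real (m n) / L n) + B / L n < e / 2) sequentially"
    using e by (intro order_tendstoD(2)) auto
  thus "eventually (\<lambda>n. dist (hp (x n) 0 n / L n) l < e) sequentially"
    using *(4) floor_eps[OF *(1,2)] ev_ge[of 2]
  proof eventually_elim
    case (elim n)
    interpret freezing_walk "x n" n by (rule walk_ok) (use elim in simp)
    define K where "K = nat \<lfloor>\<epsilon> * real n\<rfloor>"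
    have K: "m n \<le> K" "K \<le> n" "real K \<le> \<epsilon> * real n" "\<epsilon> / 2 * real n \<le> real K"
      "\<And>i. K < i \<Longrightarrow> \<epsilon> * real n \<le> real i" using elim unfolding K_def by auto
    have m1: "1 \<le> m n" using m_ge_1 elim by simp
    have n: "real n > 0" "L n > 0" using elim by auto
    have split: "hp (x n) 0 n = hp (x n) 0 (m n) + hp (x n) (m n) K + hp (x n) K n"
      using hp_split[of 0 "m n" n] hp_split[of "m n" K n] K by simp
    have h1: "0 \<le> hp (x n) 0 (m n)" "hp (x n) 0 (m n) \<le> real (m n)"
      using hp_nonneg[of "m n" 0] hp_le_const[of "m n" 1 0] S_ge_1 K by auto
    have h3: "0 \<le> hp (x n) K n" "hp (x n) K n \<le> 1 / \<eta>"
    proof -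
      show "0 \<le> hp (x n) K n" by (rule hp_nonneg) simp
      have "hp (x n) K n \<le> real (n - K) / (\<eta> * real n)"
        using elim K n * by (intro hp_le_const) (auto simp: W_def S_def)
      also have "\<dots> \<le> real n / (\<eta> * real n)" using n * by (intro divide_right_mono) auto
      finally show "hp (x n) K n \<le> 1 / \<eta>" using n by simp
    qed
    define q where "q = ln (real K / real (m n))"
    have h2: "hp (x n) (m n) K \<le> (l + e') * q + C" "(l - e') * q - C \<le> hp (x n) (m n) K"
      using elim(2) K unfolding q_def by blast+
    have K0: "real K > 0" "real (m n) > 0" using m1 K by auto
    have q_le: "q \<le> L n"
    proof -
      have "q = ln (real K) - ln (real (m n))" using K0 by (simp add: q_def ln_div)
      moreover have "ln (real K) \<le> L n" using K0 K n by (subst ln_le_cancel_iff) auto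
      moreover have "0 \<le> ln (real (m n))" using m1 by simp
      ultimately show ?thesis by linarith
    qed
    have q_ge: "L n + ln (\<epsilon> / 2) - real (m n) \<le> q"
    proof -
      have "q = ln (real K) - ln (real (m n))" using K0 by (simp add: q_def ln_div)
      moreover have "ln (\<epsilon> / 2 * real n) \<le> ln (real K)" using K0 K n * by (subst ln_le_cancel_iff) auto
      moreover have "ln (\<epsilon> / 2 * real n) = ln (\<epsilon> / 2) + L n" using * n by (subst ln_mult) auto
      moreover have "ln (real (m n)) \<le> real (m n)" using ln_bound[of "real (m n)"] K0 by simp
      ultimately show ?thesis by linarith
    qed
    have "(l + e') * q \<le> (l + e') * L n" using q_le e' l_pos by (intro mult_left_mono) auto
    hence up: "hp (x n) 0 n \<le> (l + e') * L n + real (m n) + B"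
      using split h1 h2 h3 l_pos unfolding B_def by (smt (verit) mult_nonneg_nonneg)
    have "(l - e') * (L n + ln (\<epsilon> / 2) - real (m n)) \<le> (l - e') * q"
      using q_ge e' by (intro mult_left_mono) auto
    moreover have "(l - e') * (ln (\<epsilon> / 2) - real (m n)) \<ge> - (l * (\<bar>ln (\<epsilon> / 2)\<bar> + real (m n)))"
    proof -
      have "\<bar>(l - e') * (ln (\<epsilon> / 2) - real (m n))\<bar> \<le> l * (\<bar>ln (\<epsilon> / 2)\<bar> + real (m n))"
        unfolding abs_mult using e' by (intro mult_mono) auto
      thus ?thesis by linarith
    qed
    ultimately have lo: "(l - e') * L n - l * real (m n) - B \<le> hp (x n) 0 n"
      using split h1 h2 h3 *(3) unfolding B_def
      by (smt (verit) divide_nonneg_nonneg distrib_left add_diff_eq)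
    have d: "\<bar>hp (x n) 0 n - l * L n\<bar> \<le> e' * L n + (1 + l) * real (m n) + B"
    proof -
      have "real (m n) \<le> (1 + l) * real (m n)" "l * real (m n) \<le> (1 + l) * real (m n)"
        using l_pos by (simp_all add: algebra_simps)
      thus ?thesis using up lo by (simp add: algebra_simps abs_le_iff)
    qed
    have "\<bar>hp (x n) 0 n / L n - l\<bar> = \<bar>hp (x n) 0 n - l * L n\<bar> / L n"
    proof -
      have "hp (x n) 0 n / L n - l = (hp (x n) 0 n - l * L n) / L n" using n by (simp add: diff_divide_distrib)
      thus ?thesis using n by (simp add: abs_divide)
    qed
    also have "\<dots> \<le> (e' * L n + (1 + l) * real (m n) + B) / L n"
      using d n by (intro divide_right_mono) auto
    also have "\<dots> = e' + ((1 + l) * (real (m n) / L n) + B / L n)"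
      using n by (simp add: add_divide_distrib)
    also have "\<dots> < e" using elim(1) e' by linarith
    finally show ?case by (simp add: dist_real_def)
  qed
qed

end

section \<open>Uniform vertices\<close>

lemma powr_le_exp:
  fixes y p :: real
  assumes "0 \<le> y" "1 \<le> p"
  shows "y powr p \<le> p powr p * exp y"
proof -
  have "y / p \<le> exp (y / p)" using exp_ge_add_one_self[of "y / p"] by linarith
  hence "(y / p) powr p \<le> exp (y / p) powr p" using assms by (intro powr_mono2) auto
  also have "\<dots> = exp y" using assms by (simp add: powr_def)
  finally show ?thesis using assms by (simp add: powr_divide divide_le_eq mult.commute)
qed

lemma powr_add4_le:
  fixes a b c d p :: real
  assumes "0 \<le> a" "0 \<le> b" "0 \<le> c" "0 \<le> d" "1 \<le> p"
  shows "(a + b + c + d) powr p \<le> 4 powr p * (a powr p + b powr p + c powr p + d powr p)"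
proof -
  define M where "M = max (max a b) (max c d)"
  have "(a + b + c + d) powr p \<le> (4 * M) powr p"
    using assms by (intro powr_mono2) (auto simp: M_def)
  also have "\<dots> = 4 powr p * M powr p" using assms by (simp add: powr_mult M_def)
  also have "M powr p \<le> a powr p + b powr p + c powr p + d powr p"
    by (auto simp: M_def max_def)
  finally show ?thesis by simp
qed

text \<open>The quadratic error is what lets a small tilt \<open>\<theta>\<close> give a negative
  rate for low vertices.\<close>

lemma one_minus_exp_neg_ge:
  fixes t :: real
  assumes "0 \<le> t" shows "t * (1 - t) \<le> 1 - exp (- t)"
proof -
  have "exp (- t) = 1 / exp t" by (simp add: exp_minus inverse_eq_divide)
  also have "\<dots> \<le> 1 / (1 + t)" using assms exp_ge_add_one_self[of t] by (intro divide_left_mono) auto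
  also have "\<dots> \<le> 1 - t * (1 - t)"
  proof -
    have "(1 - t * (1 - t)) * (1 + t) = 1 + t ^ 3" by (simp add: algebra_simps power3_eq_cube)
    moreover have "0 \<le> t ^ 3" using assms by simp
    ultimately show ?thesis using assms by (simp add: divide_le_eq)
  qed
  finally show ?thesis by linarith
qed

lemma verts_law_expectation_1:
  fixes \<phi> :: "lab_tree \<Rightarrow> nat \<Rightarrow> real"
  shows "measure_pmf.expectation (tree_vertices_law x k) (\<lambda>(T, u, v). \<phi> T u)
    = measure_pmf.expectation (tree_law x k) (\<lambda>T. (\<Sum>u\<in>verts T. \<phi> T u) / real (card (verts T)))"
    "measure_pmf.expectation (tree_vertices_law x k) (\<lambda>(T, u, v). \<phi> T v)
    = measure_pmf.expectation (tree_law x k) (\<lambda>T. (\<Sum>u\<in>verts T. \<phi> T u) / real (card (verts T)))"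
proof -
  have c: "real (card (verts T)) > 0" if "T \<in> set_pmf (tree_law x k)" for T
    using wf_treeD(2,3)[OF wf_tree_law[OF that]] by (auto simp: card_gt_0_iff)
  show "measure_pmf.expectation (tree_vertices_law x k) (\<lambda>(T, u, v). \<phi> T u)
    = measure_pmf.expectation (tree_law x k) (\<lambda>T. (\<Sum>u\<in>verts T. \<phi> T u) / real (card (verts T)))"
    unfolding verts_law_expectation[of x k "\<lambda>T u v. \<phi> T u"]
  proof (rule expectation_cong)
    fix T assume T: "T \<in> set_pmf (tree_law x k)"
    have "(\<Sum>u\<in>verts T. \<Sum>v\<in>verts T. \<phi> T u) = real (card (verts T)) * (\<Sum>u\<in>verts T. \<phi> T u)"
      by (simp add: sum_distrib_left)
    thus "(\<Sum>u\<in>verts T. \<Sum>v\<in>verts T. \<phi> T u) / (real (card (verts T)))\<^sup>2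
      = (\<Sum>u\<in>verts T. \<phi> T u) / real (card (verts T))"
      using c[OF T] by (simp add: power2_eq_square)
  qed
  show "measure_pmf.expectation (tree_vertices_law x k) (\<lambda>(T, u, v). \<phi> T v)
    = measure_pmf.expectation (tree_law x k) (\<lambda>T. (\<Sum>u\<in>verts T. \<phi> T u) / real (card (verts T)))"
    unfolding verts_law_expectation[of x k "\<lambda>T u v. \<phi> T v"]
  proof (rule expectation_cong)
    fix T assume T: "T \<in> set_pmf (tree_law x k)"
    show "(\<Sum>u\<in>verts T. \<Sum>v\<in>verts T. \<phi> T v) / (real (card (verts T)))\<^sup>2
      = (\<Sum>u\<in>verts T. \<phi> T u) / real (card (verts T))"
      using c[OF T] by (simp add: power2_eq_square)
  qed
qed

section \<open>Exponential moments and coalescence of uniform vertices at time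
  \<open>n\<close>\<close>

context freezing_walk
begin

definition N :: real where "N = (S n + real n + 1) / 2"

lemma N_ge: "real n / 2 \<le> N" "0 < N"
  using S_ge_1[of n] by (auto simp: N_def)

text \<open>At \<open>z = 1\<close> all weights are 1, and the formula for weighted sums counts
  births.\<close>

lemma N_eq: "N = 1 + (\<Sum>i\<in>{1..n}. of_bool (x i = 1))"
proof -
  have "N = measure_pmf.expectation (tree_law x n) (\<lambda>T. \<Sum>v\<in>verts T. of_bool True * 1 ^ rdep 0 T v)"
    using card_verts by (subst expectation_const[of _ _ N]) (auto simp: N_def)
  also have "\<dots> = 1 + (\<Sum>i\<in>{1..n}. of_bool (x i = 1))"
    by (subst expectation_verts_sum) (auto simp: growth_def)
  finally show ?thesis .
qed

lemma vertex_sum_mean: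
  "measure_pmf.expectation (tree_vertices_law x n) (\<lambda>(T, u, v). \<phi> T u)
    = measure_pmf.expectation (tree_law x n) (\<lambda>T. \<Sum>u\<in>verts T. \<phi> T u) / N"
proof -
  have "measure_pmf.expectation (tree_vertices_law x n) (\<lambda>(T, u, v). \<phi> T u)
    = measure_pmf.expectation (tree_law x n) (\<lambda>T. (\<Sum>u\<in>verts T. \<phi> T u) / N)"
    unfolding verts_law_expectation_1
    by (intro expectation_cong) (simp only: card_verts[OF order_refl] N_def)
  thus ?thesis by simp
qed

lemma expectation_verts_sum_le:
  assumes "1 \<le> z"
  shows "measure_pmf.expectation (tree_law x n) (\<lambda>T. \<Sum>v\<in>verts T. z ^ rdep 0 T v)
    \<le> N * (z * exp ((z - 1) * hp x 0 n))"
proof -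
  let ?b = "z * exp ((z - 1) * hp x 0 n)"
  have "(z - 1) * hp x 0 n \<ge> 0" using assms hp_nonneg by simp
  hence b: "1 * 1 \<le> ?b" using assms by (intro mult_mono) auto
  have "measure_pmf.expectation (tree_law x n) (\<lambda>T. \<Sum>v\<in>verts T. z ^ rdep 0 T v)
    = 1 + (\<Sum>i\<in>{1..n}. of_bool (x i = 1) * z * growth x 0 (i - 1) z)"
    using expectation_verts_sum[of n "\<lambda>_. True" z] by simp
  also have "\<dots> \<le> ?b + (\<Sum>i\<in>{1..n}. of_bool (x i = 1) * ?b)"
  proof (intro add_mono sum_mono)
    fix i assume i: "i \<in> {1..n}"
    have "growth x 0 (i - 1) z \<le> exp ((z - 1) * hp x 0 (i - 1))"
      using i assms by (intro growth_le) auto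
    also have "\<dots> \<le> exp ((z - 1) * hp x 0 n)"
    proof -
      have "hp x 0 (i - 1) \<le> hp x 0 n" using hp_split[of 0 "i - 1" n] hp_nonneg[of n "i - 1"] i by auto
      thus ?thesis using assms by (simp add: mult_left_mono)
    qed
    finally have "z * growth x 0 (i - 1) z \<le> ?b" using assms by (intro mult_left_mono) auto
    thus "of_bool (x i = 1) * z * growth x 0 (i - 1) z \<le> of_bool (x i = 1) * ?b" by simp
  qed (use b in simp)
  also have "\<dots> = N * ?b" by (simp add: N_eq sum_distrib_left sum_distrib_right distrib_right)
  finally show ?thesis .
qed

lemma expectation_height_exp_le:
  assumes "1 \<le> z"
  shows "measure_pmf.expectation (tree_vertices_law x n) (\<lambda>(T, u, v). z ^ rdep 0 T u)
    \<le> z * exp ((z - 1) * hp x 0 n)"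
  unfolding vertex_sum_mean using expectation_verts_sum_le[OF assms] N_ge(2)
  by (simp add: divide_le_eq mult.commute)

text \<open>For \<open>z < 1\<close> vertices of small height dominate the weighted sum, so those
  born by time \<open>K\<close> are excluded; for the others the mean height at birth is at least
  that accumulated up to time \<open>K\<close>.\<close>

lemma expectation_height_exp_le_late:
  assumes "0 < z" "z \<le> 1" "K \<le> n"
  shows "measure_pmf.expectation (tree_vertices_law x n) (\<lambda>(T, u, v). of_bool (K < u) * z ^ rdep 0 T u)
    \<le> exp (- (1 - z) * hp x 0 K)"
proof -
  let ?b = "exp (- (1 - z) * hp x 0 K)"
  have "measure_pmf.expectation (tree_law x n) (\<lambda>T. \<Sum>v\<in>verts T. of_bool (K < v) * z ^ rdep 0 T v)
    = (\<Sum>i\<in>{1..n}. of_bool (x i = 1 \<and> K < i) * z * growth x 0 (i - 1) z)"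
    by (subst expectation_verts_sum) auto
  also have "\<dots> \<le> (\<Sum>i\<in>{1..n}. of_bool (x i = 1) * ?b)"
  proof (rule sum_mono)
    fix i assume i: "i \<in> {1..n}"
    show "of_bool (x i = 1 \<and> K < i) * z * growth x 0 (i - 1) z \<le> of_bool (x i = 1) * ?b"
    proof (cases "K < i")
      case True
      have "growth x 0 (i - 1) z \<le> exp ((z - 1) * hp x 0 (i - 1))"
        using i assms by (intro growth_le) auto
      also have "\<dots> \<le> ?b"
      proof -
        have "hp x 0 K \<le> hp x 0 (i - 1)"
          using hp_split[of 0 K "i - 1"] hp_nonneg[of "i - 1" K] i True by auto
        hence "(1 - z) * hp x 0 K \<le> (1 - z) * hp x 0 (i - 1)" using assms by (intro mult_left_mono) auto
        thus ?thesis by (simp add: algebra_simps)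
      qed
      finally have "z * growth x 0 (i - 1) z \<le> 1 * ?b" using assms growth_pos[of "i - 1" z 0] i
        by (intro mult_mono) (auto intro: less_imp_le)
      thus ?thesis by simp
    qed simp
  qed
  also have "\<dots> \<le> N * ?b" by (simp add: N_eq sum_distrib_right distrib_right)
  finally show ?thesis unfolding vertex_sum_mean using N_ge(2) by (simp add: divide_le_eq mult.commute)
qed

lemma prob_early_vertex:
  assumes "1 \<le> n"
  shows "measure_pmf.expectation (tree_vertices_law x n) (\<lambda>(T, u, v). of_bool (u \<le> K))
    \<le> 2 * (real K + 1) / real n"
proof -
  have "(\<Sum>u\<in>verts T. of_bool (u \<le> K)) \<le> real K + 1" if "T \<in> set_pmf (tree_law x n)" for T
  proof -
    have "(\<Sum>u\<in>verts T. of_bool (u \<le> K) :: real) = real (card (verts T \<inter> {u. u \<le> K}))"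
      using wf_treeD(3)[OF wf_tree_law[OF that]] by simp
    also have "card (verts T \<inter> {u. u \<le> K}) \<le> card {..K}" by (intro card_mono) auto
    finally show ?thesis by simp
  qed
  hence "measure_pmf.expectation (tree_law x n) (\<lambda>T. \<Sum>u\<in>verts T. of_bool (u \<le> K))
     \<le> measure_pmf.expectation (tree_law x n) (\<lambda>T. real K + 1)"
    by (intro expectation_mono finite_set_tree_law)
  hence "measure_pmf.expectation (tree_law x n) (\<lambda>T. \<Sum>u\<in>verts T. of_bool (u \<le> K)) / N \<le> (real K + 1) / (real n / 2)"
    using N_ge assms by (intro frac_le) auto
  thus ?thesis unfolding vertex_sum_mean by (simp add: mult.commute)
qed

text \<open>With \<open>b\<close> and \<open>d\<close> of order \<open>1 / m\<close>, the recursions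
  bound the expected number of pairs by \<open>5 n + 2 n\<^sup>2 (b + d)\<close> (written
  informally), where 5 collects 3 from the last recursion and 2 from \<open>m + 1 \<le> 2 n\<close>.
  Dividing by the squared number of vertices, at least \<open>(n / 2)\<^sup>2\<close>, leaves order
  \<open>1 / m\<close>.\<close>

lemma prob_same_ancestor:
  assumes m: "1 \<le> m" "m \<le> n" and \<gamma>: "0 < \<gamma>" "\<And>i. m \<le> i \<Longrightarrow> i \<le> n \<Longrightarrow> \<gamma> * real i \<le> S i"
  shows "measure_pmf.expectation (tree_vertices_law x n) (\<lambda>(T, u, v). of_bool (anc m T u = anc m T v))
    \<le> 4 * (5 + 4 / \<gamma> + 2 / \<gamma>\<^sup>2) / real m"
proof -
  define b where "b = 1 / (\<gamma> * real m) + 1 / (\<gamma>\<^sup>2 * real m)"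
  define d where "d = 1 / (\<gamma> * real m)"
  have n: "real n > 0" "real m > 0" using m by auto
  have bd: "0 \<le> b" "0 \<le> d" using \<gamma> n by (auto simp: b_def d_def)
  have Sm: "1 / S i \<le> d" if "m \<le> i" "i \<le> n" for i
  proof -
    have "\<gamma> * real m \<le> \<gamma> * real i" using that \<gamma> by (intro mult_left_mono) auto
    hence "\<gamma> * real m \<le> S i" "0 < S i" using \<gamma>(2)[OF that] S_ge_1[OF that(2)] by linarith+
    thus ?thesis unfolding d_def using \<gamma> n by (intro divide_left_mono mult_pos_pos) auto
  qed
  have sq: "inv_sq m k \<le> 1 / (\<gamma>\<^sup>2 * real m)" if "m \<le> k" "k \<le> n" for k
    using m \<gamma> that by (intro inv_sq_le) auto
  have 1: "measure_pmf.expectation (tree_law x k) (\<lambda>T. cnt m T (active T) (active T)) / (S k)\<^sup>2 \<le> b"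
    if "m \<le> k" "k \<le> n" for k
    using cnt_active_bound[OF that] Sm[of m] sq[OF that] m unfolding inv_sq_def b_def d_def by linarith
  have 2: "measure_pmf.expectation (tree_law x k) (\<lambda>T. cnt m T (active T) (verts T)) / S k
    \<le> 1 + real n * b + real n * d" if k: "m \<le> k" "k \<le> n" for k
  proof -
    have "(\<Sum>i\<in>{m<..k}. 1 / S i) \<le> (\<Sum>i\<in>{m<..k}. d)" using k by (intro sum_mono Sm) auto
    also have "\<dots> = real (k - m) * d" by simp
    also have "\<dots> \<le> real n * d" using k bd by (intro mult_right_mono) auto
    finally have "(\<Sum>i\<in>{m<..k}. 1 / S i) \<le> real n * d" .
    moreover have "real (k - m) * b \<le> real n * b" using k bd by (intro mult_right_mono) auto
    ultimately show ?thesis using cnt_mixed_bound[OF k 1] by linarith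
  qed
  define Y where "Y = measure_pmf.expectation (tree_law x n) (\<lambda>T. cnt m T (verts T) (verts T))"
  have "Y \<le> real m + 1 + real (n - m) * (2 * (1 + real n * b + real n * d) + 1)"
    unfolding Y_def by (rule cnt_verts_bound[OF m(2) order_refl 2])
  also have "\<dots> \<le> real m + 1 + real n * (2 * (1 + real n * b + real n * d) + 1)"
    using bd by (intro add_left_mono mult_right_mono) auto
  also have "\<dots> \<le> 5 * real n + 2 * (real n)\<^sup>2 * b + 2 * (real n)\<^sup>2 * d"
    using m by (simp add: algebra_simps power2_eq_square)
  finally have Y: "Y \<le> 5 * real n + 2 * (real n)\<^sup>2 * b + 2 * (real n)\<^sup>2 * d" .
  have Y0: "0 \<le> Y" unfolding Y_def by (intro integral_nonneg_AE) (auto simp: cnt_def intro!: sum_nonneg)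
  have "measure_pmf.expectation (tree_vertices_law x n) (\<lambda>(T, u, v). of_bool (anc m T u = anc m T v))
    = measure_pmf.expectation (tree_law x n) (\<lambda>T. cnt m T (verts T) (verts T) / N\<^sup>2)"
    unfolding verts_law_expectation cnt_def
    by (intro expectation_cong) (simp only: card_verts[OF order_refl] N_def)
  also have "\<dots> = Y / N\<^sup>2" by (simp add: Y_def)
  also have "\<dots> \<le> Y / (real n / 2)\<^sup>2"
    using Y0 N_ge n by (intro divide_left_mono power_mono mult_pos_pos) auto
  also have "\<dots> \<le> (5 * real n + 2 * (real n)\<^sup>2 * b + 2 * (real n)\<^sup>2 * d) / (real n / 2)\<^sup>2"
    using Y by (intro divide_right_mono) auto
  also have "\<dots> = 4 * (5 / real n + 2 * b + 2 * d)"
    using n by (simp add: field_simps power2_eq_square)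
  also have "\<dots> \<le> 4 * (5 / real m + 2 * b + 2 * d)"
    using m n by (intro mult_left_mono add_right_mono divide_left_mono) auto
  also have "\<dots> = 4 * (5 + 4 / \<gamma> + 2 / \<gamma>\<^sup>2) / real m"
    using n \<gamma> by (simp add: b_def d_def field_simps power2_eq_square)
  finally show ?thesis .
qed

end

section \<open>Convergence of typical height and distance in \<open>Lp\<close>\<close>

context freezing_asymptotics
begin

text \<open>The exponents met below are all of order \<open>ln n\<close>, so only the sign of the
  limiting rate matters.\<close>

lemma exp_tendsto_0:
  assumes "(\<lambda>n. g n / L n) \<longlonglongrightarrow> a" "a < 0"
  shows "(\<lambda>n. exp (g n)) \<longlonglongrightarrow> 0"
proof -
  have "filterlim (\<lambda>n. g n / L n * L n) at_bot sequentially"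
    by (rule filterlim_tendsto_neg_mult_at_bot[OF assms L_at_top])
  hence "(\<lambda>n. exp (g n / L n * L n)) \<longlonglongrightarrow> 0"
    by (rule filterlim_compose[OF exp_at_bot])
  moreover have "eventually (\<lambda>n. exp (g n / L n * L n) = exp (g n)) sequentially"
    using ev_ge[of 2] by eventually_elim auto
  ultimately show ?thesis using tendsto_cong by fast
qed

lemma const_div_L: "(\<lambda>n. a / L n) \<longlonglongrightarrow> 0"
  by (intro tendsto_divide_0[OF tendsto_const filterlim_at_top_imp_at_infinity[OF L_at_top]])

definition mom :: "real \<Rightarrow> nat \<Rightarrow> real" where
  "mom p n = measure_pmf.expectation (tree_vertices_law (x n) n)
     (\<lambda>(T, u, v). \<bar>real (rdep 0 T u) / L n - l\<bar> powr p)"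

text \<open>One term for each regime. Above \<open>l + e\<close>, the power is dominated by an
  exponential and then by the tilt \<open>exp \<theta> ^ H\<close>. Below \<open>l - e\<close>, the
  deviation is at most \<open>l\<close> because heights are nonnegative, and the indicator of this
  event is bounded by 1 for early vertices and by the tilt \<open>exp (- \<theta>) ^ H\<close> for
  late ones.\<close>

lemma deviation_pointwise:
  fixes H u K :: nat
  assumes e: "0 < e" and p: "1 \<le> p" and \<theta>: "1 \<le> \<theta> * lg" and lg: "0 < lg"
  shows "\<bar>real H / lg - l\<bar> powr p \<le> e powr p
    + l powr p * (of_bool (u \<le> K) + of_bool (K < u) * exp (\<theta> * ((l - e) * lg)) * exp (- \<theta>) ^ H)
    + p powr p * exp (e - \<theta> * e * lg - \<theta> * l * lg) * exp \<theta> ^ H"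
proof -
  let ?y = "real H / lg - l"
  have \<theta>0: "0 < \<theta>" using \<theta> lg by (smt (verit) zero_less_mult_pos2)
  have nn: "0 \<le> l powr p * (of_bool (u \<le> K) + of_bool (K < u) * exp (\<theta> * ((l - e) * lg)) * exp (- \<theta>) ^ H)"
    "0 \<le> p powr p * exp (e - \<theta> * e * lg - \<theta> * l * lg) * exp \<theta> ^ H" "0 \<le> e powr p" by simp_all
  consider "\<bar>?y\<bar> \<le> e" | "?y > e" | "?y < - e" by linarith
  thus ?thesis
  proof cases
    case 1
    hence "\<bar>?y\<bar> powr p \<le> e powr p" using p by (intro powr_mono2) auto
    thus ?thesis using nn by linarith
  next
    case 2
    \<comment> \<open>\<open>\<theta> * lg \<ge> 1\<close> and \<open>?y > e\<close> give
      \<open>(\<theta> * lg - 1) * (?y - e) \<ge> 0\<close>, so the factor \<open>exp ?y\<close>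
      from \<open>powr_le_exp\<close> is absorbed into the tilt.\<close>
    have "?y - \<theta> * lg * ?y = - ((\<theta> * lg - 1) * ?y)" by (simp add: algebra_simps)
    also have "\<dots> \<le> - ((\<theta> * lg - 1) * e)" using 2 \<theta> by (simp add: mult_left_mono)
    finally have "?y \<le> e - \<theta> * e * lg + \<theta> * lg * ?y" by (simp add: algebra_simps)
    also have "\<theta> * lg * ?y = real H * \<theta> - \<theta> * l * lg" using lg by (simp add: field_simps)
    finally have "exp ?y \<le> exp (e - \<theta> * e * lg - \<theta> * l * lg + real H * \<theta>)" by simp
    also have "\<dots> = exp (e - \<theta> * e * lg - \<theta> * l * lg) * exp \<theta> ^ H"
      by (simp add: exp_add exp_of_nat_mult)
    finally have "p powr p * exp ?y \<le> p powr p * (exp (e - \<theta> * e * lg - \<theta> * l * lg) * exp \<theta> ^ H)"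
      by (intro mult_left_mono) auto
    moreover have "\<bar>?y\<bar> powr p \<le> p powr p * exp ?y" using powr_le_exp[of ?y p] 2 e p by simp
    moreover have "p powr p * (exp (e - \<theta> * e * lg - \<theta> * l * lg) * exp \<theta> ^ H)
        = p powr p * exp (e - \<theta> * e * lg - \<theta> * l * lg) * exp \<theta> ^ H" by (simp only: mult.assoc)
    ultimately show ?thesis using nn by linarith
  next
    case 3
    have "real H / lg \<ge> 0" using lg by simp
    hence "\<bar>?y\<bar> \<le> l" using 3 e by linarith
    hence "\<bar>?y\<bar> powr p \<le> l powr p" using p by (intro powr_mono2) auto
    moreover have "1 \<le> of_bool (u \<le> K) + of_bool (K < u) * exp (\<theta> * ((l - e) * lg)) * exp (- \<theta>) ^ H"
    proof (cases "u \<le> K")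
      case False
      have "real H \<le> (l - e) * lg" using 3 lg by (simp add: field_simps)
      hence "\<theta> * real H \<le> \<theta> * ((l - e) * lg)" using \<theta>0 by (intro mult_left_mono) auto
      hence "1 \<le> exp (\<theta> * ((l - e) * lg) + real H * (- \<theta>))" by (simp add: mult.commute)
      also have "\<dots> = exp (\<theta> * ((l - e) * lg)) * exp (- \<theta>) ^ H" by (simp only: exp_add exp_of_nat_mult)
      finally show ?thesis using False by simp
    qed simp
    hence "l powr p * 1 \<le> l powr p * (of_bool (u \<le> K) + of_bool (K < u) * exp (\<theta> * ((l - e) * lg)) * exp (- \<theta>) ^ H)"
      by (intro mult_left_mono) auto
    ultimately show ?thesis using nn by linarith
  qed
qed

text \<open>Beyond time \<open>\<delta> n\<close> there are at most \<open>n\<close> terms, each at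
  most \<open>1 / (\<eta> n)\<close>. Thus stopping at a fixed fraction of \<open>n\<close> loses
  only a constant.\<close>

lemma hp_late:
  assumes "0 < \<delta>" "\<delta> < 1"
  obtains C where "eventually (\<lambda>n. hp (x n) 0 n - C \<le> hp (x n) 0 (nat \<lfloor>\<delta> * real n\<rfloor>)) sequentially"
proof -
  have "liminf (\<lambda>n. ereal (Min ((\<lambda>i. real_of_int (walk (x n) i) / real n)
          ` {i. \<delta> * real n \<le> real i \<and> i \<le> n}))) > 0" using S_bulk assms by auto
  from ereal_dense2[OF this] obtain \<eta> where \<eta>: "0 < ereal \<eta>"
    "ereal \<eta> < liminf (\<lambda>n. ereal (Min ((\<lambda>i. real_of_int (walk (x n) i) / real n)
          ` {i. \<delta> * real n \<le> real i \<and> i \<le> n})))" by auto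
  have "eventually (\<lambda>n. hp (x n) 0 n - 1 / \<eta> \<le> hp (x n) 0 (nat \<lfloor>\<delta> * real n\<rfloor>)) sequentially"
    using less_LiminfD[OF \<eta>(2)] floor_eps[OF assms] ev_ge[of 1]
  proof eventually_elim
    case (elim n)
    interpret freezing_walk "x n" n by (rule walk_ok) (use elim in simp)
    let ?K = "nat \<lfloor>\<delta> * real n\<rfloor>"
    have n: "real n > 0" using elim by simp
    have "\<eta> * real n \<le> S i" if i: "?K < i" "i \<le> n" for i
    proof -
      have "finite {i. \<delta> * real n \<le> real i \<and> i \<le> n}" by (rule finite_subset[of _ "{..n}"]) auto
      hence "Min ((\<lambda>i. real_of_int (walk (x n) i) / real n) ` {i. \<delta> * real n \<le> real i \<and> i \<le> n}) \<le> S i / real n"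
        unfolding S_def using i elim by (intro Min_le) auto
      hence "\<eta> \<le> S i / real n" using elim by simp
      thus ?thesis using n by (simp add: le_divide_eq)
    qed
    hence "hp (x n) ?K n \<le> real (n - ?K) / (\<eta> * real n)"
      using \<eta> n by (intro hp_le_const) auto
    also have "\<dots> \<le> real n / (\<eta> * real n)" using n \<eta> by (intro divide_right_mono) auto
    also have "\<dots> = 1 / \<eta>" using n by simp
    finally show ?case using hp_split[of 0 ?K n] elim by simp
  qed
  thus ?thesis by (rule that)
qed

lemma mom_le:
  assumes e: "0 < e" and p: "1 \<le> p" and \<theta>: "0 < \<theta>" "1 \<le> \<theta> * L n" and n: "2 \<le> n" and K: "K \<le> n"
  shows "mom p n \<le> e powr p
    + l powr p * (2 * (real K + 1) / real n
        + exp (\<theta> * ((l - e) * L n) - (1 - exp (- \<theta>)) * hp (x n) 0 K))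
    + p powr p * exp (e + \<theta> - \<theta> * e * L n - \<theta> * l * L n + (exp \<theta> - 1) * hp (x n) 0 n)"
proof -
  interpret freezing_walk "x n" n by (rule walk_ok) (use n in simp)
  let ?M = "tree_vertices_law (x n) n"
  have int: "integrable (measure_pmf ?M) f" for f :: "_ \<Rightarrow> real"
    by (intro integrable_measure_pmf_finite finite_set_verts_law)
  define a where "a = exp (\<theta> * ((l - e) * L n))"
  define b where "b = exp (e - \<theta> * e * L n - \<theta> * l * L n)"
  have "mom p n \<le> measure_pmf.expectation ?M (\<lambda>\<omega>. e powr p
    + l powr p * ((case \<omega> of (T, u, v) \<Rightarrow> of_bool (u \<le> K))
        + a * (case \<omega> of (T, u, v) \<Rightarrow> of_bool (K < u) * exp (- \<theta>) ^ rdep 0 T u))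
    + p powr p * b * (case \<omega> of (T, u, v) \<Rightarrow> exp \<theta> ^ rdep 0 T u))"
    unfolding mom_def
  proof (rule expectation_mono[OF finite_set_verts_law], clarify)
    fix T u v
    show "\<bar>real (rdep 0 T u) / L n - l\<bar> powr p \<le> e powr p
      + l powr p * (of_bool (u \<le> K) + a * (of_bool (K < u) * exp (- \<theta>) ^ rdep 0 T u))
      + p powr p * b * exp \<theta> ^ rdep 0 T u"
      using deviation_pointwise[OF e p \<theta>(2), of "rdep 0 T u" u K] n
      by (simp add: a_def b_def mult_ac)
  qed
  also have "\<dots> = e powr p
    + l powr p * (measure_pmf.expectation ?M (\<lambda>(T, u, v). of_bool (u \<le> K))
        + a * measure_pmf.expectation ?M (\<lambda>(T, u, v). of_bool (K < u) * exp (- \<theta>) ^ rdep 0 T u))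
    + p powr p * b * measure_pmf.expectation ?M (\<lambda>(T, u, v). exp \<theta> ^ rdep 0 T u)"
    using int by simp
  also have "\<dots> \<le> e powr p
    + l powr p * (2 * (real K + 1) / real n + a * exp (- (1 - exp (- \<theta>)) * hp (x n) 0 K))
    + p powr p * b * (exp \<theta> * exp ((exp \<theta> - 1) * hp (x n) 0 n))"
    using \<theta> n K
    by (intro add_mono mult_left_mono order_refl prob_early_vertex expectation_height_exp_le
          expectation_height_exp_le_late) (auto simp: a_def b_def)
  also have "\<dots> = e powr p
    + l powr p * (2 * (real K + 1) / real n
        + exp (\<theta> * ((l - e) * L n) - (1 - exp (- \<theta>)) * hp (x n) 0 K))
    + p powr p * exp (e + \<theta> - \<theta> * e * L n - \<theta> * l * L n + (exp \<theta> - 1) * hp (x n) 0 n)"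
  proof -
    have "a * exp (- (1 - exp (- \<theta>)) * hp (x n) 0 K)
        = exp (\<theta> * ((l - e) * L n) - (1 - exp (- \<theta>)) * hp (x n) 0 K)"
      unfolding a_def exp_add[symmetric] by (rule arg_cong[where f = exp]) (simp add: algebra_simps)
    moreover have "b * (exp \<theta> * exp ((exp \<theta> - 1) * hp (x n) 0 n))
        = exp (e + \<theta> - \<theta> * e * L n - \<theta> * l * L n + (exp \<theta> - 1) * hp (x n) 0 n)"
      unfolding b_def exp_add[symmetric] by (rule arg_cong[where f = exp]) simp
    ultimately show ?thesis by (simp only: mult.assoc)
  qed
  finally show ?thesis .
qed

lemma mom_nonneg: "0 \<le> mom p n"
  unfolding mom_def by (intro integral_nonneg_AE) auto

lemma mom_tendsto:
  assumes p: "1 \<le> p"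
  shows "mom p \<longlonglongrightarrow> 0"
proof (rule tendstoI)
  fix r :: real assume r: "0 < r"
  \<comment> \<open>\<open>e powr p \<le> e\<close> for \<open>e \<le> 1\<close> bounds the central
    part by \<open>r / 5\<close>; \<open>\<delta>\<close> does the same for the share of vertices
    born by time \<open>\<delta> n\<close>; the vanishing terms get a third \<open>r / 5\<close>.
    The choice of \<open>\<theta>\<close> gives \<open>\<theta> l \<le> e / 2\<close>, so that both
    exponential rates are at most \<open>\<theta> (\<theta> l - e) < 0\<close>.\<close>
  define e where "e = min 1 (r / 5)"
  define \<delta> where "\<delta> = min (1/2) (r / (10 * (l powr p + 1)))"
  define \<theta> where "\<theta> = min 1 (e / (2 * l))"
  have lp: "0 \<le> l powr p" "0 \<le> p powr p" by simp_all
  have e: "0 < e" "e \<le> 1" "e \<le> r / 5" using r by (auto simp: e_def)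
  have ep: "e powr p \<le> r / 5" using powr_mono'[of 1 p e] e p by simp
  have \<theta>: "0 < \<theta>" "\<theta> \<le> 1" "\<theta> \<le> e / (2 * l)" using e l_pos by (auto simp: \<theta>_def)
  have \<theta>l: "\<theta> * l \<le> e / 2" using \<theta>(3) l_pos by (simp add: field_simps)
  have \<delta>: "0 < \<delta>" "\<delta> < 1" using r lp by (auto simp: \<delta>_def intro!: divide_pos_pos add_nonneg_pos)
  have \<delta>2: "l powr p * (2 * \<delta>) \<le> r / 5"
  proof -
    have "l powr p * (2 * \<delta>) \<le> (l powr p + 1) * (2 * (r / (10 * (l powr p + 1))))"
      using lp \<delta> by (intro mult_mono) (auto simp: \<delta>_def)
    also have "\<dots> = r / 5" using lp by (simp add: field_simps add_nonneg_eq_0_iff)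
    finally show ?thesis .
  qed
  obtain C where C: "eventually (\<lambda>n. hp (x n) 0 n - C \<le> hp (x n) 0 (nat \<lfloor>\<delta> * real n\<rfloor>)) sequentially"
    using hp_late[OF \<delta>] by blast
  define b where "b = 1 - exp (- \<theta>)"
  have b: "\<theta> * (1 - \<theta>) \<le> b" "0 \<le> b" using one_minus_exp_neg_ge[of \<theta>] \<theta> by (auto simp: b_def)
  define g1 where "g1 n = \<theta> * ((l - e) * L n) - b * hp (x n) 0 n + b * C" for n
  define g2 where "g2 n = e + \<theta> - \<theta> * e * L n - \<theta> * l * L n + (exp \<theta> - 1) * hp (x n) 0 n" for n
  have "(\<lambda>n. exp (g1 n)) \<longlonglongrightarrow> 0"
  proof (rule exp_tendsto_0)
    have "(\<lambda>n. \<theta> * (l - e) - b * (hp (x n) 0 n / L n) + b * C / L n) \<longlonglongrightarrow> \<theta> * (l - e) - b * l + 0"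
      by (intro tendsto_intros hp_asymp const_div_L)
    moreover have "eventually (\<lambda>n. \<theta> * (l - e) - b * (hp (x n) 0 n / L n) + b * C / L n = g1 n / L n) sequentially"
      using ev_ge[of 2] by eventually_elim (simp add: g1_def add_divide_distrib diff_divide_distrib)
    ultimately show "(\<lambda>n. g1 n / L n) \<longlonglongrightarrow> \<theta> * (l - e) - b * l"
      using tendsto_cong by fastforce
    have "\<theta> * (1 - \<theta>) * l \<le> b * l" using b l_pos by (intro mult_right_mono) auto
    hence "\<theta> * (l - e) - b * l \<le> \<theta> * (\<theta> * l - e)" by (simp add: algebra_simps)
    also have "\<dots> < 0" using \<theta>l \<theta> e by (intro mult_pos_neg) auto
    finally show "\<theta> * (l - e) - b * l < 0" .
  qed
  moreover have "(\<lambda>n. exp (g2 n)) \<longlonglongrightarrow> 0"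
  proof (rule exp_tendsto_0)
    have "(\<lambda>n. (e + \<theta>) / L n - \<theta> * e - \<theta> * l + (exp \<theta> - 1) * (hp (x n) 0 n / L n)) \<longlonglongrightarrow> 0 - \<theta> * e - \<theta> * l + (exp \<theta> - 1) * l"
      by (intro tendsto_intros hp_asymp const_div_L)
    moreover have "eventually (\<lambda>n. (e + \<theta>) / L n - \<theta> * e - \<theta> * l + (exp \<theta> - 1) * (hp (x n) 0 n / L n) = g2 n / L n) sequentially"
      using ev_ge[of 2] by eventually_elim (simp add: g2_def add_divide_distrib diff_divide_distrib)
    ultimately show "(\<lambda>n. g2 n / L n) \<longlonglongrightarrow> 0 - \<theta> * e - \<theta> * l + (exp \<theta> - 1) * l"
      using tendsto_cong by fastforce
    have "exp \<theta> - 1 \<le> \<theta> + \<theta>\<^sup>2" using exp_bound[of \<theta>] \<theta> by simp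
    hence "(exp \<theta> - 1) * l \<le> (\<theta> + \<theta>\<^sup>2) * l" using l_pos by (intro mult_right_mono) auto
    hence "0 - \<theta> * e - \<theta> * l + (exp \<theta> - 1) * l \<le> \<theta> * (\<theta> * l - e)" by (simp add: algebra_simps power2_eq_square)
    also have "\<dots> < 0" using \<theta>l \<theta> e by (intro mult_pos_neg) auto
    finally show "0 - \<theta> * e - \<theta> * l + (exp \<theta> - 1) * l < 0" .
  qed
  moreover have "(\<lambda>n. 2 / real n) \<longlonglongrightarrow> 0" by (rule lim_const_over_n)
  ultimately have "(\<lambda>n. l powr p * (2 / real n + exp (g1 n)) + p powr p * exp (g2 n)) \<longlonglongrightarrow> l powr p * (0 + 0) + p powr p * 0"
    by (intro tendsto_intros)
  hence "eventually (\<lambda>n. l powr p * (2 / real n + exp (g1 n)) + p powr p * exp (g2 n) < r / 5) sequentially"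
    using r by (intro order_tendstoD(2)) auto
  moreover have "eventually (\<lambda>n. 1 / \<theta> \<le> L n) sequentially"
    using L_at_top unfolding filterlim_at_top by blast
  ultimately show "eventually (\<lambda>n. dist (mom p n) 0 < r) sequentially"
    using C floor_eps[OF \<delta>] ev_ge[of 2]
  proof eventually_elim
    case (elim n)
    let ?K = "nat \<lfloor>\<delta> * real n\<rfloor>"
    have \<theta>L: "1 \<le> \<theta> * L n" using elim(2) \<theta> by (simp add: field_simps)
    have K: "?K \<le> n" "real ?K \<le> \<delta> * real n" using elim(4) by auto
    have n: "2 \<le> n" using elim by simp
    have "2 * (real ?K + 1) / real n \<le> 2 * (\<delta> * real n + 1) / real n"
      using K by (intro divide_right_mono) auto
    also have "\<dots> = 2 * \<delta> + 2 / real n" using n by (simp add: field_simps)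
    finally have k: "2 * (real ?K + 1) / real n \<le> 2 * \<delta> + 2 / real n" .
    have "b * (hp (x n) 0 n - C) \<le> b * hp (x n) 0 ?K" using elim(3) b by (intro mult_left_mono)
    hence g: "exp (\<theta> * ((l - e) * L n) - (1 - exp (- \<theta>)) * hp (x n) 0 ?K) \<le> exp (g1 n)"
      unfolding g1_def b_def[symmetric] by (simp add: algebra_simps)
    have "mom p n \<le> e powr p
      + l powr p * (2 * (real ?K + 1) / real n
        + exp (\<theta> * ((l - e) * L n) - (1 - exp (- \<theta>)) * hp (x n) 0 ?K))
      + p powr p * exp (g2 n)"
      unfolding g2_def by (rule mom_le[OF e(1) p \<theta>(1) \<theta>L n K(1)])
    also have "\<dots> \<le> e powr p + l powr p * ((2 * \<delta> + 2 / real n) + exp (g1 n)) + p powr p * exp (g2 n)"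
      using k g lp by (intro add_mono mult_left_mono order_refl) auto
    also have "\<dots> = e powr p + l powr p * (2 * \<delta>) + (l powr p * (2 / real n + exp (g1 n)) + p powr p * exp (g2 n))"
      by (simp only: algebra_simps)
    also have "\<dots> < r" using ep \<delta>2 elim(1) r by linarith
    finally show ?case using mom_nonneg[of p n] by simp
  qed
qed

lemma height_Lp:
  assumes "1 \<le> p"
  shows "tendsto_Lp p (\<lambda>n. tree_vertices_law (x n) n) (\<lambda>n (T, v1, v2). real (vheight T v1) / L n) l"
proof -
  have "measure_pmf.expectation (tree_vertices_law (x n) n)
      (\<lambda>\<omega>. \<bar>(case \<omega> of (T, v1, v2) \<Rightarrow> real (vheight T v1) / L n) - l\<bar> powr p) = mom p n" for n
    unfolding mom_def
  proof (rule expectation_cong, clarify)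
    fix T u v assume "(T, u, v) \<in> set_pmf (tree_vertices_law (x n) n)"
    from vheight_eq[OF set_verts_law(2,3)[OF this]]
    show "\<bar>real (vheight T u) / L n - l\<bar> powr p = \<bar>real (rdep 0 T u) / L n - l\<bar> powr p" by simp
  qed
  thus ?thesis using mom_tendsto[OF assms] unfolding tendsto_Lp_def
    by (auto intro!: integrable_measure_pmf_finite finite_set_verts_law)
qed

text \<open>The bound on the probability is a constant over \<open>m n\<close>, and
  \<open>m n\<close> tends to infinity because \<open>A\<close> does.\<close>

lemma same_ancestor_tendsto:
  "(\<lambda>n. measure_pmf.expectation (tree_vertices_law (x n) n)
      (\<lambda>(T, u, v). of_bool (anc (m n) T u = anc (m n) T v) :: real)) \<longlonglongrightarrow> 0"
proof -
  obtain \<gamma> where \<gamma>: "0 < \<gamma>"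
    "eventually (\<lambda>n. \<forall>i. A n \<le> real i \<and> i \<le> n \<longrightarrow> \<gamma> * real i \<le> W n i) sequentially"
    using S_linear by blast
  show ?thesis
  proof (rule tendsto_sandwich[where f = "\<lambda>_. 0" and h = "\<lambda>n. 4 * (5 + 4 / \<gamma> + 2 / \<gamma>\<^sup>2) / real (m n)"])
    show "eventually (\<lambda>n. measure_pmf.expectation (tree_vertices_law (x n) n)
      (\<lambda>(T, u, v). of_bool (anc (m n) T u = anc (m n) T v)) \<le> 4 * (5 + 4 / \<gamma> + 2 / \<gamma>\<^sup>2) / real (m n)) sequentially"
      using \<gamma>(2) m_le_eps_n[OF zero_less_one] ev_ge[of 1]
    proof eventually_elim
      case (elim n)
      interpret freezing_walk "x n" n by (rule walk_ok) (use elim in simp)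
      show ?case
      proof (rule prob_same_ancestor[OF _ _ \<gamma>(1)])
        fix i assume i: "m n \<le> i" "i \<le> n"
        hence "A n \<le> real i" using m_ge_A[of n] by (meson of_nat_le_iff order_trans)
        thus "\<gamma> * real i \<le> S i" using elim i by (simp add: W_def S_def)
      qed (use elim m_ge_1 in auto)
    qed
    show "(\<lambda>n. 4 * (5 + 4 / \<gamma> + 2 / \<gamma>\<^sup>2) / real (m n)) \<longlonglongrightarrow> 0"
      by (intro tendsto_divide_0[OF tendsto_const filterlim_at_top_imp_at_infinity[OF m_at_top]])
  qed (auto intro!: always_eventually integral_nonneg_AE)
qed

text \<open>The distance never exceeds the sum of the two heights, and falls short of it by at most
  \<open>2 j\<close> unless the vertices share their ancestor at time \<open>j\<close>. In that
  exceptional case only nonnegativity of the distance is used, at a cost of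
  \<open>2 l\<close>.\<close>

lemma distance_pointwise:
  assumes T: "wf_tree k T" "u \<in> verts T" "v \<in> verts T" and lg: "0 < lg"
  shows "\<bar>real (gdist T u v) / lg - 2 * l\<bar> \<le> \<bar>real (rdep 0 T u) / lg - l\<bar> + \<bar>real (rdep 0 T v) / lg - l\<bar>
    + 2 * real j / lg + 2 * l * of_bool (anc j T u = anc j T v)"
proof -
  let ?a = "real (rdep 0 T u) / lg" and ?b = "real (rdep 0 T v) / lg" and ?d = "real (gdist T u v) / lg"
  have "real (gdist T u v) \<le> real (rdep 0 T u) + real (rdep 0 T v)"
    using gdist_le[OF T] by linarith
  hence "?d \<le> (real (rdep 0 T u) + real (rdep 0 T v)) / lg" using lg by (intro divide_right_mono) auto
  hence up: "?d \<le> ?a + ?b" by (simp add: add_divide_distrib)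
  have nn: "0 \<le> ?d" "0 \<le> 2 * real j / lg" using lg by auto
  show ?thesis
  proof (cases "anc j T u = anc j T v")
    case True
    have "?d - 2 * l \<le> \<bar>?a - l\<bar> + \<bar>?b - l\<bar>" using up by linarith
    thus ?thesis using True nn l_pos by (simp add: abs_le_iff)
  next
    case False
    have "real (rdep 0 T u) + real (rdep 0 T v) \<le> real (gdist T u v) + 2 * real j"
      using gdist_ge_heights[OF T False] by linarith
    hence "(real (rdep 0 T u) + real (rdep 0 T v)) / lg \<le> (real (gdist T u v) + 2 * real j) / lg"
      using lg by (intro divide_right_mono) auto
    hence "?a + ?b \<le> ?d + 2 * real j / lg" by (simp add: add_divide_distrib)
    moreover have "2 * l * of_bool (anc j T u = anc j T v) = 0" using False by simp
    ultimately show ?thesis using up nn by linarith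
  qed
qed

lemma distance_Lp:
  assumes p: "1 \<le> p"
  shows "tendsto_Lp p (\<lambda>n. tree_vertices_law (x n) n) (\<lambda>n (T, v1, v2). real (gdist T v1 v2) / L n) (2 * l)"
proof -
  let ?M = "\<lambda>n. tree_vertices_law (x n) n"
  define D where "D n = measure_pmf.expectation (?M n)
     (\<lambda>\<omega>. \<bar>(case \<omega> of (T, u, v) \<Rightarrow> real (gdist T u v) / L n) - 2 * l\<bar> powr p)" for n
  define q where "q n = measure_pmf.expectation (?M n)
     (\<lambda>(T, u, v). of_bool (anc (m n) T u = anc (m n) T v) :: real)" for n
  have int: "integrable (measure_pmf (?M n)) f" for n and f :: "_ \<Rightarrow> real"
    by (intro integrable_measure_pmf_finite finite_set_verts_law)
  have sym: "measure_pmf.expectation (?M n) (\<lambda>(T, u, v). \<bar>real (rdep 0 T v) / L n - l\<bar> powr p) = mom p n" for n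
    unfolding mom_def verts_law_expectation_1 ..
  have le: "D n \<le> 4 powr p * (2 * mom p n + (2 * (real (m n) / L n)) powr p + (2 * l) powr p * q n)"
    if n: "2 \<le> n" for n
  proof -
    have lg: "0 < L n" using n by simp
    have "D n \<le> measure_pmf.expectation (?M n) (\<lambda>\<omega>. 4 powr p * (
        (case \<omega> of (T, u, v) \<Rightarrow> \<bar>real (rdep 0 T u) / L n - l\<bar> powr p)
        + (case \<omega> of (T, u, v) \<Rightarrow> \<bar>real (rdep 0 T v) / L n - l\<bar> powr p)
        + (2 * (real (m n) / L n)) powr p
        + (2 * l) powr p * (case \<omega> of (T, u, v) \<Rightarrow> of_bool (anc (m n) T u = anc (m n) T v))))"
      unfolding D_def
    proof (rule expectation_mono[OF finite_set_verts_law], clarify)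
      fix T u v assume "(T, u, v) \<in> set_pmf (?M n)"
      note T = set_verts_law(2-4)[OF this]
      define b where "b = (of_bool (anc (m n) T u = anc (m n) T v) :: real)"
      have bp: "b powr p = b" by (simp add: b_def)
      have "\<bar>real (gdist T u v) / L n - 2 * l\<bar> powr p \<le>
        (\<bar>real (rdep 0 T u) / L n - l\<bar> + \<bar>real (rdep 0 T v) / L n - l\<bar> + 2 * (real (m n) / L n) + 2 * l * b) powr p"
        using distance_pointwise[OF T lg, of "m n"] p by (intro powr_mono2) (auto simp: b_def)
      also have "\<dots> \<le> 4 powr p * (\<bar>real (rdep 0 T u) / L n - l\<bar> powr p + \<bar>real (rdep 0 T v) / L n - l\<bar> powr p
         + (2 * (real (m n) / L n)) powr p + (2 * l * b) powr p)"
        using p lg l_pos by (intro powr_add4_le) (auto simp: b_def)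
      also have "(2 * l * b) powr p = (2 * l) powr p * b"
        using l_pos by (subst powr_mult) (auto simp: bp)
      finally show "\<bar>real (gdist T u v) / L n - 2 * l\<bar> powr p \<le> 4 powr p * (
        \<bar>real (rdep 0 T u) / L n - l\<bar> powr p + \<bar>real (rdep 0 T v) / L n - l\<bar> powr p
        + (2 * (real (m n) / L n)) powr p + (2 * l) powr p * of_bool (anc (m n) T u = anc (m n) T v))"
        unfolding b_def .
    qed
    also have "\<dots> = 4 powr p * (mom p n + mom p n + (2 * (real (m n) / L n)) powr p + (2 * l) powr p * q n)"
      using int sym[of n] unfolding mom_def[symmetric] q_def by (simp add: mom_def)
    finally show ?thesis by simp
  qed
  have "(\<lambda>n. 4 powr p * (2 * mom p n + (2 * (real (m n) / L n)) powr p + (2 * l) powr p * q n))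
    \<longlonglongrightarrow> 4 powr p * (2 * 0 + 0 + (2 * l) powr p * 0)"
  proof (intro tendsto_intros mom_tendsto p)
    show "q \<longlonglongrightarrow> 0" unfolding q_def by (rule same_ancestor_tendsto)
    have "(\<lambda>n. (2 * (real (m n) / L n)) powr p) \<longlonglongrightarrow> (2 * 0) powr p"
      using p by (intro tendsto_powr' tendsto_mult tendsto_const m_small)
        (auto intro!: eventually_mono[OF ev_ge[of 1]])
    thus "(\<lambda>n. (2 * (real (m n) / L n)) powr p) \<longlonglongrightarrow> 0" by simp
  qed
  hence lim: "(\<lambda>n. 4 powr p * (2 * mom p n + (2 * (real (m n) / L n)) powr p + (2 * l) powr p * q n)) \<longlonglongrightarrow> 0" by simp
  have "D \<longlonglongrightarrow> 0"
  proof (rule tendsto_sandwich[OF _ _ tendsto_const lim])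
    show "eventually (\<lambda>n. 0 \<le> D n) sequentially"
      unfolding D_def by (intro always_eventually allI integral_nonneg_AE) auto
    show "eventually (\<lambda>n. D n \<le> 4 powr p * (2 * mom p n + (2 * (real (m n) / L n)) powr p + (2 * l) powr p * q n)) sequentially"
      using ev_ge[of 2] by eventually_elim (rule le)
  qed
  thus ?thesis using int unfolding tendsto_Lp_def D_def by blast
qed

end

section \<open>Maximal height\<close>

lemma is_f_strict_mono:
  fixes y z :: real
  assumes "1 < y" "y < z"
  shows "y * (ln y - 1) < z * (ln z - 1)"
proof (rule DERIV_pos_imp_increasing[OF assms(2)])
  fix t :: real assume "y \<le> t" "t \<le> z"
  hence t: "1 < t" using assms by simp
  have "((\<lambda>y. y * (ln y - 1)) has_real_derivative ln t) (at t)"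
    using t by (auto intro!: derivative_eq_intros)
  thus "\<exists>d. ((\<lambda>y. y * (ln y - 1)) has_real_derivative d) (at t) \<and> 0 < d"
    using t by (intro exI[of _ "ln t"]) simp
qed

text \<open>On \<open>[1, exp 1]\<close> the function goes from -1 to 0. The right-hand side is at
  most 0 because \<open>c \<le> 1\<close>, and above -1 because \<open>c > 0\<close>, which also
  rules out the root 1.\<close>

lemma ex1_is_f:
  assumes "0 < c" "c \<le> 1"
  shows "\<exists>!y. is_f c y"
proof -
  let ?r = "(c - 1) / (c + 1)"
  have r: "-1 < ?r" "?r \<le> 0" using assms by (auto simp: field_simps divide_nonpos_pos)
  have "\<exists>y. 1 \<le> y \<and> y \<le> exp 1 \<and> y * (ln y - 1) = ?r"
    using r by (intro IVT') (auto intro!: continuous_intros)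
  then obtain y where y: "1 \<le> y" "y * (ln y - 1) = ?r" by blast
  hence "y \<noteq> 1" using r by auto
  hence "is_f c y" using y by (simp add: is_f_def)
  moreover have "z = y'" if "is_f c z" "is_f c y'" for z y'
    using that is_f_strict_mono[of z y'] is_f_strict_mono[of y' z] unfolding is_f_def by linarith
  ultimately show ?thesis by blast
qed

section \<open>Tails of the maximal height for fixed \<open>n\<close>\<close>

context freezing_walk
begin

text \<open>Markov's inequality for the total weight: a single vertex above height \<open>h\<close>
  already contributes \<open>exp (h * ln z)\<close>.\<close>

lemma height_upper_tail:
  assumes "1 < z"
  shows "measure_pmf.expectation (tree_law x n) (\<lambda>T. of_bool (real (Height T) > h))
    \<le> N * (z * exp ((z - 1) * hp x 0 n - h * ln z))"
proof -
  have "of_bool (real (Height T) > h) \<le> exp (- h * ln z) * (\<Sum>v\<in>verts T. z ^ rdep 0 T v)"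
    if T: "T \<in> set_pmf (tree_law x n)" for T
  proof (cases "real (Height T) > h")
    case True
    have wf: "wf_tree n T" by (rule wf_tree_law[OF T])
    obtain v where v: "v \<in> verts T" "h < real (rdep 0 T v)"
      using True Height_le_iff[OF wf, of h] by (auto simp: not_le)
    have "h * ln z \<le> real (rdep 0 T v) * ln z" using v assms by (intro mult_right_mono) auto
    hence "exp (h * ln z) \<le> exp (real (rdep 0 T v) * ln z)" by simp
    also have "\<dots> = z ^ rdep 0 T v" using assms by (simp add: exp_of_nat_mult)
    also have "\<dots> \<le> (\<Sum>v\<in>verts T. z ^ rdep 0 T v)"
      using v wf_treeD(3)[OF wf] assms by (intro member_le_sum) auto
    finally have "exp (- h * ln z) * exp (h * ln z) \<le> exp (- h * ln z) * (\<Sum>v\<in>verts T. z ^ rdep 0 T v)"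
      by (intro mult_left_mono) auto
    thus ?thesis using True by (simp add: exp_add[symmetric])
  qed (use assms in \<open>auto intro!: mult_nonneg_nonneg sum_nonneg\<close>)
  hence "measure_pmf.expectation (tree_law x n) (\<lambda>T. of_bool (real (Height T) > h))
    \<le> measure_pmf.expectation (tree_law x n) (\<lambda>T. exp (- h * ln z) * (\<Sum>v\<in>verts T. z ^ rdep 0 T v))"
    by (intro expectation_mono finite_set_tree_law)
  also have "\<dots> = exp (- h * ln z) * measure_pmf.expectation (tree_law x n) (\<lambda>T. \<Sum>v\<in>verts T. z ^ rdep 0 T v)"
    by simp
  also have "\<dots> \<le> exp (- h * ln z) * (N * (z * exp ((z - 1) * hp x 0 n)))"
    using assms by (intro mult_left_mono expectation_verts_sum_le) auto
  also have "\<dots> = N * (z * (exp (- h * ln z) * exp ((z - 1) * hp x 0 n)))"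
    by (simp only: mult_ac)
  also have "exp (- h * ln z) * exp ((z - 1) * hp x 0 n) = exp ((z - 1) * hp x 0 n - h * ln z)"
    unfolding exp_add[symmetric] by (rule arg_cong[where f = exp]) simp
  finally show ?thesis .
qed

text \<open>Steps remove no vertex and change no height, so the maximum cannot decrease. This allows
  the lower bound to be proved at an earlier time \<open>K\<close>, inside the window where the walk
  is close to linear.\<close>

lemma height_lower_tail_le:
  assumes "K \<le> n"
  shows "measure_pmf.expectation (tree_law x n) (\<lambda>T. of_bool (real (Height T) \<le> h) :: real)
    \<le> measure_pmf.expectation (tree_law x K) (\<lambda>T. of_bool (\<forall>v\<in>verts T. real (rdep 0 T v) \<le> h))"
proof -
  have "measure_pmf.expectation (tree_law x n) (\<lambda>T. of_bool (real (Height T) \<le> h) :: real)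
    = measure_pmf.expectation (tree_law x n) (\<lambda>T. of_bool (\<forall>v\<in>verts T. real (rdep 0 T v) \<le> h))"
    by (intro expectation_cong) (simp add: Height_le_iff[OF wf_tree_law])
  also have "\<dots> \<le> measure_pmf.expectation (tree_law x K) (\<lambda>T. of_bool (\<forall>v\<in>verts T. real (rdep 0 T v) \<le> h))"
  proof (rule expectation_antimono[OF assms order_refl])
    fix j T v assume T: "wf_tree j T" "v \<in> active T"
    have vv: "v \<in> verts T" using T active_subset_verts by blast
    have keep: "w \<in> verts (upd (Suc j) v T) \<and> rdep 0 (upd (Suc j) v T) w = rdep 0 T w" if "w \<in> verts T" for w
      using that vv wf_treeD(1)[OF T(1)] by (auto simp: upd_def verts_freeze rdep_attach)
    have "real (rdep 0 T w) \<le> h"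
      if "\<forall>w\<in>verts (upd (Suc j) v T). real (rdep 0 (upd (Suc j) v T) w) \<le> h" "w \<in> verts T" for w
      using keep[OF that(2)] that(1) by metis
    thus "of_bool (\<forall>w\<in>verts (upd (Suc j) v T). real (rdep 0 (upd (Suc j) v T) w) \<le> h)
       \<le> (of_bool (\<forall>w\<in>verts T. real (rdep 0 T w) \<le> h) :: real)"
      by (simp add: of_bool_def)
  qed
  finally show ?thesis .
qed

text \<open>If all heights are at most \<open>h\<close>, then
  \<open>z ^ r \<le> (z / z') powr h * z' ^ r\<close> for every active vertex, so the martingale for
  \<open>z\<close> is bounded by a multiple of \<open>Z m z'\<close>, whose mean is known. Either
  the martingale is below 1/2, which happens only if
  \<open>\<bar>mart - 1\<bar> powr q \<ge> 1/4\<close> (hence the factor 4), or 1 is at most twice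
  that bound (hence the factor 2).\<close>

lemma no_high_vertex:
  assumes mK: "m \<le> K" "K \<le> n" and z: "1 \<le> z'" "z' < z" and q: "1 < q" "q \<le> 2"
  shows "measure_pmf.expectation (tree_law x K) (\<lambda>T. of_bool (\<forall>v\<in>verts T. real (rdep 0 T v) \<le> h))
    \<le> 4 * measure_pmf.expectation (tree_law x K) (\<lambda>T. \<bar>mart m z K T - 1\<bar> powr q)
      + 2 * exp (h * ln (z / z') - (z - z') * hp x m K + (z - 1)\<^sup>2 * inv_sq m K)"
proof -
  define G where "G = S K * growth x m K z"
  have S: "S K > 0" using S_ge_1[OF mK(2)] by simp
  have g: "growth x m K z > 0" using growth_pos[OF mK(2)] z by simp
  have G: "G > 0" using S g by (simp add: G_def)
  define R where "R = exp (h * ln (z / z'))"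
  have pt: "of_bool (\<forall>v\<in>verts T. real (rdep 0 T v) \<le> h)
     \<le> 4 * \<bar>mart m z K T - 1\<bar> powr q + (2 * R / G) * Z m z' T + 0"
    if T: "T \<in> set_pmf (tree_law x K)" for T
  proof (cases "\<forall>v\<in>verts T. real (rdep 0 T v) \<le> h")
    case True
    have "z ^ rdep m T v \<le> R * z' ^ rdep m T v" if v: "v \<in> active T" for v
    proof -
      have "real (rdep m T v) \<le> h"
        using True v active_subset_verts[of T] rdep_le_rdep_0[of m T v] by fastforce
      hence "real (rdep m T v) * ln (z / z') \<le> h * ln (z / z')"
        using z by (intro mult_right_mono) auto
      hence "exp (real (rdep m T v) * ln (z / z')) \<le> R" unfolding R_def by simp
      hence "(z / z') ^ rdep m T v \<le> R" using z by (simp add: exp_of_nat_mult)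
      hence "(z / z') ^ rdep m T v * z' ^ rdep m T v \<le> R * z' ^ rdep m T v"
        using z by (intro mult_right_mono) auto
      thus ?thesis using z by (simp add: power_divide)
    qed
    hence "Z m z T \<le> R * Z m z' T" unfolding Z_def sum_distrib_left by (intro sum_mono)
    hence "mart m z K T \<le> R * Z m z' T / G"
      unfolding mart_def G_def[symmetric] using G by (intro divide_right_mono) auto
    hence b: "2 * mart m z K T \<le> (2 * R / G) * Z m z' T" by simp
    have Z0: "0 \<le> (2 * R / G) * Z m z' T" using z G
      unfolding Z_def R_def by (intro mult_nonneg_nonneg sum_nonneg) auto
    show ?thesis
    proof (cases "mart m z K T < 1 / 2")
      case True
      hence "(1 / 2) powr q \<le> \<bar>mart m z K T - 1\<bar> powr q" using q by (intro powr_mono2) auto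
      moreover have "(1 / 2) powr 2 \<le> (1 / 2) powr q" using q by (intro powr_mono') auto
      moreover have "(1 / 2) powr 2 = (1 / 4 :: real)" by (simp add: power2_eq_square)
      moreover have "of_bool (\<forall>v\<in>verts T. real (rdep 0 T v) \<le> h) \<le> (1 :: real)" by simp
      ultimately show ?thesis using Z0 by linarith
    next
      case False
      have "0 \<le> \<bar>mart m z K T - 1\<bar> powr q" by simp
      moreover have "of_bool (\<forall>v\<in>verts T. real (rdep 0 T v) \<le> h) \<le> (1 :: real)" by simp
      ultimately show ?thesis using False b by linarith
    qed
  next
    case False
    have "0 \<le> (2 * R / G) * Z m z' T" using z G
      unfolding Z_def R_def by (intro mult_nonneg_nonneg sum_nonneg) auto
    moreover have "0 \<le> \<bar>mart m z K T - 1\<bar> powr q" by simp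
    moreover have "of_bool (\<forall>v\<in>verts T. real (rdep 0 T v) \<le> h) = (0 :: real)"
      by (simp only: False of_bool_eq)
    ultimately show ?thesis by linarith
  qed
  have "measure_pmf.expectation (tree_law x K) (\<lambda>T. of_bool (\<forall>v\<in>verts T. real (rdep 0 T v) \<le> h))
    \<le> measure_pmf.expectation (tree_law x K) (\<lambda>T. 4 * \<bar>mart m z K T - 1\<bar> powr q + (2 * R / G) * Z m z' T + 0)"
    by (intro expectation_mono finite_set_tree_law pt)
  also have "\<dots> = 4 * measure_pmf.expectation (tree_law x K) (\<lambda>T. \<bar>mart m z K T - 1\<bar> powr q)
      + 2 * (R * (growth x m K z' / growth x m K z))"
    unfolding expectation_linear expectation_Z[OF mK] G_def using S g by simp
  also have "R * (growth x m K z' / growth x m K z)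
     \<le> R * (exp ((z' - 1) * hp x m K) / exp ((z - 1) * hp x m K - (z - 1)\<^sup>2 * inv_sq m K))"
    using growth_le[OF mK(2), of z' m] growth_ge[OF mK(2), of z m] growth_pos[OF mK(2), of z' m] z
    by (intro mult_left_mono frac_le) (auto simp: R_def)
  also have "\<dots> = exp (h * ln (z / z') - (z - z') * hp x m K + (z - 1)\<^sup>2 * inv_sq m K)"
    unfolding R_def exp_diff[symmetric] exp_add[symmetric]
    by (rule arg_cong[where f = exp]) (simp add: algebra_simps)
  finally show ?thesis by simp
qed

text \<open>In \<open>growth (z powr q) / growth z powr q\<close> the exponents combine to
  \<open>\<kappa> * hp\<close>, and \<open>hp\<close> is at most \<open>\<alpha> * ln i + C\<close>;
  the factor \<open>S i powr (- q)\<close> supplies \<open>i powr (- q)\<close>. The term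
  \<open>q (z - 1)\<^sup>2 / \<gamma>\<^sup>2\<close> (written informally) inside \<open>exp\<close>
  is the second-order error of \<open>growth_ge\<close>.\<close>

lemma mart_moment_summable:
  assumes mK: "1 \<le> m" "m \<le> K" "K \<le> n" and z: "1 \<le> z" and q: "1 < q" "q \<le> 2"
    and \<gamma>: "0 < \<gamma>" "\<And>i. m \<le> i \<Longrightarrow> i \<le> K \<Longrightarrow> \<gamma> * real i \<le> S i"
    and \<alpha>: "0 \<le> \<alpha>" "\<And>k. m \<le> k \<Longrightarrow> k \<le> K \<Longrightarrow> hp x m k \<le> \<alpha> * ln (real k / real m) + C"
  defines "\<kappa> \<equiv> z powr q - 1 - q * (z - 1)"
  shows "measure_pmf.expectation (tree_law x K) (\<lambda>T. \<bar>mart m z K T - 1\<bar> powr q)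
    \<le> 6 * (z / \<gamma>) powr q * exp (q * ((z - 1)\<^sup>2 / \<gamma>\<^sup>2) + \<kappa> * C)
       * (\<Sum>i\<in>{m<..K}. real i powr (\<alpha> * \<kappa> - q))"
proof -
  have \<kappa>: "0 \<le> \<kappa>" using powr_tangent[of 1 z q] z q by (simp add: \<kappa>_def)
  define D where "D = (z - 1)\<^sup>2 / \<gamma>\<^sup>2"
  define E where "E = 6 * (z / \<gamma>) powr q * exp (q * D + \<kappa> * C)"
  have "measure_pmf.expectation (tree_law x K) (\<lambda>T. \<bar>mart m z K T - 1\<bar> powr q)
    \<le> (\<Sum>i\<in>{m<..K}. 6 * (z / (S i * growth x m (i - 1) z)) powr q * growth x m (i - 1) (z powr q))"
    by (rule mart_moment[OF z q mK(2,3)])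
  also have "\<dots> \<le> (\<Sum>i\<in>{m<..K}. E * real i powr (\<alpha> * \<kappa> - q))"
  proof (rule sum_mono)
    fix i assume i: "i \<in> {m<..K}"
    define h where "h = hp x m (i - 1)"
    have i0: "0 < real i" "0 < real m" "m \<le> i - 1" "i - 1 \<le> K" "i - 1 \<le> n" using i mK by auto
    have "inv_sq m (i - 1) \<le> 1 / (\<gamma>\<^sup>2 * real m)"
      using mK(1) i0 \<gamma> by (intro inv_sq_le) auto
    also have "\<dots> \<le> 1 / \<gamma>\<^sup>2" using mK(1) \<gamma> by (intro divide_left_mono) auto
    finally have "(z - 1)\<^sup>2 * inv_sq m (i - 1) \<le> (z - 1)\<^sup>2 * (1 / \<gamma>\<^sup>2)" by (intro mult_left_mono) auto
    hence "exp ((z - 1) * h - D) \<le> exp ((z - 1) * h - (z - 1)\<^sup>2 * inv_sq m (i - 1))" by (simp add: D_def)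
    also have "\<dots> \<le> growth x m (i - 1) z" unfolding h_def using growth_ge i0 z by simp
    finally have g: "exp ((z - 1) * h - D) \<le> growth x m (i - 1) z" .
    have Si: "\<gamma> * real i \<le> S i" "0 < \<gamma> * real i" using \<gamma> i i0 by auto
    have pos: "0 < (\<gamma> * real i) * exp ((z - 1) * h - D)" using Si by simp
    have le: "(\<gamma> * real i) * exp ((z - 1) * h - D) \<le> S i * growth x m (i - 1) z"
      using Si g by (intro mult_mono) auto
    have "z / (S i * growth x m (i - 1) z) \<le> z / ((\<gamma> * real i) * exp ((z - 1) * h - D))"
      using z by (intro divide_left_mono[OF le _ mult_pos_pos[OF less_le_trans[OF pos le] pos]]) auto
    hence "(z / (S i * growth x m (i - 1) z)) powr q \<le> (z / ((\<gamma> * real i) * exp ((z - 1) * h - D))) powr q"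
      using z q by (intro powr_mono2 divide_nonneg_pos[OF _ less_le_trans[OF pos le]]) auto
    also have "z / ((\<gamma> * real i) * exp ((z - 1) * h - D)) = (z / \<gamma>) * (1 / real i * exp (D - (z - 1) * h))"
      by (simp add: exp_diff field_simps)
    also have "\<dots> powr q = (z / \<gamma>) powr q * (real i powr (- q) * exp (q * (D - (z - 1) * h)))"
      using z \<gamma> i0 by (simp add: powr_mult powr_divide powr_minus_divide exp_powr_real mult.commute)
    finally have 1: "(z / (S i * growth x m (i - 1) z)) powr q
       \<le> (z / \<gamma>) powr q * (real i powr (- q) * exp (q * (D - (z - 1) * h)))" .
    have zq: "0 < z powr q" using z by simp
    have 2: "growth x m (i - 1) (z powr q) \<le> exp ((z powr q - 1) * h)"
      unfolding h_def by (rule growth_le[OF i0(5) zq])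
    have 3: "\<kappa> * h \<le> \<alpha> * \<kappa> * ln (real i) + \<kappa> * C"
    proof -
      \<comment> \<open>The gain from \<open>ln (real m)\<close> is given up; the sum over
        \<open>i > m\<close> is small anyway as the tail of a convergent series.\<close>
      have "ln (real (i - 1) / real m) \<le> ln (real i)"
      proof -
        have "real (i - 1) / real m \<le> real i / 1" using i0 mK by (intro frac_le) auto
        thus ?thesis using i0 mK by (subst ln_le_cancel_iff) auto
      qed
      hence "\<alpha> * ln (real (i - 1) / real m) \<le> \<alpha> * ln (real i)" using \<alpha>(1) by (rule mult_left_mono)
      hence "h \<le> \<alpha> * ln (real i) + C" using \<alpha>(2)[OF i0(3,4)] unfolding h_def by linarith
      hence "\<kappa> * h \<le> \<kappa> * (\<alpha> * ln (real i) + C)" using \<kappa> by (intro mult_left_mono)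
      thus ?thesis by (simp add: algebra_simps)
    qed
    have "6 * (z / (S i * growth x m (i - 1) z)) powr q * growth x m (i - 1) (z powr q)
      \<le> 6 * ((z / \<gamma>) powr q * (real i powr (- q) * exp (q * (D - (z - 1) * h)))) * exp ((z powr q - 1) * h)"
      using 1 2 growth_pos[OF i0(5) zq, of m] by (intro mult_mono) auto
    also have "\<dots> = 6 * (z / \<gamma>) powr q * real i powr (- q) * exp (q * D + \<kappa> * h)"
    proof -
      have "exp (q * (D - (z - 1) * h)) * exp ((z powr q - 1) * h) = exp (q * D + \<kappa> * h)"
        unfolding exp_add[symmetric] \<kappa>_def by (rule arg_cong[where f = exp]) (simp add: algebra_simps)
      thus ?thesis by simp
    qed
    also have "\<dots> \<le> 6 * (z / \<gamma>) powr q * real i powr (- q) * exp (q * D + (\<alpha> * \<kappa> * ln (real i) + \<kappa> * C))"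
      using 3 by (intro mult_left_mono) auto
    also have "\<dots> = E * (real i powr (\<alpha> * \<kappa>) * real i powr (- q))"
      using i0 by (simp add: E_def powr_def exp_add)
    also have "\<dots> = E * real i powr (\<alpha> * \<kappa> - q)"
      by (simp add: powr_add[symmetric])
    finally show "6 * (z / (S i * growth x m (i - 1) z)) powr q * growth x m (i - 1) (z powr q)
      \<le> E * real i powr (\<alpha> * \<kappa> - q)" .
  qed
  also have "\<dots> = E * (\<Sum>i\<in>{m<..K}. real i powr (\<alpha> * \<kappa> - q))" by (simp only: sum_distrib_left)
  finally show ?thesis unfolding E_def D_def .
qed

end

section \<open>Convergence of the maximal height\<close>

context freezing_asymptotics
begin

definition f :: real where "f = f_sol c"

text \<open>The second form comes from
  \<open>l * (c - 1) / (c + 1) = (c - 1) / (2 * c) = 1 - l\<close>; it is the one that matches the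
  exponents of \<open>n\<close>.\<close>

lemma f_props: "1 < f" "l * (f * (ln f - 1)) = 1 - l"
proof -
  have "is_f c f"
    unfolding f_def f_sol_def using theI'[OF ex1_is_f[OF c_pos c_le]] .
  hence f: "1 < f" "f * (ln f - 1) = (c - 1) / (c + 1)" by (auto simp: is_f_def)
  show "1 < f" by (rule f)
  show "l * (f * (ln f - 1)) = 1 - l"
  proof -
    have "l * ((c - 1) / (c + 1)) = (c - 1) / (2 * c)" using c_pos by (simp add: l_def)
    also have "\<dots> = 1 - l" using c_pos by (simp add: l_def field_simps)
    finally show ?thesis unfolding f(2) .
  qed
qed

lemma height_upper_tendsto:
  assumes e: "0 < e"
  shows "(\<lambda>n. measure_pmf.expectation (tree_law (x n) n) (\<lambda>T. of_bool (real (Height T) > (l * f + e) * L n)) :: real) \<longlonglongrightarrow> 0"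
proof -
  have lf: "0 < ln f" using f_props by simp
  define g where "g n = ln (2 * f) + L n + ((f - 1) * hp (x n) 0 n - (l * f + e) * L n * ln f)" for n
  have lim: "(\<lambda>n. exp (g n)) \<longlonglongrightarrow> 0"
  proof (rule exp_tendsto_0)
    have "(\<lambda>n. ln (2 * f) / L n + 1 + ((f - 1) * (hp (x n) 0 n / L n) - (l * f + e) * ln f))
      \<longlonglongrightarrow> 0 + 1 + ((f - 1) * l - (l * f + e) * ln f)"
      by (intro tendsto_intros hp_asymp const_div_L)
    moreover have "eventually (\<lambda>n. ln (2 * f) / L n + 1 + ((f - 1) * (hp (x n) 0 n / L n) - (l * f + e) * ln f) = g n / L n) sequentially"
      using ev_ge[of 2] by eventually_elim (simp add: g_def add_divide_distrib diff_divide_distrib)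
    ultimately show "(\<lambda>n. g n / L n) \<longlonglongrightarrow> 0 + 1 + ((f - 1) * l - (l * f + e) * ln f)"
      using tendsto_cong by fastforce
    \<comment> \<open>The 1 is the number of vertices on the logarithmic scale. At
      \<open>e = 0\<close> the rate is zero by the equation of \<open>f\<close>, so any excess makes
      it negative.\<close>
    have "0 + 1 + ((f - 1) * l - (l * f + e) * ln f) = - (e * ln f)"
      using f_props(2) by (simp add: algebra_simps)
    also have "\<dots> < 0" using e lf by simp
    finally show "0 + 1 + ((f - 1) * l - (l * f + e) * ln f) < 0" .
  qed
  show ?thesis
  proof (rule tendsto_sandwich[OF _ _ tendsto_const lim])
    show "eventually (\<lambda>n. measure_pmf.expectation (tree_law (x n) n) (\<lambda>T. of_bool (real (Height T) > (l * f + e) * L n)) \<le> exp (g n)) sequentially"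
      using ev_ge[of 1]
    proof eventually_elim
      case (elim n)
      interpret freezing_walk "x n" n by (rule walk_ok) (use elim in simp)
      have "N \<le> 1 + (\<Sum>i\<in>{1..n}. 1)" unfolding N_eq by (intro add_left_mono sum_mono) auto
      hence N: "N \<le> 2 * real n" using elim by simp
      have "measure_pmf.expectation (tree_law (x n) n) (\<lambda>T. of_bool (real (Height T) > (l * f + e) * L n))
        \<le> N * (f * exp ((f - 1) * hp (x n) 0 n - (l * f + e) * L n * ln f))"
        by (rule height_upper_tail[OF f_props(1)])
      also have "\<dots> \<le> (2 * real n) * (f * exp ((f - 1) * hp (x n) 0 n - (l * f + e) * L n * ln f))"
        using N f_props by (intro mult_right_mono) auto
      also have "\<dots> = exp (g n)"
        using elim f_props by (simp add: g_def exp_add)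
      finally show ?case .
    qed
  qed (auto intro!: always_eventually integral_nonneg_AE)
qed

text \<open>The exponent \<open>q\<close> exists because the left-hand side vanishes at \<open>q = 1\<close>, where its
  derivative is negative precisely when \<open>z < f\<close>.\<close>
lemma exponent_exists:
  assumes z: "1 < z" "z < f"
  obtains q where "1 < q" "q \<le> 2" "1 - q + l * (z powr q - 1 - q * (z - 1)) < 0"
proof -
  define D where "D = -1 + l * (z * ln z - (z - 1))"
  have "z * (ln z - 1) < f * (ln f - 1)" by (rule is_f_strict_mono[OF z])
  hence "l * (z * (ln z - 1)) < 1 - l" using l_pos f_props(2) by (metis mult_strict_left_mono)
  hence D: "D < 0" by (simp add: D_def algebra_simps)
  have "((\<lambda>q. 1 - q + l * (z powr q - 1 - q * (z - 1))) has_real_derivative D) (at 1)"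
    unfolding D_def using z by (auto intro!: derivative_eq_intros)
  from DERIV_neg_dec_right[OF this D] obtain d where d: "0 < d"
    "\<And>h. 0 < h \<Longrightarrow> h < d \<Longrightarrow> 1 - (1 + h) + l * (z powr (1 + h) - 1 - (1 + h) * (z - 1))
      < 1 - 1 + l * (z powr 1 - 1 - 1 * (z - 1))" by auto
  show thesis
  proof (rule that[of "1 + min (d / 2) 1"])
    show "1 - (1 + min (d / 2) 1) + l * (z powr (1 + min (d / 2) 1) - 1 - (1 + min (d / 2) 1) * (z - 1)) < 0"
      using d(2)[of "min (d / 2) 1"] d(1) z by simp
  qed (use d in auto)
qed

text \<open>The Cauchy criterion is uniform in the upper end, so \<open>K\<close> may be arbitrary
  as long as \<open>m n\<close> tends to infinity.\<close>

lemma powr_tail_tendsto: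
  fixes K :: "nat \<Rightarrow> nat"
  assumes "s < -1"
  shows "(\<lambda>n. \<Sum>i\<in>{m n<..K n}. real i powr s) \<longlonglongrightarrow> 0"
proof (rule tendstoI)
  fix r :: real assume r: "0 < r"
  have "summable (\<lambda>i. real i powr s)" using assms by (simp add: summable_real_powr_iff)
  then obtain M where M: "\<And>a b. M \<le> a \<Longrightarrow> norm (sum (\<lambda>i. real i powr s) {a..<b}) < r"
    using r unfolding summable_Cauchy by blast
  have "eventually (\<lambda>n. real M \<le> real (m n)) sequentially"
    using m_at_top unfolding filterlim_at_top by blast
  thus "eventually (\<lambda>n. dist (\<Sum>i\<in>{m n<..K n}. real i powr s) 0 < r) sequentially"
  proof eventually_elim
    case (elim n)
    have "{m n<..K n} = {Suc (m n)..<Suc (K n)}" by auto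
    thus ?case using M[of "Suc (m n)" "Suc (K n)"] elim by simp
  qed
qed

lemma mart_tendsto:
  assumes z: "1 < z" "z < f"
  obtains q \<epsilon> where "1 < q" "q \<le> 2" "0 < \<epsilon>" "\<epsilon> < 1"
    "(\<lambda>n. measure_pmf.expectation (tree_law (x n) (nat \<lfloor>\<epsilon> * real n\<rfloor>))
       (\<lambda>T. \<bar>freezing_walk.mart (x n) (m n) z (nat \<lfloor>\<epsilon> * real n\<rfloor>) T - 1\<bar> powr q)) \<longlonglongrightarrow> 0"
proof -
  obtain q where q: "1 < q" "q \<le> 2" "1 - q + l * (z powr q - 1 - q * (z - 1)) < 0"
    using exponent_exists[OF z] by blast
  define \<kappa> where "\<kappa> = z powr q - 1 - q * (z - 1)"
  have \<kappa>: "0 \<le> \<kappa>" using powr_tangent[of 1 z q] z q by (simp add: \<kappa>_def)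
  \<comment> \<open>Spends at most half of the slack \<open>q - 1 - l * \<kappa>\<close> on the
    inaccuracy of \<open>hp_near\<close>; the denominator uses \<open>\<kappa> + 1\<close> because
    only \<open>\<kappa> \<ge> 0\<close> is known.\<close>
  define d where "d = (q - 1 - l * \<kappa>) / (2 * (\<kappa> + 1))"
  have d: "0 < d" using q(3) \<kappa> by (auto simp: d_def \<kappa>_def[symmetric] intro!: divide_pos_pos)
  have "d * \<kappa> \<le> d * (\<kappa> + 1)" using d by simp
  also have "\<dots> = (q - 1 - l * \<kappa>) / 2" using \<kappa> by (simp add: d_def field_simps)
  finally have s: "(l + d) * \<kappa> - q < -1" using q(3) unfolding \<kappa>_def[symmetric] by (simp add: algebra_simps)
  obtain \<epsilon> \<eta> C where \<epsilon>: "0 < \<epsilon>" "\<epsilon> < 1" "0 < \<eta>"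
    "eventually (\<lambda>n. (\<forall>k. m n \<le> k \<and> real k \<le> \<epsilon> * real n \<longrightarrow>
          hp (x n) (m n) k \<le> (l + d) * ln (real k / real (m n)) + C
          \<and> (l - d) * ln (real k / real (m n)) - C \<le> hp (x n) (m n) k)
       \<and> (\<forall>i. \<epsilon> * real n \<le> real i \<and> i \<le> n \<longrightarrow> \<eta> * real n \<le> W n i)) sequentially"
    using hp_near[OF d] by blast
  obtain \<gamma> where \<gamma>: "0 < \<gamma>"
    "eventually (\<lambda>n. \<forall>i. A n \<le> real i \<and> i \<le> n \<longrightarrow> \<gamma> * real i \<le> W n i) sequentially"
    using S_linear by blast
  let ?K = "\<lambda>n. nat \<lfloor>\<epsilon> * real n\<rfloor>"
  define E where "E = 6 * (z / \<gamma>) powr q * exp (q * ((z - 1)\<^sup>2 / \<gamma>\<^sup>2) + \<kappa> * C)"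
  have "(\<lambda>n. E * (\<Sum>i\<in>{m n<..?K n}. real i powr ((l + d) * \<kappa> - q))) \<longlonglongrightarrow> E * 0"
    by (intro tendsto_intros powr_tail_tendsto s)
  hence lim: "(\<lambda>n. E * (\<Sum>i\<in>{m n<..?K n}. real i powr ((l + d) * \<kappa> - q))) \<longlonglongrightarrow> 0" by simp
  have "(\<lambda>n. measure_pmf.expectation (tree_law (x n) (?K n))
       (\<lambda>T. \<bar>freezing_walk.mart (x n) (m n) z (?K n) T - 1\<bar> powr q)) \<longlonglongrightarrow> 0"
  proof (rule tendsto_sandwich[OF _ _ tendsto_const lim])
    show "eventually (\<lambda>n. measure_pmf.expectation (tree_law (x n) (?K n))
       (\<lambda>T. \<bar>freezing_walk.mart (x n) (m n) z (?K n) T - 1\<bar> powr q)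
       \<le> E * (\<Sum>i\<in>{m n<..?K n}. real i powr ((l + d) * \<kappa> - q))) sequentially"
      using \<epsilon>(4) \<gamma>(2) floor_eps[OF \<epsilon>(1,2)] ev_ge[of 1]
    proof eventually_elim
      case (elim n)
      interpret freezing_walk "x n" n by (rule walk_ok) (use elim in simp)
      have K: "m n \<le> ?K n" "?K n \<le> n" "real (?K n) \<le> \<epsilon> * real n" using elim(3) by blast+
      show ?case unfolding E_def \<kappa>_def
      proof (rule mart_moment_summable[OF _ K(1,2) _ q(1,2) \<gamma>(1)])
        fix i assume i: "m n \<le> i" "i \<le> ?K n"
        hence "A n \<le> real i" using m_ge_A[of n] by (meson of_nat_le_iff order_trans)
        thus "\<gamma> * real i \<le> S i" using elim(2) i K(2) by (simp add: W_def S_def)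
      next
        fix k assume k: "m n \<le> k" "k \<le> ?K n"
        hence "real k \<le> real (?K n)" by simp
        hence "real k \<le> \<epsilon> * real n" using K(3) by linarith
        thus "hp (x n) (m n) k \<le> (l + d) * ln (real k / real (m n)) + C"
          using elim(1) k by blast
      qed (use m_ge_1 elim z d l_pos in auto)
    qed
  qed (auto intro!: always_eventually integral_nonneg_AE)
  thus thesis using q \<epsilon> by (intro that) auto
qed

lemma height_lower_tendsto:
  assumes e: "0 < e"
  shows "(\<lambda>n. measure_pmf.expectation (tree_law (x n) n) (\<lambda>T. of_bool (real (Height T) \<le> (l * f - e) * L n)) :: real) \<longlonglongrightarrow> 0"
proof -
  \<comment> \<open>Close enough to \<open>f\<close> that \<open>l * a\<close> exceeds the target
    \<open>l * f - e\<close>; the maximum with 1 ensures \<open>1 \<le> z'\<close>. Then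
    \<open>z'\<close> and \<open>z\<close> divide the interval from \<open>a\<close> to
    \<open>f\<close> into three equal parts.\<close>
  define a where "a = max 1 (f - e / (2 * l))"
  have a: "1 \<le> a" "a < f" using e l_pos f_props by (auto simp: a_def)
  have "l * (f - e / (2 * l)) \<le> l * a" using l_pos by (intro mult_left_mono) (auto simp: a_def)
  moreover have "l * (f - e / (2 * l)) = l * f - e / 2" using l_pos by (simp add: algebra_simps)
  ultimately have la: "l * f - e < l * a" using e by linarith
  define z' where "z' = (2 * a + f) / 3"
  define z where "z = (a + 2 * f) / 3"
  have z: "a < z'" "z' < z" "z < f" "1 \<le> z'" "1 < z" "0 < z'" using a by (auto simp: z'_def z_def)
  obtain q \<epsilon> where q: "1 < q" "q \<le> 2" and \<epsilon>: "0 < \<epsilon>" "\<epsilon> < 1" and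
    mlim: "(\<lambda>n. measure_pmf.expectation (tree_law (x n) (nat \<lfloor>\<epsilon> * real n\<rfloor>))
       (\<lambda>T. \<bar>freezing_walk.mart (x n) (m n) z (nat \<lfloor>\<epsilon> * real n\<rfloor>) T - 1\<bar> powr q)) \<longlonglongrightarrow> 0"
    using mart_tendsto[OF z(5,3)] by blast
  let ?K = "\<lambda>n. nat \<lfloor>\<epsilon> * real n\<rfloor>"
  obtain C where C: "eventually (\<lambda>n. hp (x n) 0 n - C \<le> hp (x n) 0 (?K n)) sequentially"
    using hp_late[OF \<epsilon>] by blast
  obtain \<gamma> where \<gamma>: "0 < \<gamma>"
    "eventually (\<lambda>n. \<forall>i. A n \<le> real i \<and> i \<le> n \<longrightarrow> \<gamma> * real i \<le> W n i) sequentially"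
    using S_linear by blast
  define w where "w = l * f - e"
  define D where "D = (z - 1)\<^sup>2 * (1 / \<gamma>\<^sup>2)"
  define g where "g n = w * L n * ln (z / z') - (z - z') * (hp (x n) 0 n - C - real (m n)) + D" for n
  have "(\<lambda>n. exp (g n)) \<longlonglongrightarrow> 0"
  proof (rule exp_tendsto_0)
    have "(\<lambda>n. w * ln (z / z') - (z - z') * (hp (x n) 0 n / L n - C / L n - real (m n) / L n) + D / L n)
      \<longlonglongrightarrow> w * ln (z / z') - (z - z') * (l - 0 - 0) + 0"
      by (intro tendsto_intros hp_asymp const_div_L m_small)
    moreover have "eventually (\<lambda>n. w * ln (z / z') - (z - z') * (hp (x n) 0 n / L n - C / L n - real (m n) / L n) + D / L n = g n / L n) sequentially"
      using ev_ge[of 2]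
    proof eventually_elim
      case (elim n)
      have "L n \<noteq> 0" using elim by simp
      thus ?case by (simp add: g_def field_simps)
    qed
    ultimately show "(\<lambda>n. g n / L n) \<longlonglongrightarrow> w * ln (z / z') - (z - z') * (l - 0 - 0) + 0"
      using tendsto_cong by fastforce
    have lnp: "0 \<le> ln (z / z')" using z by simp
    have ln_le: "ln (z / z') \<le> (z - z') / z'"
    proof -
      have "ln (z / z') \<le> z / z' - 1" using z by (intro ln_le_minus_one) auto
      thus ?thesis using z by (simp add: diff_divide_distrib)
    qed
    have "w \<le> l * a" using la by (simp add: w_def)
    hence "w * ln (z / z') \<le> l * a * ln (z / z')" using lnp by (rule mult_right_mono)
    also have "\<dots> \<le> l * a * ((z - z') / z')" using ln_le l_pos a by (intro mult_left_mono) auto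
    also have "\<dots> = (z - z') * l * (a / z')" by (simp add: field_simps)
    \<comment> \<open>The decisive inequality is \<open>a < z'\<close>: to first order, the cost
      \<open>l a ln (z / z')\<close> of bounding heights by \<open>l a ln n\<close> is less than the
      gap \<open>l (z - z')\<close> between the growth rates for \<open>z\<close> and
      \<open>z'\<close>.\<close>
    also have "\<dots> < (z - z') * l * 1" using z l_pos by (intro mult_strict_left_mono) auto
    finally show "w * ln (z / z') - (z - z') * (l - 0 - 0) + 0 < 0" by simp
  qed
  hence "(\<lambda>n. 4 * measure_pmf.expectation (tree_law (x n) (?K n))
       (\<lambda>T. \<bar>freezing_walk.mart (x n) (m n) z (?K n) T - 1\<bar> powr q) + 2 * exp (g n)) \<longlonglongrightarrow> 4 * 0 + 2 * 0"
    by (intro tendsto_intros mlim)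
  hence lim: "(\<lambda>n. 4 * measure_pmf.expectation (tree_law (x n) (?K n))
       (\<lambda>T. \<bar>freezing_walk.mart (x n) (m n) z (?K n) T - 1\<bar> powr q) + 2 * exp (g n)) \<longlonglongrightarrow> 0" by simp
  show ?thesis
  proof (rule tendsto_sandwich[OF _ _ tendsto_const lim])
    show "eventually (\<lambda>n. measure_pmf.expectation (tree_law (x n) n) (\<lambda>T. of_bool (real (Height T) \<le> (l * f - e) * L n))
      \<le> 4 * measure_pmf.expectation (tree_law (x n) (?K n))
       (\<lambda>T. \<bar>freezing_walk.mart (x n) (m n) z (?K n) T - 1\<bar> powr q) + 2 * exp (g n)) sequentially"
      using C \<gamma>(2) floor_eps[OF \<epsilon>] ev_ge[of 1]
    proof eventually_elim
      case (elim n)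
      interpret freezing_walk "x n" n by (rule walk_ok) (use elim in simp)
      have K: "m n \<le> ?K n" "?K n \<le> n" using elim(3) by blast+
      have m1: "1 \<le> m n" using m_ge_1 elim by simp
      have "inv_sq (m n) (?K n) \<le> 1 / (\<gamma>\<^sup>2 * real (m n))"
      proof (rule inv_sq_le[OF m1 K(1) \<gamma>(1)])
        fix i assume i: "m n < i" "i \<le> ?K n"
        hence "A n \<le> real i" using m_ge_A[of n] by (meson less_imp_le of_nat_le_iff order_trans)
        thus "\<gamma> * real i \<le> S i" using elim(2) i K(2) by (simp add: W_def S_def)
      qed
      also have "\<dots> \<le> 1 / \<gamma>\<^sup>2" using m1 \<gamma>(1) by (intro divide_left_mono) auto
      finally have sq: "(z - 1)\<^sup>2 * inv_sq (m n) (?K n) \<le> D"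
        unfolding D_def by (intro mult_left_mono) auto
      have "hp (x n) 0 (m n) \<le> real (m n)"
        using hp_le_const[of "m n" 1 0] S_ge_1 K by auto
      hence "hp (x n) 0 n - C - real (m n) \<le> hp (x n) (m n) (?K n)"
        using hp_split[of 0 "m n" "?K n"] K elim(1) by simp
      hence "(z - z') * (hp (x n) 0 n - C - real (m n)) \<le> (z - z') * hp (x n) (m n) (?K n)"
        using z by (intro mult_left_mono) auto
      hence ex: "exp (w * L n * ln (z / z') - (z - z') * hp (x n) (m n) (?K n) + (z - 1)\<^sup>2 * inv_sq (m n) (?K n))
         \<le> exp (g n)" using sq unfolding g_def by (simp del: times_divide_eq_left)
      have "measure_pmf.expectation (tree_law (x n) n) (\<lambda>T. of_bool (real (Height T) \<le> w * L n))
        \<le> measure_pmf.expectation (tree_law (x n) (?K n)) (\<lambda>T. of_bool (\<forall>v\<in>verts T. real (rdep 0 T v) \<le> w * L n) :: real)"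
        by (rule height_lower_tail_le[OF K(2)])
      also have "\<dots> \<le> 4 * measure_pmf.expectation (tree_law (x n) (?K n)) (\<lambda>T. \<bar>mart (m n) z (?K n) T - 1\<bar> powr q)
        + 2 * exp (w * L n * ln (z / z') - (z - z') * hp (x n) (m n) (?K n) + (z - 1)\<^sup>2 * inv_sq (m n) (?K n))"
        by (rule no_high_vertex[OF K z(4,2) q])
      finally show ?case using ex unfolding w_def by linarith
    qed
  qed (auto intro!: always_eventually integral_nonneg_AE)
qed

lemma height_prob:
  "tendsto_prob (\<lambda>n. tree_law (x n) n) (\<lambda>n T. real (Height T) / L n) (l * f)"
  unfolding tendsto_prob_def
proof (intro allI impI)
  fix e :: real assume e: "0 < e"
  let ?U = "\<lambda>n. measure_pmf.expectation (tree_law (x n) n) (\<lambda>T. of_bool (real (Height T) > (l * f + e) * L n)) :: real"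
  let ?V = "\<lambda>n. measure_pmf.expectation (tree_law (x n) n) (\<lambda>T. of_bool (real (Height T) \<le> (l * f - e) * L n)) :: real"
  have "(\<lambda>n. ?U n + ?V n) \<longlonglongrightarrow> 0 + 0"
    by (intro tendsto_add height_upper_tendsto height_lower_tendsto e)
  hence lim: "(\<lambda>n. ?U n + ?V n) \<longlonglongrightarrow> 0" by simp
  show "(\<lambda>n. measure_pmf.prob (tree_law (x n) n) {T. \<bar>real (Height T) / L n - l * f\<bar> > e}) \<longlonglongrightarrow> 0"
  proof (rule tendsto_sandwich[OF _ _ tendsto_const lim])
    show "eventually (\<lambda>n. measure_pmf.prob (tree_law (x n) n) {T. \<bar>real (Height T) / L n - l * f\<bar> > e} \<le> ?U n + ?V n) sequentially"
      using ev_ge[of 2]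
    proof eventually_elim
      case (elim n)
      have Ln: "0 < L n" using elim by simp
      have "measure_pmf.prob (tree_law (x n) n) {T. \<bar>real (Height T) / L n - l * f\<bar> > e}
        = measure_pmf.expectation (tree_law (x n) n) (\<lambda>T. of_bool (\<bar>real (Height T) / L n - l * f\<bar> > e))"
        by (rule prob_eq_expectation)
      also have "\<dots> \<le> measure_pmf.expectation (tree_law (x n) n)
          (\<lambda>T. 1 * of_bool (real (Height T) > (l * f + e) * L n) + 1 * of_bool (real (Height T) \<le> (l * f - e) * L n) + 0)"
      proof (rule expectation_mono[OF finite_set_tree_law])
        fix T
        have "real (Height T) > (l * f + e) * L n \<or> real (Height T) \<le> (l * f - e) * L n"
          if "\<bar>real (Height T) / L n - l * f\<bar> > e"
        proof -
          have "real (Height T) / L n > l * f + e \<or> real (Height T) / L n \<le> l * f - e" using that by linarith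
          thus ?thesis using Ln by (simp add: less_divide_eq divide_le_eq)
        qed
        thus "of_bool (\<bar>real (Height T) / L n - l * f\<bar> > e)
          \<le> 1 * of_bool (real (Height T) > (l * f + e) * L n) + 1 * of_bool (real (Height T) \<le> (l * f - e) * L n) + (0 :: real)"
          by (auto simp: of_bool_def)
      qed
      also have "\<dots> = ?U n + ?V n" unfolding expectation_linear by simp
      finally show ?case .
    qed
  qed (auto intro!: always_eventually)
qed

end

theorem theorem4:
  fixes x :: "nat \<Rightarrow> nat \<Rightarrow> int" and c :: real and A :: "nat \<Rightarrow> real"
  assumes x_values: "\<forall>n\<ge>1. \<forall>i\<ge>1. x n i \<in> {-1, 1}"
    and tau_gt: "\<forall>n\<ge>1. tau (x n) > enat n"
    and c_pos: "0 < c" and c_le: "c \<le> 1"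
    and A_pos: "\<forall>n\<ge>1. A n > 0"
    and A_lim: "filterlim A at_top sequentially"
    and A_small: "A \<in> o(\<lambda>n. ln (real n))"
    and S_near: "((\<lambda>\<epsilon>::real. limsup (\<lambda>n. ereal (Max
        ((\<lambda>i. \<bar>real_of_int (walk (x n) i) / real i - c\<bar>)
          ` {i. A n \<le> real i \<and> real i \<le> \<epsilon> * real n})))) \<longlongrightarrow> 0) (at_right 0)"
    and S_bulk: "\<forall>\<epsilon>\<in>{0<..<1::real}. liminf (\<lambda>n. ereal (Min
        ((\<lambda>i. real_of_int (walk (x n) i) / real n)
          ` {i. \<epsilon> * real n \<le> real i \<and> i \<le> n}))) > 0"
  shows "(\<lambda>n. h_plus (x n) n / ln (real n)) \<longlonglongrightarrow> (c + 1) / (2 * c)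
    \<and> (\<forall>p\<ge>1.
          tendsto_Lp p (\<lambda>n. tree_vertices_law (x n) n)
            (\<lambda>n (T, v1, v2). real (vheight T v1) / ln (real n)) ((c + 1) / (2 * c))
        \<and> tendsto_Lp p (\<lambda>n. tree_vertices_law (x n) n)
            (\<lambda>n (T, v1, v2). real (gdist T v1 v2) / ln (real n)) ((c + 1) / c))
    \<and> (\<exists>!y. is_f c y)
    \<and> tendsto_prob (\<lambda>n. tree_law (x n) n)
        (\<lambda>n T. real (Height T) / ln (real n)) ((c + 1) / (2 * c) * f_sol c)"
proof -
  interpret freezing_asymptotics x c A using assms by unfold_locales
  have "(c + 1) / c = 2 * l" using c_pos by (simp add: l_def field_simps)
  moreover have "(\<lambda>n. h_plus (x n) n / ln (real n)) \<longlonglongrightarrow> l"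
    using hp_asymp unfolding hp_0_eq .
  ultimately show ?thesis
    using height_Lp distance_Lp ex1_is_f[OF c_pos c_le] height_prob
    unfolding f_def l_def[symmetric] by simp
qed

end
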